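(* Let $n\ge1$, and let $L^{(n)}$ and $\tilde L^{(n)}$ be the integral operators corresponding to any two $n$-loop box diagrams. Then $L^{(n)}=\tilde L^{(n)}$ as operators on $\mathcal H^+\otimes\mathcal H^+$.
   Context: Complexified quaternions. $\mathbb H_{\mathbb C}=\mathbb H\otimes\mathbb C$ is identified with the algebra of complex $2\times2$ matrices $Z=\begin{pmatrix}z_{11}&z_{12}\\ z_{21}&z_{22}\end{pmatrix}$, and $N(Z)=\det Z$. The holomorphic 4-form is $dV=\frac14dz_{11}\wedge dz_{12}\wedge dz_{21}\wedge dz_{22}$. For $R>0$, $U(2)_R=\{RZ: Z\in U(2)\}$, oriented so that $\int_{U(2)_R}dV/N(Z)^2=-2\pi^3i$; $\mathbb D^+_R=\{Z: ZZ^*<R^2\}$ and $\mathbb D^-_R=\{Z: ZZ^*>R^2\}$, where $Z^*$ is the conjugate transpose and the inequalities mean that $ZZ^*-R^2$ is negative, respectively positive, definite. $\mathcal H^+$ is the space of polynomials $\phi\in\mathbb C[z_{11},z_{12},z_{21},z_{22}]$ with $\bigl(\frac{\partial^2}{\partial z_{11}\partial z_{22}}-\frac{\partial^2}{\partial z_{12}\partial z_{21}}\bigr)\phi=0$. Elements of $\mathcal H^+\otimes\mathcal H^+$ are identified with polynomials in two variables, $(\phi_1\otimes\phi_2)(Z,Z')=\phi_1(Z)\phi_2(Z')$. Box diagrams. An $n$-loop box diagram is a graph with four external vertices labelled $Z_1,Z_2,W_1,W_2$, with $n$ internal vertices $T_1,\dots,T_n$, with solid edges and dashed edges (counted with multiplicity),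 and carrying a partial order $\prec$ on these $n+4$ variables, built recursively. The one-loop box diagram has one internal vertex $T_1$ joined by solid edges to $Z_1,Z_2,W_1,W_2$, no dashed edges, and order $W_1,W_2\prec T_1\prec Z_1,Z_2$. For $n\ge2$, an $n$-loop box diagram is obtained from an $(n-1)$-loop box diagram (internal vertices $T_1,\dots,T_{n-1}$) by attaching a slingshot at one of its external vertices $X\in\{Z_1,Z_2,W_1,W_2\}$: the vertex $X$ becomes internal and is relabelled $T_n$, keeping all its edges and order relations; a new external vertex labelled $X$ is added; let $\{Y,Y'\}=\{Z_2,W_2\}$ if $X\in\{Z_1,W_1\}$ and $\{Y,Y'\}=\{Z_1,W_1\}$ if $X\in\{Z_2,W_2\}$; then one adds solid edges joining $T_n$ to $X$, $Y$ and $Y'$ and one dashed edge joining $Y$ and $Y'$. The new order relations (together with those implied by transitivity) are: $W_2\prec T_n\prec Z_1,Z_2$ if $X=Z_1$; $W_1\prec T_n\prec Z_1,Z_2$ if $X=Z_2$; $W_1,W_2\prec T_n\prec Z_2$ if $X=W_1$; $W_1,W_2\prec T_n\prec Z_1$ if $X=W_2$. Diagrams differing by a permutation of the labels $T_1,\dots,T_n$ are regarded as the same. Box integrals. Given an $n$-loop box diagram, choose $r_1,\dots,r_n>0$ with $r_i<r_j$ whenever $T_i\prec T_j$. Its conformal four-point integral $l^{(n)}(Z_1,Z_2;W_1,W_2)$ is $\bigl(\frac i{2\pi^3}\bigr)^n$ times the integral over $T_1\in U(2)_{r_1},\dots,T_n\in U(2)_{r_n}$ (with respect to $dV_{T_1}\cdots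 dV_{T_n}$) of the product of a factor $N(Y-Y')^{-1}$ for each solid edge and a factor $N(Y-Y')$ for each dashed edge joining $Y$ and $Y'$. Here $Z_i\in\mathbb D^-_{r_{\max,i}}$ with $r_{\max,i}=\max\{r_k: T_k\prec Z_i\}$ and $W_i\in\mathbb D^+_{r_{\min,i}}$ with $r_{\min,i}=\min\{r_k: W_i\prec T_k\}$, $i=1,2$. The operator. Let $\widetilde{\deg}f=f+\sum_{i,j}z_{ij}\frac{\partial f}{\partial z_{ij}}$. For $\phi_1,\phi_2\in\mathcal H^+$, $R_i>r_{\max,i}$ and $W_i\in\mathbb D^+_{r_{\min,i}}$ ($i=1,2$), $$L^{(n)}(\phi_1\otimes\phi_2)(W_1,W_2)=\Bigl(\frac i{2\pi^3}\Bigr)^2\iint_{Z_1\in U(2)_{R_1},\,Z_2\in U(2)_{R_2}}l^{(n)}(Z_1,Z_2;W_1,W_2)\,(\widetilde{\deg}\phi_1)(Z_1)\,(\widetilde{\deg}\phi_2)(Z_2)\,\frac{dV_1}{N(Z_1)}\frac{dV_2}{N(Z_2)},$$ extended linearly to $\mathcal H^+\otimes\mathcal H^+$; the result (a polynomial in $W_1,W_2$) is viewed as an element of $\mathcal H^+\otimes\mathcal H^+$. *)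

theory Defs
  imports "HOL-Analysis.Analysis" "HOL-Library.Multiset" "HOL-Library.FuncSet"
begin

section \<open>Complexified quaternions\<close>

text \<open>The entry \<open>z\<^sub>i\<^sub>j\<close> is \<open>Z $ i $ j\<close>, with indices in the two-element type \<open>2\<close>;
  the norm \<open>N(Z)\<close> is \<open>det Z\<close>.\<close>

type_synonym cmat = "complex^2^2"

definition ctranspose :: "cmat \<Rightarrow> cmat" where
  "ctranspose Z = (\<chi> i j. cnj (Z $ j $ i))"

definition herm_form :: "cmat \<Rightarrow> complex^2 \<Rightarrow> complex" where
  "herm_form A v = (\<Sum>i\<in>UNIV. \<Sum>j\<in>UNIV. cnj (v $ i) * A $ i $ j * v $ j)"

text \<open>The next two notions are only applied to Hermitian matrices, for which the form is real.\<close>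

definition pos_definite :: "cmat \<Rightarrow> bool" where
  "pos_definite A \<longleftrightarrow> (\<forall>v. v \<noteq> 0 \<longrightarrow> Re (herm_form A v) > 0)"

definition neg_definite :: "cmat \<Rightarrow> bool" where
  "neg_definite A \<longleftrightarrow> (\<forall>v. v \<noteq> 0 \<longrightarrow> Re (herm_form A v) < 0)"

definition D_plus :: "real \<Rightarrow> cmat set" where
  "D_plus R = {Z. neg_definite (Z ** ctranspose Z - mat (of_real (R\<^sup>2)))}"

definition D_minus :: "real \<Rightarrow> cmat set" where
  "D_minus R = {Z. pos_definite (Z ** ctranspose Z - mat (of_real (R\<^sup>2)))}"

definition U2 :: "real \<Rightarrow> cmat set" where
  "U2 R = {R *\<^sub>R Z | Z. Z ** ctranspose Z = mat 1}"

section \<open>Integration of 4-forms over the scaled unitary group\<close>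

text \<open>The holomorphic 4-form \<open>dV\<close>, as an alternating form on tangent vectors.\<close>

definition coords :: "cmat \<Rightarrow> complex^4" where
  "coords v = vector [v $ 1 $ 1, v $ 1 $ 2, v $ 2 $ 1, v $ 2 $ 2]"

definition dV :: "cmat \<Rightarrow> cmat \<Rightarrow> cmat \<Rightarrow> cmat \<Rightarrow> complex" where
  "dV v1 v2 v3 v4 =
     1/4 * det (vector [coords v1, coords v2, coords v3, coords v4] :: complex^4^4)"

text \<open>\<open>U2 R\<close> is parametrized by \<open>(\<psi>, \<theta>, \<alpha>, \<beta>)\<close>, where \<open>\<psi>\<close> is the phase of the centre
  (running over \<open>[0, \<pi>]\<close> only, as \<open>U(2)\<close> is \<open>U(1) \<times> SU(2)\<close> modulo the common sign) and
  \<open>(\<theta>, \<alpha>, \<beta>)\<close> are Hopf coordinates on \<open>SU(2)\<close>. The map is onto (\<open>u2_param_image\<close>) and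
  injective on the interior of the box. An integral over \<open>U2 R\<close> is the integral
  of the pulled-back form; the order of the four parameters fixes the orientation, which is the
  one with \<open>\<integral> dV / N(Z)\<^sup>2 = -2\<pi>\<^sup>3i\<close> (\<open>u2_integral_orientation\<close>).\<close>

fun u2_param :: "real \<Rightarrow> real \<times> real \<times> real \<times> real \<Rightarrow> cmat" where
  "u2_param R (\<psi>, \<theta>, \<alpha>, \<beta>) = R *\<^sub>R vector
     [vector [cos \<theta> *\<^sub>R cis (\<psi> + \<alpha>), sin \<theta> *\<^sub>R cis (\<psi> + \<beta>)],
      vector [- (sin \<theta> *\<^sub>R cis (\<psi> - \<beta>)), cos \<theta> *\<^sub>R cis (\<psi> - \<alpha>)]]"

definition u2_box :: "(real \<times> real \<times> real \<times> real) set" where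
  "u2_box = {0..pi} \<times> {0..pi/2} \<times> {0..2*pi} \<times> {0..2*pi}"

fun u2_pullback :: "real \<Rightarrow> real \<times> real \<times> real \<times> real \<Rightarrow> complex" where
  "u2_pullback R (\<psi>, \<theta>, \<alpha>, \<beta>) =
     dV (vector_derivative (\<lambda>s. u2_param R (s, \<theta>, \<alpha>, \<beta>)) (at \<psi>))
        (vector_derivative (\<lambda>s. u2_param R (\<psi>, s, \<alpha>, \<beta>)) (at \<theta>))
        (vector_derivative (\<lambda>s. u2_param R (\<psi>, \<theta>, s, \<beta>)) (at \<alpha>))
        (vector_derivative (\<lambda>s. u2_param R (\<psi>, \<theta>, \<alpha>, s)) (at \<beta>))"

definition u2_integral :: "real \<Rightarrow> (cmat \<Rightarrow> complex) \<Rightarrow> complex" where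
  "u2_integral R f = (LINT t:u2_box|lborel. f (u2_param R t) * u2_pullback R t)"

lemma has_vector_derivative_cmatI:
  fixes f :: "real \<Rightarrow> cmat"
  assumes "\<And>i j. ((\<lambda>s. f s $ i $ j) has_vector_derivative f' $ i $ j) (at x)"
  shows "(f has_vector_derivative f') (at x)"
proof -
  have "((\<lambda>y. ((f y - f x) - (y - x) *\<^sub>R f') /\<^sub>R norm (y - x)) \<longlongrightarrow> 0) (at x)"
  proof (intro vec_tendstoI)
    fix i j :: 2
    show "((\<lambda>y. (((f y - f x) - (y - x) *\<^sub>R f') /\<^sub>R norm (y - x)) $ i $ j) \<longlongrightarrow> 0 $ i $ j) (at x)"
      using assms[of i j] by (simp add: has_vector_derivative_def has_derivative_at_within)
  qed
  then show ?thesis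
    by (simp add: has_vector_derivative_def has_derivative_at_within bounded_linear_scaleR_left)
qed

lemma vector_4:
  "(vector [a, b, c, d] :: 'a::zero^4) $ 1 = a" "(vector [a, b, c, d] :: 'a^4) $ 2 = b"
  "(vector [a, b, c, d] :: 'a^4) $ 3 = c" "(vector [a, b, c, d] :: 'a^4) $ 4 = d"
  by (simp_all add: vector_def)

lemma det_4:
  fixes A :: "'a::comm_ring_1^4^4"
  shows "det A =
    A$1$1 * (A$2$2 * (A$3$3 * A$4$4 - A$3$4 * A$4$3) - A$2$3 * (A$3$2 * A$4$4 - A$3$4 * A$4$2)
           + A$2$4 * (A$3$2 * A$4$3 - A$3$3 * A$4$2))
  - A$1$2 * (A$2$1 * (A$3$3 * A$4$4 - A$3$4 * A$4$3) - A$2$3 * (A$3$1 * A$4$4 - A$3$4 * A$4$1)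
           + A$2$4 * (A$3$1 * A$4$3 - A$3$3 * A$4$1))
  + A$1$3 * (A$2$1 * (A$3$2 * A$4$4 - A$3$4 * A$4$2) - A$2$2 * (A$3$1 * A$4$4 - A$3$4 * A$4$1)
           + A$2$4 * (A$3$1 * A$4$2 - A$3$2 * A$4$1))
  - A$1$4 * (A$2$1 * (A$3$2 * A$4$3 - A$3$3 * A$4$2) - A$2$2 * (A$3$1 * A$4$3 - A$3$3 * A$4$1)
           + A$2$3 * (A$3$1 * A$4$2 - A$3$2 * A$4$1))"
proof -
  have f1: "finite {2::4, 3, 4}" "1 \<notin> {2::4, 3, 4}"
    and f2: "finite {3::4, 4}" "2 \<notin> {3::4, 4}"
    and f3: "finite {4::4}" "3 \<notin> {4::4}"
    by auto
  show ?thesis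
    unfolding det_def UNIV_4
    unfolding sum_over_permutations_insert[OF f1]
    unfolding sum_over_permutations_insert[OF f2]
    unfolding sum_over_permutations_insert[OF f3]
    unfolding permutes_sing
    by (simp add: sign_swap_id permutation_swap_id sign_compose permutation_compose sign_id
        swap_id_eq algebra_simps)
qed

lemma has_vector_derivative_polar:
  assumes "(p has_real_derivative p') (at x)" "(q has_real_derivative q') (at x)"
    and "f' = of_real c * (of_real p' + \<i> * of_real (p x * q')) * cis (q x)"
  shows "((\<lambda>s. c *\<^sub>R p s *\<^sub>R cis (q s)) has_vector_derivative f') (at x)"
  unfolding has_vector_derivative_complex_iff assms(3)
  by (auto intro!: derivative_eq_intros assms(1,2) simp: algebra_simps)

lemma has_vector_derivative_cmat_polar:
  fixes f :: "real \<Rightarrow> cmat"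
  assumes "\<And>i j. (p i j has_real_derivative p' i j) (at x)"
    "\<And>i j. (q i j has_real_derivative q' i j) (at x)"
    and "\<And>s i j. f s $ i $ j = c *\<^sub>R p i j s *\<^sub>R cis (q i j s)"
    and "\<And>i j. f' $ i $ j = of_real c * (of_real (p' i j) + \<i> * of_real (p i j x * q' i j)) * cis (q i j x)"
  shows "vector_derivative f (at x) = f'"
proof (rule vector_derivative_at, rule has_vector_derivative_cmatI)
  show "((\<lambda>s. f s $ i $ j) has_vector_derivative f' $ i $ j) (at x)" for i j
    unfolding assms(3) by (rule has_vector_derivative_polar[OF assms(1,2,4)])
qed

lemma u2_param_polar:
  "u2_param R (\<psi>, \<theta>, \<alpha>, \<beta>) $ i $ j =
     R *\<^sub>R (if i = j then cos \<theta> else if i = 1 then sin \<theta> else - sin \<theta>) *\<^sub>R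
     cis (\<psi> + (if i = 1 then 1 else -1) * (if i = j then \<alpha> else \<beta>))"
  using exhaust_2[of i] exhaust_2[of j] by auto

lemma u2_pullback_eq:
  "u2_pullback R (\<psi>, \<theta>, \<alpha>, \<beta>) = - \<i> * of_real (R ^ 4 * (cos \<theta> * sin \<theta>)) * cis (4 * \<psi>)"
proof -
  let ?v = "\<lambda>a b c d. vector [vector [a, b], vector [c, d]] :: cmat"
  define a b c d where "a = cis (\<psi> + \<alpha>)" "b = cis (\<psi> + \<beta>)" "c = cis (\<psi> - \<beta>)" "d = cis (\<psi> - \<alpha>)"
  note abcd = this
  define C S r where CS: "C = complex_of_real (cos \<theta>)" "S = complex_of_real (sin \<theta>)" "r = complex_of_real R"
  have 1: "vector_derivative (\<lambda>s. u2_param R (s, \<theta>, \<alpha>, \<beta>)) (at \<psi>)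
      = ?v (\<i> * r * C * a) (\<i> * r * S * b) (- (\<i> * r * S * c)) (\<i> * r * C * d)"
    apply (rule has_vector_derivative_cmat_polar[OF _ _ u2_param_polar])
      apply (auto intro!: derivative_eq_intros)[2]
    subgoal for i j using exhaust_2[of i] exhaust_2[of j] by (auto simp: abcd CS)
    done
  have 2: "vector_derivative (\<lambda>s. u2_param R (\<psi>, s, \<alpha>, \<beta>)) (at \<theta>)
      = ?v (- (r * S * a)) (r * C * b) (- (r * C * c)) (- (r * S * d))"
    apply (rule has_vector_derivative_cmat_polar[where q' = "\<lambda>_ _. 0" and
        p' = "\<lambda>i j. if i = j then - sin \<theta> else if i = 1 then cos \<theta> else - cos \<theta>",
          OF _ _ u2_param_polar])
      apply (auto intro!: derivative_eq_intros)[2]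
    subgoal for i j using exhaust_2[of i] exhaust_2[of j] by (auto simp: abcd CS)
    done
  have 3: "vector_derivative (\<lambda>s. u2_param R (\<psi>, \<theta>, s, \<beta>)) (at \<alpha>)
      = ?v (\<i> * r * C * a) 0 0 (- (\<i> * r * C * d))"
    apply (rule has_vector_derivative_cmat_polar[where p' = "\<lambda>_ _. 0" and
        q' = "\<lambda>i j. if i = j then if i = 1 then 1 else -1 else 0",
          OF _ _ u2_param_polar])
      apply (auto intro!: derivative_eq_intros)[2]
    subgoal for i j using exhaust_2[of i] exhaust_2[of j] by (auto simp: abcd CS)
    done
  have 4: "vector_derivative (\<lambda>s. u2_param R (\<psi>, \<theta>, \<alpha>, s)) (at \<beta>)
      = ?v 0 (\<i> * r * S * b) (\<i> * r * S * c) 0"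
    apply (rule has_vector_derivative_cmat_polar[where p' = "\<lambda>_ _. 0" and
        q' = "\<lambda>i j. if i = j then 0 else if i = 1 then 1 else -1",
          OF _ _ u2_param_polar])
      apply (auto intro!: derivative_eq_intros)[2]
    subgoal for i j using exhaust_2[of i] exhaust_2[of j] by (auto simp: abcd CS)
    done
  have h1: "u2_pullback R (\<psi>, \<theta>, \<alpha>, \<beta>) = - \<i> * r ^ 4 * C * S * (C\<^sup>2 + S\<^sup>2) * (a * b * c * d)"
    unfolding u2_pullback.simps 1 2 3 4 dV_def det_4 coords_def
    by (simp add: vector_4 algebra_simps power2_eq_square power4_eq_xxxx)
  have h2: "C\<^sup>2 + S\<^sup>2 = 1"
    unfolding CS by (metis add.commute of_real_1 of_real_add of_real_power sin_cos_squared_add)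
  have h3: "a * b * c * d = cis (4 * \<psi>)"
    unfolding abcd cis_mult by (simp add: algebra_simps)
  show ?thesis
    unfolding h1 h2 h3 by (simp add: CS)
qed

lemma det_u2_param: "det (u2_param R (\<psi>, \<theta>, \<alpha>, \<beta>)) = of_real (R\<^sup>2) * cis (2 * \<psi>)"
proof -
  have "det (u2_param R (\<psi>, \<theta>, \<alpha>, \<beta>)) =
      of_real (R\<^sup>2) * ((of_real (cos \<theta>))\<^sup>2 + (of_real (sin \<theta>))\<^sup>2) * cis (2 * \<psi>)"
    unfolding det_2 u2_param_polar
    by (simp add: scaleR_conv_of_real power2_eq_square algebra_simps cis_mult)
  also have "(complex_of_real (cos \<theta>))\<^sup>2 + (of_real (sin \<theta>))\<^sup>2 = 1"
    by (metis add.commute of_real_1 of_real_add of_real_power sin_cos_squared_add)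
  finally show ?thesis by simp
qed

lemma u2_integral_orientation:
  assumes "R > 0"
  shows "u2_integral R (\<lambda>Z. 1 / (det Z)\<^sup>2) = - 2 * of_real (pi ^ 3) * \<i>"
proof -
  let ?f = "\<lambda>(\<psi>::real, \<theta>, \<alpha>::real, \<beta>::real). - \<i> * of_real (cos \<theta> * sin \<theta>)"
  have eq: "1 / (det (u2_param R t))\<^sup>2 * u2_pullback R t = ?f t" for t
  proof -
    obtain \<psi> \<theta> \<alpha> \<beta> where t: "t = (\<psi>, \<theta>, \<alpha>, \<beta>)" by (cases t)
    have "(cis (2 * \<psi>))\<^sup>2 = cis (4 * \<psi>)"
      by (simp add: power2_eq_square cis_mult)
    then show ?thesis
      using assms unfolding t u2_pullback_eq det_u2_param
      by (simp add: power_mult_distrib field_simps)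
  qed
  have box: "u2_box = cbox (0, 0, 0, 0) (pi, pi/2, 2*pi, 2*pi)"
    by (simp add: u2_box_def cbox_Pair_eq)
  have cont: "continuous_on UNIV ?f"
    unfolding case_prod_beta' by (intro continuous_intros)
  have "u2_integral R (\<lambda>Z. 1 / (det Z)\<^sup>2) = (LINT t:u2_box|lborel. ?f t)"
    unfolding u2_integral_def eq ..
  also have "\<dots> = integral u2_box ?f"
    unfolding box set_lebesgue_integral_def[symmetric]
    by (rule set_borel_integral_eq_integral, unfold set_integrable_def,
        rule borel_integrable_compact, rule compact_cbox,
        rule continuous_on_subset[OF cont], simp)
  also have "\<dots> = integral (cbox 0 pi) (\<lambda>\<psi>::real. integral (cbox 0 (pi/2)) (\<lambda>\<theta>::real.
      integral (cbox 0 (2*pi)) (\<lambda>\<alpha>::real. integral (cbox 0 (2*pi)) (\<lambda>\<beta>::real.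
        - \<i> * of_real (cos \<theta> * sin \<theta>)))))"
  proof -
    let ?g = "\<lambda>(\<theta>, \<alpha>::real, \<beta>::real). - \<i> * of_real (cos \<theta> * sin \<theta>)"
    let ?h = "\<lambda>\<theta> (\<alpha>::real, \<beta>::real). - \<i> * of_real (cos \<theta> * sin \<theta>)"
    have g: "continuous_on A ?g" and h: "continuous_on B (?h \<theta>)" for A B \<theta>
      unfolding case_prod_beta' by (intro continuous_intros)+
    have 1: "integral (cbox (0, 0, 0, 0) (pi, pi/2, 2*pi, 2*pi)) ?f =
        integral (cbox 0 pi) (\<lambda>\<psi>. integral (cbox (0, 0, 0) (pi/2, 2*pi, 2*pi)) ?g)"
      using integral_prod_continuous[OF continuous_on_subset[OF cont]] by simp
    have 2: "integral (cbox (0, 0, 0) (pi/2, 2*pi, 2*pi)) ?g =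
        integral (cbox 0 (pi/2)) (\<lambda>\<theta>. integral (cbox (0, 0) (2*pi, 2*pi)) (?h \<theta>))"
      by (subst integral_prod_continuous[OF g]) (simp only: prod.case)
    have 3: "integral (cbox (0, 0) (2*pi, 2*pi)) (?h \<theta>) =
        integral (cbox 0 (2*pi)) (\<lambda>\<alpha>::real. integral (cbox 0 (2*pi)) (\<lambda>\<beta>::real.
          - \<i> * of_real (cos \<theta> * sin \<theta>)))" for \<theta>
      by (subst integral_prod_continuous[OF h]) (simp only: prod.case)
    show ?thesis unfolding box 1 2 3 by (rule refl)
  qed
  also have "\<dots> = - 2 * of_real (pi ^ 3) * \<i>"
  proof -
    have "((\<lambda>\<theta>. - \<i> * of_real (cos \<theta> * sin \<theta>) * of_real (4 * pi\<^sup>2)) has_integral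
        (- \<i> * of_real ((sin (pi/2))\<^sup>2/2) * of_real (4 * pi\<^sup>2) - (- \<i> * of_real ((sin 0)\<^sup>2/2) * of_real (4 * pi\<^sup>2)))) {0..pi/2}"
      by (rule fundamental_theorem_of_calculus)
         (auto simp: has_vector_derivative_complex_iff power2_eq_square intro!: derivative_eq_intros)
    then have "integral {0..pi/2} (\<lambda>\<theta>. - \<i> * of_real (cos \<theta> * sin \<theta>) * of_real (4 * pi\<^sup>2)) = - \<i> * of_real (2 * pi\<^sup>2)"
      by (intro integral_unique) (simp add: mult_ac)
    then show ?thesis
      by (simp add: scaleR_conv_of_real power2_eq_square power3_eq_cube mult_ac)
  qed
  finally show ?thesis .
qed

lemma u2_param_image: "u2_param R ` u2_box = U2 R"
proof (intro equalityI subsetI)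
  fix Z assume "Z \<in> u2_param R ` u2_box"
  then obtain \<psi> \<theta> \<alpha> \<beta> where Z: "Z = u2_param R (\<psi>, \<theta>, \<alpha>, \<beta>)" by (metis imageE prod_cases4)
  have cs: "(complex_of_real (cos \<theta>))\<^sup>2 + (of_real (sin \<theta>))\<^sup>2 = 1"
    by (metis add.commute of_real_1 of_real_add of_real_power sin_cos_squared_add)
  have "u2_param 1 (\<psi>, \<theta>, \<alpha>, \<beta>) ** ctranspose (u2_param 1 (\<psi>, \<theta>, \<alpha>, \<beta>)) = mat 1"
    using cs unfolding vec_eq_iff forall_2 ctranspose_def matrix_matrix_mult_def mat_def sum_2
    by (simp add: scaleR_conv_of_real cis_cnj cis_mult power2_eq_square algebra_simps)
  then show "Z \<in> U2 R"
    unfolding Z U2_def by (auto intro!: exI[of _ "u2_param 1 (\<psi>, \<theta>, \<alpha>, \<beta>)"])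
next
  fix Z assume "Z \<in> U2 R"
  then obtain U where Z: "Z = R *\<^sub>R U" and U: "U ** ctranspose U = mat 1"
    unfolding U2_def by auto
  let ?a = "U $ 1 $ 1" and ?b = "U $ 1 $ 2" and ?c = "U $ 2 $ 1" and ?d = "U $ 2 $ 2"
  have eqs: "?a * cnj ?a + ?b * cnj ?b = 1" "?c * cnj ?a + ?d * cnj ?b = 0"
    "?c * cnj ?c + ?d * cnj ?d = 1"
    using U unfolding vec_eq_iff forall_2 ctranspose_def matrix_matrix_mult_def mat_def sum_2 by auto
  define \<Delta> where "\<Delta> = ?a * ?d - ?b * ?c"
  have d: "?d = \<Delta> * cnj ?a" and c: "?c = - \<Delta> * cnj ?b"
    unfolding \<Delta>_def using eqs(1,2) by algebra+
  have "\<Delta> * cnj \<Delta> = ?c * cnj ?c + ?d * cnj ?d"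
    unfolding c d using eqs(1) by (simp add: algebra_simps) algebra
  then have "complex_of_real ((norm \<Delta>)\<^sup>2) = 1"
    using eqs(3) by (simp add: complex_norm_square del: of_real_power)
  then have "norm \<Delta> = 1"
    by (metis norm_ge_zero of_real_eq_1_iff power2_eq_1_iff zero_le_one abs_norm_cancel abs_1 abs_minus_cancel)
  define \<psi> where "\<psi> = Arg2pi \<Delta> / 2"
  define \<theta> where "\<theta> = arccos (norm ?a)"
  define \<alpha> where "\<alpha> = Arg2pi (?a * cis (- \<psi>))"
  define \<beta> where "\<beta> = Arg2pi (?b * cis (- \<psi>))"
  have polar: "z = of_real (norm z) * cis (\<psi> + Arg2pi (z * cis (- \<psi>)))" for z
  proof -
    have "z * cis (- \<psi>) * cis \<psi> = of_real (norm z) * cis (Arg2pi (z * cis (- \<psi>))) * cis \<psi>"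
      using Arg2pi_eq[of "z * cis (- \<psi>)"] by (simp add: norm_mult cis_conv_exp)
    then show ?thesis
      by (simp add: mult.assoc cis_mult add.commute)
  qed
  have \<Delta>: "\<Delta> = cis (2 * \<psi>)"
    using Arg2pi_eq[of \<Delta>] \<open>norm \<Delta> = 1\<close> by (simp add: \<psi>_def cis_conv_exp)
  have "complex_of_real ((norm ?a)\<^sup>2 + (norm ?b)\<^sup>2) = 1"
    using eqs(1) by (simp add: complex_norm_square del: of_real_power)
  then have n: "(norm ?a)\<^sup>2 + (norm ?b)\<^sup>2 = 1"
    using of_real_eq_1_iff by blast
  then have "norm ?a \<le> 1"
    by (metis abs_norm_cancel abs_square_le_1 le_add_same_cancel1 zero_le_power2)
  have "- 1 \<le> norm ?a"
    using norm_ge_zero[of ?a] by linarith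
  then have cos: "cos \<theta> = norm ?a"
    using \<open>norm ?a \<le> 1\<close> by (simp add: \<theta>_def cos_arccos)
  have sin: "sin \<theta> = norm ?b"
    using \<open>norm ?a \<le> 1\<close> \<open>- 1 \<le> norm ?a\<close> n
    by (simp add: \<theta>_def sin_arccos real_sqrt_unique)
  have "(\<psi>, \<theta>, \<alpha>, \<beta>) \<in> u2_box"
  proof -
    have "0 \<le> \<theta>" "\<theta> \<le> pi / 2"
      using \<open>norm ?a \<le> 1\<close> \<open>- 1 \<le> norm ?a\<close>
        arccos_lbound[of "norm ?a"] arccos_le_pi2[of "norm ?a"] norm_ge_zero[of ?a]
      unfolding \<theta>_def by blast+
    moreover have "0 \<le> Arg2pi z \<and> Arg2pi z \<le> 2 * pi" for z
      using Arg2pi_ge_0 Arg2pi_lt_2pi less_imp_le by blast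
    ultimately show ?thesis
      by (simp add: u2_box_def \<psi>_def \<alpha>_def \<beta>_def mult.commute)
  qed
  moreover have "U = u2_param 1 (\<psi>, \<theta>, \<alpha>, \<beta>)"
  proof -
    have a: "?a = of_real (cos \<theta>) * cis (\<psi> + \<alpha>)" and b: "?b = of_real (sin \<theta>) * cis (\<psi> + \<beta>)"
      unfolding cos sin \<alpha>_def \<beta>_def by (rule polar)+
    have "?d = of_real (cos \<theta>) * cis (\<psi> - \<alpha>)" "?c = - (of_real (sin \<theta>) * cis (\<psi> - \<beta>))"
      unfolding c d unfolding a b \<Delta> by (simp_all add: cis_cnj cis_mult)
    with a b show ?thesis
      by (simp add: vec_eq_iff forall_2 scaleR_conv_of_real)
  qed
  then have "Z = u2_param R (\<psi>, \<theta>, \<alpha>, \<beta>)"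
    unfolding Z by simp
  ultimately show "Z \<in> u2_param R ` u2_box"
    by blast
qed

text \<open>Integral over \<open>T\<^sub>1 \<in> U2 (r 1), \<dots>, T\<^sub>n \<in> U2 (r n)\<close>; the integrand is given the family
  \<open>\<tau>\<close> with \<open>\<tau> k = T\<^sub>k\<close> for \<open>1 \<le> k \<le> n\<close>.\<close>

primrec u2_multi_integral ::
  "nat \<Rightarrow> (nat \<Rightarrow> real) \<Rightarrow> ((nat \<Rightarrow> cmat) \<Rightarrow> complex) \<Rightarrow> complex" where
  "u2_multi_integral 0 r f = f (\<lambda>_. 0)"
| "u2_multi_integral (Suc n) r f =
     u2_integral (r (Suc n)) (\<lambda>T. u2_multi_integral n r (\<lambda>\<tau>. f (\<tau>(Suc n := T))))"

section \<open>Harmonic polynomials\<close>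

text \<open>Polynomials over the infinite field \<open>\<complex>\<close> are identified with polynomial functions.\<close>

definition poly_functions :: "(cmat \<Rightarrow> complex) set" where
  "poly_functions = {\<phi>. \<exists>(d::nat) c. \<phi> = (\<lambda>Z. \<Sum>i\<le>d. \<Sum>j\<le>d. \<Sum>k\<le>d. \<Sum>l\<le>d.
     c i j k l * (Z $ 1 $ 1) ^ i * (Z $ 1 $ 2) ^ j * (Z $ 2 $ 1) ^ k * (Z $ 2 $ 2) ^ l)}"

definition pderiv_entry :: "2 \<Rightarrow> 2 \<Rightarrow> (cmat \<Rightarrow> complex) \<Rightarrow> cmat \<Rightarrow> complex" where
  "pderiv_entry i j f Z =
     deriv (\<lambda>w. f (\<chi> a b. if a = i \<and> b = j then w else Z $ a $ b)) (Z $ i $ j)"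

definition harmonic_polys :: "(cmat \<Rightarrow> complex) set" where
  "harmonic_polys = {\<phi> \<in> poly_functions. \<forall>Z.
     pderiv_entry 1 1 (pderiv_entry 2 2 \<phi>) Z - pderiv_entry 1 2 (pderiv_entry 2 1 \<phi>) Z = 0}"

definition deg_tilde :: "(cmat \<Rightarrow> complex) \<Rightarrow> cmat \<Rightarrow> complex" where
  "deg_tilde f Z = f Z + (\<Sum>i\<in>UNIV. \<Sum>j\<in>UNIV. Z $ i $ j * pderiv_entry i j f Z)"

definition tensor :: "(cmat \<Rightarrow> complex) \<Rightarrow> (cmat \<Rightarrow> complex) \<Rightarrow> cmat \<Rightarrow> cmat \<Rightarrow> complex" where
  "tensor \<phi>1 \<phi>2 = (\<lambda>Z Z'. \<phi>1 Z * \<phi>2 Z')"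

definition harmonic_tensors :: "(cmat \<Rightarrow> cmat \<Rightarrow> complex) set" where
  "harmonic_tensors = {F. \<exists>(m::nat) \<phi> \<psi>. (\<forall>k<m. \<phi> k \<in> harmonic_polys \<and> \<psi> k \<in> harmonic_polys) \<and>
     F = (\<lambda>Z Z'. \<Sum>k<m. tensor (\<phi> k) (\<psi> k) Z Z')}"

section \<open>Box diagrams\<close>

datatype corner = CZ1 | CZ2 | CW1 | CW2

datatype vertex = Outer corner | Inner nat

text \<open>An edge is recorded as a pair in an arbitrary orientation: \<open>det (A - B) = det (B - A)\<close> for
  2-by-2 matrices. The strict partial order is the set of pairs \<open>(u, v)\<close> with \<open>u \<prec> v\<close>.\<close>

record diagram =
  solid :: "(vertex \<times> vertex) multiset"
  dashed :: "(vertex \<times> vertex) multiset"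
  prec :: "(vertex \<times> vertex) set"

definition one_loop :: diagram where
  "one_loop = \<lparr>
     solid = {#(Inner 1, Outer CZ1), (Inner 1, Outer CZ2),
               (Inner 1, Outer CW1), (Inner 1, Outer CW2)#},
     dashed = {#},
     prec = {(Outer CW1, Inner 1), (Outer CW2, Inner 1),
             (Inner 1, Outer CZ1), (Inner 1, Outer CZ2)}\<^sup>+\<rparr>"

fun neighbours :: "corner \<Rightarrow> corner \<times> corner" where
  "neighbours CZ1 = (CZ2, CW2)"
| "neighbours CW1 = (CZ2, CW2)"
| "neighbours CZ2 = (CZ1, CW1)"
| "neighbours CW2 = (CZ1, CW1)"

fun new_prec :: "nat \<Rightarrow> corner \<Rightarrow> (vertex \<times> vertex) set" where
  "new_prec n CZ1 = {(Outer CW2, Inner n), (Inner n, Outer CZ1), (Inner n, Outer CZ2)}"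
| "new_prec n CZ2 = {(Outer CW1, Inner n), (Inner n, Outer CZ1), (Inner n, Outer CZ2)}"
| "new_prec n CW1 = {(Outer CW1, Inner n), (Outer CW2, Inner n), (Inner n, Outer CZ2)}"
| "new_prec n CW2 = {(Outer CW1, Inner n), (Outer CW2, Inner n), (Inner n, Outer CZ1)}"

definition relabel :: "nat \<Rightarrow> corner \<Rightarrow> vertex \<Rightarrow> vertex" where
  "relabel n X = id(Outer X := Inner n)"

definition slingshot :: "nat \<Rightarrow> corner \<Rightarrow> diagram \<Rightarrow> diagram" where
  "slingshot n X D = (case neighbours X of (Y, Y') \<Rightarrow> \<lparr>
     solid = image_mset (map_prod (relabel n X) (relabel n X)) (solid D)
       + {#(Inner n, Outer X), (Inner n, Outer Y), (Inner n, Outer Y')#},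
     dashed = image_mset (map_prod (relabel n X) (relabel n X)) (dashed D)
       + {#(Outer Y, Outer Y')#},
     prec = (map_prod (relabel n X) (relabel n X) ` prec D \<union> new_prec n X)\<^sup>+\<rparr>)"

text \<open>Internal vertices are numbered in the order of their creation. Every diagram has such a
  numbering, and renumbering it only renames the integration variables.\<close>

inductive box_diagram :: "nat \<Rightarrow> diagram \<Rightarrow> bool" where
  one: "box_diagram 1 one_loop"
| step: "box_diagram n D \<Longrightarrow> box_diagram (Suc n) (slingshot (Suc n) X D)"

section \<open>Box integrals and box operators\<close>

fun place :: "cmat \<Rightarrow> cmat \<Rightarrow> cmat \<Rightarrow> cmat \<Rightarrow> (nat \<Rightarrow> cmat) \<Rightarrow> vertex \<Rightarrow> cmat" where
  "place Z1 Z2 W1 W2 \<tau> (Outer CZ1) = Z1"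
| "place Z1 Z2 W1 W2 \<tau> (Outer CZ2) = Z2"
| "place Z1 Z2 W1 W2 \<tau> (Outer CW1) = W1"
| "place Z1 Z2 W1 W2 \<tau> (Outer CW2) = W2"
| "place Z1 Z2 W1 W2 \<tau> (Inner k) = \<tau> k"

definition box_integrand :: "diagram \<Rightarrow> (vertex \<Rightarrow> cmat) \<Rightarrow> complex" where
  "box_integrand D p =
     (\<Prod>(u, v)\<in>#solid D. inverse (det (p u - p v))) * (\<Prod>(u, v)\<in>#dashed D. det (p u - p v))"

definition box_integral ::
  "nat \<Rightarrow> diagram \<Rightarrow> (nat \<Rightarrow> real) \<Rightarrow> cmat \<Rightarrow> cmat \<Rightarrow> cmat \<Rightarrow> cmat \<Rightarrow> complex" where
  "box_integral n D r Z1 Z2 W1 W2 = (\<i> / of_real (2 * pi ^ 3)) ^ n *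
     u2_multi_integral n r (\<lambda>\<tau>. box_integrand D (place Z1 Z2 W1 W2 \<tau>))"

definition admissible_radii :: "nat \<Rightarrow> diagram \<Rightarrow> (nat \<Rightarrow> real) \<Rightarrow> bool" where
  "admissible_radii n D r \<longleftrightarrow> (\<forall>k\<in>{1..n}. r k > 0) \<and>
     (\<forall>j\<in>{1..n}. \<forall>k\<in>{1..n}. (Inner j, Inner k) \<in> prec D \<longrightarrow> r j < r k)"

text \<open>\<open>r_max\<close> is used at the corners \<open>CZ1\<close>, \<open>CZ2\<close> and \<open>r_min\<close> at \<open>CW1\<close>, \<open>CW2\<close>, where the sets
  are nonempty for box diagrams.\<close>

definition r_max :: "nat \<Rightarrow> diagram \<Rightarrow> (nat \<Rightarrow> real) \<Rightarrow> corner \<Rightarrow> real" where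
  "r_max n D r X = Max (r ` {k \<in> {1..n}. (Inner k, Outer X) \<in> prec D})"

definition r_min :: "nat \<Rightarrow> diagram \<Rightarrow> (nat \<Rightarrow> real) \<Rightarrow> corner \<Rightarrow> real" where
  "r_min n D r X = Min (r ` {k \<in> {1..n}. (Outer X, Inner k) \<in> prec D})"

text \<open>For \<open>R1\<close>, \<open>R2\<close> as in \<open>is_box_operator\<close> below, \<open>U2 R1\<close> and \<open>U2 R2\<close> lie in the domains
  \<open>D_minus (r_max n D r CZ1)\<close> and \<open>D_minus (r_max n D r CZ2)\<close> of \<open>box_integral\<close> in \<open>Z1\<close>, \<open>Z2\<close>.\<close>

definition box_operator_integral ::
  "nat \<Rightarrow> diagram \<Rightarrow> (nat \<Rightarrow> real) \<Rightarrow> real \<Rightarrow> real \<Rightarrow>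
   (cmat \<Rightarrow> complex) \<Rightarrow> (cmat \<Rightarrow> complex) \<Rightarrow> cmat \<Rightarrow> cmat \<Rightarrow> complex" where
  "box_operator_integral n D r R1 R2 \<phi>1 \<phi>2 W1 W2 = (\<i> / of_real (2 * pi ^ 3))\<^sup>2 *
     u2_integral R1 (\<lambda>Z1. u2_integral R2 (\<lambda>Z2.
       box_integral n D r Z1 Z2 W1 W2 * deg_tilde \<phi>1 Z1 * deg_tilde \<phi>2 Z2 / det Z1 / det Z2))"

text \<open>\<open>L\<close> is a linear endomorphism of the space of harmonic tensors (made a total function by
  extensionality) that is given by the integral on pure tensors, for every choice of radii.\<close>

definition is_box_operator ::
  "nat \<Rightarrow> diagram \<Rightarrow> ((cmat \<Rightarrow> cmat \<Rightarrow> complex) \<Rightarrow> cmat \<Rightarrow> cmat \<Rightarrow> complex) \<Rightarrow> bool" where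
  "is_box_operator n D L \<longleftrightarrow>
     L \<in> harmonic_tensors \<rightarrow>\<^sub>E harmonic_tensors \<and>
     (\<forall>F\<in>harmonic_tensors. \<forall>G\<in>harmonic_tensors.
        L (\<lambda>Z Z'. F Z Z' + G Z Z') = (\<lambda>W W'. L F W W' + L G W W')) \<and>
     (\<forall>c. \<forall>F\<in>harmonic_tensors. L (\<lambda>Z Z'. c * F Z Z') = (\<lambda>W W'. c * L F W W')) \<and>
     (\<forall>\<phi>1\<in>harmonic_polys. \<forall>\<phi>2\<in>harmonic_polys. \<forall>r R1 R2 W1 W2.
        admissible_radii n D r \<and> R1 > r_max n D r CZ1 \<and> R2 > r_max n D r CZ2 \<and>
        W1 \<in> D_plus (r_min n D r CW1) \<and> W2 \<in> D_plus (r_min n D r CW2) \<longrightarrow>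
        L (tensor \<phi>1 \<phi>2) W1 W2 = box_operator_integral n D r R1 R2 \<phi>1 \<phi>2 W1 W2)"

definition box_operator ::
  "nat \<Rightarrow> diagram \<Rightarrow> (cmat \<Rightarrow> cmat \<Rightarrow> complex) \<Rightarrow> cmat \<Rightarrow> cmat \<Rightarrow> complex" where
  "box_operator n D = (THE L. is_box_operator n D L)"

end

theory Submission
  imports Defs
begin

text \<open>Put \<open>a = N(Z\<^sub>1 - W\<^sub>2) N(Z\<^sub>2 - W\<^sub>1)\<close>, \<open>b = N(Z\<^sub>1 - W\<^sub>1) N(Z\<^sub>2 - W\<^sub>2)\<close>,
  \<open>c = N(Z\<^sub>1 - Z\<^sub>2) N(W\<^sub>1 - W\<^sub>2)\<close> and \<open>Q\<^sub>s = (1 - s) a + s b - s (1 - s) c\<close>. The integral of every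
  \<open>n\<close>-loop box diagram, for all admissible radii, is the integral of \<open>1 / Q\<^sub>s\<close> over
  \<open>s = s\<^sub>1 \<cdots> s\<^sub>n\<close>, \<open>(s\<^sub>1, \<dots>, s\<^sub>n) \<in> [0, 1]\<^sup>n\<close>, which does not see the diagram.

  As a function of one of the four points, \<open>Q\<^sub>s\<close> is a multiple of \<open>N(T - P\<^sub>s)\<close>, where \<open>P\<^sub>s\<close> moves along
  a conformal line between two of the other points, inside the same domain. Hence a slingshot amounts to a
  one-loop integral with one vertex moved to \<open>P\<^sub>s\<close>, and replaces \<open>Q\<^sub>s\<close> by the integral over \<open>Q\<^sub>s\<^sub>t\<close>,
  irrespective of the vertex. The one-loop integral itself follows by differentiation in \<open>s\<close>: the two
  resulting integrals are evaluated by contracting the contour inside \<open>\<D>\<^sup>+\<close> and inside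
  \<open>\<D>\<^sup>-\<close>, which is justified by Stokes' theorem on \<open>U(2)\<^sub>R\<close>.\<close>

section \<open>Bounded matrices\<close>

text \<open>Behind \<open>Q_s\<close> stands the null cone. A point X is the null vector (1, X,
  N(X)) of a six-dimensional space, on which N(X - Y) is, up to a factor, the pairing of two such
  vectors. Three points span a space that meets the cone in a conic: this is the conformal line, and
  pairing its point with a fourth one gives \<open>Q_s\<close>. The main obstacle is that
  \<open>P_s\<close> must stay strictly on the correct side of the contour for every s in [0, 1].
  This becomes visible after the third point has been sent to infinity: the line turns into a
  segment and the domain into a convex set. Outer points Z enter through A = Z^(-1), that is through
  \<open>contr (1/R) A\<close>. A singular A stands for a point at infinity, which a moving outer
  point may well reach. A second obstacle is that the admissible radii depend on the partial order,
  hence on the diagram. Two facts deal with it: the vertex created last always lies above both W's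
  and below both Z's, so its contour separates all four outer points; and the radii of one diagram
  can be chosen inside the window that the data of another diagram leave open.\<close>

definition contr :: "real \<Rightarrow> cmat \<Rightarrow> bool" where
  "contr \<rho> M \<longleftrightarrow> (\<forall>v. v \<noteq> 0 \<longrightarrow> norm (v v* M) < \<rho> * norm v)"

lemma contrD: "contr \<rho> M \<Longrightarrow> v \<noteq> 0 \<Longrightarrow> norm (v v* M) < \<rho> * norm v"
  by (simp add: contr_def)

lemma contr_le: "contr \<rho> M \<Longrightarrow> norm (v v* M) \<le> \<rho> * norm v"
  by (cases "v = 0") (auto simp: contr_def less_imp_le)

lemma cmat_eq_iff: "(A :: cmat) = B \<longleftrightarrow>
    A$1$1 = B$1$1 \<and> A$1$2 = B$1$2 \<and> A$2$1 = B$2$1 \<and> A$2$2 = B$2$2"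
  by (auto simp: vec_eq_iff forall_2)

lemma cvec_eq_iff: "(v :: complex^2) = w \<longleftrightarrow> v$1 = w$1 \<and> v$2 = w$2"
  by (auto simp: vec_eq_iff forall_2)

lemma mat_entry [simp]: "(mat c :: cmat) $ 1 $ 1 = c" "(mat c :: cmat) $ 1 $ 2 = 0"
    "(mat c :: cmat) $ 2 $ 1 = 0" "(mat c :: cmat) $ 2 $ 2 = c"
  by (simp_all add: mat_def)

lemma mult_entry: "((A :: cmat) ** B) $ i $ j = A $ i $ 1 * B $ 1 $ j + A $ i $ 2 * B $ 2 $ j"
  by (simp add: matrix_matrix_mult_def sum_2)

lemma vmult_entry: "((v :: complex^2) v* A) $ j = v $ 1 * A $ 1 $ j + v $ 2 * A $ 2 $ j"
  by (simp add: vector_matrix_mult_def sum_2 mult.commute)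

lemma vmult_assoc: "((v :: complex^2) v* A) v* B = v v* (A ** B)"
  by (rule vector_matrix_mul_assoc)

lemma vmult_diff: "(v :: complex^2) v* (A - B) = v v* A - v v* B"
  by (simp add: cvec_eq_iff vmult_entry algebra_simps)

lemma vmult_add: "(v :: complex^2) v* (A + B) = v v* A + v v* B"
  by (simp add: cvec_eq_iff vmult_entry algebra_simps)

lemma vmult_scale: "(v :: complex^2) v* (s *\<^sub>R (A :: cmat)) = s *\<^sub>R (v v* A)"
  by (simp add: cvec_eq_iff vmult_entry scaleR_right_distrib)

lemma vmult_1: "(v :: complex^2) v* mat 1 = v"
  by (simp add: cvec_eq_iff vmult_entry)

lemma vmult_0: "0 v* (A :: cmat) = 0"
  by (simp add: cvec_eq_iff vmult_entry)

lemma norm_cvec_sq: "(norm (v :: complex^2))\<^sup>2 = (norm (v$1))\<^sup>2 + (norm (v$2))\<^sup>2"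
  by (simp add: norm_vec_def L2_set_def sum_2)

lemma det_zero_kernel:
  assumes "det (M :: cmat) = 0"
  obtains v :: "complex^2" where "v \<noteq> 0" "v v* M = 0"
proof -
  \<comment> \<open>Up to sign and order, \<open>?u\<close> and \<open>?w\<close> are the rows of
    the adjugate. Both vanish only for M = 0, where any vector serves.\<close>
  let ?u = "vector [M$2$1, - M$1$1] :: complex^2" and ?w = "vector [M$2$2, - M$1$2] :: complex^2"
    and ?e = "vector [1, 0] :: complex^2"
  have 1: "?u v* M = 0" "?w v* M = 0"
    using assms by (simp_all add: cvec_eq_iff vmult_entry det_2 algebra_simps)
  show ?thesis
  proof (cases "?u = 0 \<and> ?w = 0")
    case True
    then have "?e v* M = 0" "?e \<noteq> 0"
      by (simp_all add: cvec_eq_iff vmult_entry)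
    then show ?thesis using that by blast
  next
    case False
    then show ?thesis using 1 that by blast
  qed
qed

lemma det_nonzeroI:
  assumes "\<And>v :: complex^2. v \<noteq> 0 \<Longrightarrow> v v* M \<noteq> 0"
  shows "det (M :: cmat) \<noteq> 0"
  using det_zero_kernel assms by metis

text \<open>The form has its conjugate on the left and Z stands to the left of its conjugate
  transpose, so conjugating the vector turns the form into the length of a row vector times Z. This
  is why matrices act on row vectors throughout.\<close>

lemma norm_vmult_sq:
  fixes v :: "complex^2"
  shows "Re (herm_form (Z ** ctranspose Z - mat (of_real c)) (\<chi> i. cnj (v $ i)))
    = (norm (v v* Z))\<^sup>2 - c * (norm v)\<^sup>2"
  unfolding norm_cvec_sq herm_form_def ctranspose_def
  by (simp add: sum_2 mult_entry vmult_entry cmod_power2 algebra_simps)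
     (simp add: power2_eq_square algebra_simps)

lemma all_cnj_vec: "(\<forall>v::complex^2. v \<noteq> 0 \<longrightarrow> P v) \<longleftrightarrow> (\<forall>v. v \<noteq> 0 \<longrightarrow> P (\<chi> i. cnj (v $ i)))"
proof (intro iffI allI impI)
  fix v :: "complex^2" assume "\<forall>v. v \<noteq> 0 \<longrightarrow> P v" "v \<noteq> 0"
  moreover have "(\<chi> i. cnj (v $ i)) \<noteq> 0"
    using \<open>v \<noteq> 0\<close> by (simp add: cvec_eq_iff)
  ultimately show "P (\<chi> i. cnj (v $ i))" by blast
next
  fix v :: "complex^2" assume *: "\<forall>v. v \<noteq> 0 \<longrightarrow> P (\<chi> i. cnj (v $ i))" "v \<noteq> 0"
  then have "(\<chi> i. cnj (v $ i)) \<noteq> 0" by (simp add: cvec_eq_iff)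
  with * have "P (\<chi> i. cnj ((\<chi> i. cnj (v $ i)) $ i))" by blast
  then show "P v" by simp
qed

lemma D_plus_iff:
  assumes "R > 0"
  shows "Z \<in> D_plus R \<longleftrightarrow> contr R Z"
proof -
  have "(norm (v v* Z))\<^sup>2 - R\<^sup>2 * (norm v)\<^sup>2 < 0 \<longleftrightarrow> norm (v v* Z) < R * norm v" for v
    using assms abs_square_less_1 power2_less_imp_less[of "norm (v v* Z)" "R * norm v"]
      power_strict_mono[of "norm (v v* Z)" "R * norm v" 2]
    by (auto simp: power_mult_distrib)
  then show ?thesis
    unfolding D_plus_def contr_def neg_definite_def mem_Collect_eq
    by (subst all_cnj_vec) (simp only: norm_vmult_sq)
qed

lemma D_minus_iff:
  assumes "R > 0"
  shows "Z \<in> D_minus R \<longleftrightarrow> (\<forall>v. v \<noteq> 0 \<longrightarrow> norm (v v* Z) > R * norm v)"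
proof -
  have "(norm (v v* Z))\<^sup>2 - R\<^sup>2 * (norm v)\<^sup>2 > 0 \<longleftrightarrow> norm (v v* Z) > R * norm v" for v
    using assms power2_less_imp_less[of "R * norm v" "norm (v v* Z)"]
      power_strict_mono[of "R * norm v" "norm (v v* Z)" 2]
    by (auto simp: power_mult_distrib)
  then show ?thesis
    unfolding D_minus_def pos_definite_def mem_Collect_eq
    by (subst all_cnj_vec) (simp only: norm_vmult_sq)
qed

lemma norm_vmult_U2:
  assumes "R > 0" "T \<in> U2 R"
  shows "norm (v v* T) = R * norm v"
proof -
  obtain U where T: "T = R *\<^sub>R U" and U: "U ** ctranspose U = mat 1"
    using assms unfolding U2_def by auto
  have "Re (herm_form (U ** ctranspose U - mat (of_real 1)) (\<chi> i. cnj (v $ i))) = 0"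
    unfolding U herm_form_def by simp
  then have "norm (v v* U) = norm v"
    unfolding norm_vmult_sq by simp
  then show ?thesis
    unfolding T vmult_scale using assms by simp
qed

lemma inverse_cmat:
  assumes "det (M :: cmat) \<noteq> 0"
  obtains B where "M ** B = mat 1" "B ** M = mat 1"
  using assms invertible_det_nz[of M] unfolding invertible_def by blast

lemma convex_gap:
  fixes x1 x2 y1 y2 :: "'a::real_inner"
  assumes "0 \<le> s" "s \<le> 1"
  shows "(norm ((1-s) *\<^sub>R x2 + s *\<^sub>R x1))\<^sup>2
    = (1-s) * (norm x2)\<^sup>2 + s * (norm x1)\<^sup>2 - s * (1-s) * (norm (x1 - x2))\<^sup>2"
  unfolding power2_norm_eq_inner
  by (simp add: inner_simps inner_commute algebra_simps)

text \<open>A left kernel vector v would satisfy v W A = v, but W followed by A strictly shortens v.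
  With A the inverse of an outer point Z, this is the separation of Z from W.\<close>

lemma contr_1_minus:
  assumes "\<rho> > 0" "contr (1/\<rho>) A" "contr \<rho> W"
  shows "det (mat 1 - W ** A) \<noteq> 0"
proof (rule det_nonzeroI)
  fix v :: "complex^2" assume v: "v \<noteq> 0"
  have "norm ((v v* W) v* A) \<le> 1/\<rho> * norm (v v* W)" by (rule contr_le[OF assms(2)])
  also have "\<dots> < 1/\<rho> * (\<rho> * norm v)"
    using contrD[OF assms(3) v] assms(1) by (intro mult_strict_left_mono) auto
  also have "\<dots> = norm v" using assms(1) by simp
  finally have "(v v* W) v* A \<noteq> v" by auto
  then show "v v* (mat 1 - W ** A) \<noteq> 0"
    by (simp add: vmult_diff vmult_1 vmult_assoc)
qed

lemma det_1_minus_comm: "det (mat 1 - A ** B) = det (mat 1 - B ** (A :: cmat))"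
  by (simp add: det_2 mult_entry algebra_simps)

lemma contr_1_minus':
  assumes "\<rho> > 0" "contr (1/\<rho>) A" "contr \<rho> W"
  shows "det (mat 1 - A ** W) \<noteq> 0"
  using contr_1_minus[OF assms] det_1_minus_comm by metis

lemma det_1_minus_U2:
  assumes "\<rho> > 0" "contr (1/\<rho>) A" "T \<in> U2 \<rho>"
  shows "det (mat 1 - A ** T) \<noteq> 0"
proof (rule det_nonzeroI)
  fix v :: "complex^2" assume v: "v \<noteq> 0"
  have "norm ((v v* A) v* T) < norm v"
    using contrD[OF assms(2) v] assms(1)
    unfolding norm_vmult_U2[OF assms(1,3)] by (simp add: field_simps)
  then have "(v v* A) v* T \<noteq> v" by auto
  then show "v v* (mat 1 - A ** T) \<noteq> 0"
    by (simp add: vmult_diff vmult_1 vmult_assoc)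
qed

lemma det_diff_U2:
  assumes "\<rho> > 0" "contr \<rho> W" "T \<in> U2 \<rho>"
  shows "det (T - W) \<noteq> 0"
proof (rule det_nonzeroI)
  fix v :: "complex^2" assume v: "v \<noteq> 0"
  have "v v* T \<noteq> v v* W"
    using contrD[OF assms(2) v] norm_vmult_U2[OF assms(1,3), of v] by auto
  then show "v v* (T - W) \<noteq> 0"
    by (simp add: vmult_diff)
qed

section \<open>Polarized determinants and conformal lines\<close>

definition adj :: "cmat \<Rightarrow> cmat" where
  "adj M = vector [vector [M$2$2, - M$1$2], vector [- M$2$1, M$1$1]]"

text \<open>The polarization of the determinant.\<close>

definition pdet :: "cmat \<Rightarrow> cmat \<Rightarrow> complex" where
  "pdet M H = M$2$2 * H$1$1 - M$1$2 * H$2$1 - M$2$1 * H$1$2 + M$1$1 * H$2$2"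

definition csc :: "complex \<Rightarrow> cmat \<Rightarrow> cmat" where
  "csc c M = (\<chi> i j. c * M $ i $ j)"

lemma csc_entry [simp]: "csc c M $ i $ j = c * M $ i $ j"
  by (simp add: csc_def)

lemma adj_entry [simp]: "adj M $ 1 $ 1 = M$2$2" "adj M $ 1 $ 2 = - M$1$2"
   "adj M $ 2 $ 1 = - M$2$1" "adj M $ 2 $ 2 = M$1$1"
  by (simp_all add: adj_def)


lemma matrix_diff: "(A :: cmat) ** (B - C :: cmat) = A ** B - A ** C"
  unfolding cmat_eq_iff by (simp add: mult_entry algebra_simps)

lemma det_minus: "det (A - B) = det A - pdet B A + det (B :: cmat)"
  by (simp add: det_2 pdet_def algebra_simps)

lemma det_combination:
  "det (csc x U + csc y V + csc z K) = x\<^sup>2 * det U + y\<^sup>2 * det V + z\<^sup>2 * det K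
     + x * y * pdet U V + x * z * pdet U K + y * z * pdet V K"
  by (simp add: det_2 pdet_def power2_eq_square algebra_simps)

text \<open>The point on the conformal line through \<open>W1\<close>, \<open>W2\<close> and \<open>A\<^sup>-\<^sup>1\<close>.\<close>

lemma conformal_combination:
  fixes A W1 W2 :: cmat and s :: complex
  defines "x \<equiv> (1-s) * det (mat 1 - A ** W1)" and "y \<equiv> s * det (mat 1 - A ** W2)"
    and "z \<equiv> - s * (1-s) * det (W1 - W2)"
  defines "e \<equiv> x + y + z * det A"
    and "M \<equiv> csc x W2 + csc y W1 + csc z (adj A)"
  assumes e: "e \<noteq> 0"
  shows "e * det (G ** csc (1/e) M - H) =
    x * det (G ** W2 - H) + y * det (G ** W1 - H) + z * det (G - H ** A)"
proof -
  define f where "f = x * det W2 + y * det W1 + z"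
  define b t1 t2 d n1 n2 where "b = pdet W2 W1" "t1 = pdet (adj A) W1" "t2 = pdet (adj A) W2"
    "d = det A" "n1 = det W1" "n2 = det W2"
  note bdefs = this
  have d1: "det (mat 1 - A ** W) = 1 - pdet (adj A) W + det A * det W" for W
    by (simp add: det_2 pdet_def mult_entry algebra_simps)
  have sym: "pdet U V = pdet V U" for U V
    by (simp add: pdet_def algebra_simps)
  have dadj: "det (adj A) = d" by (simp add: det_2 bdefs)
  \<comment> \<open>\<open>(e, M, f)\<close> is the combination, with weights x, y, z, of the null
    vectors of W2, W1 and A^(-1), the last one rescaled to (det A, adj A, 1). It is null again
    because x y N(W1 - W2) + x z N(1 - A W2) + y z N(1 - A W1) = 0, which is how the weights are
    chosen. The quadratic term det G det M below thus loses one factor e and the result is linear in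
    the three vectors.\<close>
  have null: "det M = e * f"
    unfolding M_def det_combination dadj e_def f_def x_def y_def z_def d1
    unfolding det_minus sym[of W1 W2] sym[of _ "adj A"] bdefs[symmetric]
    by algebra
  have "e * det (G ** csc (1/e) M - H) = det (G ** M - csc e H) / e"
    using e by (simp add: det_2 mult_entry field_simps)
  also have "det (G ** M - csc e H) = det G * det M - e * pdet (adj (adj H ** G)) M + e\<^sup>2 * det H"
    by (simp add: det_2 pdet_def mult_entry power2_eq_square algebra_simps)
  also have "\<dots> / e = det G * f - pdet (adj (adj H ** G)) M + e * det H"
    unfolding null using e by (simp add: field_simps power2_eq_square)
  also have "\<dots> = x * det (G ** W2 - H) + y * det (G ** W1 - H) + z * det (G - H ** A)"
    unfolding f_def M_def e_def
    by (simp add: det_2 pdet_def mult_entry algebra_simps)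
  finally show ?thesis .
qed


text \<open>For K = 1 - T A and U_i = T - W_i one has K + U_i A = 1 - W_i A. The identity is then
  the cross term of \<open>det_pencil\<close>, cleared of denominators.\<close>

lemma pdet_adj_identity:
  fixes K U1 U2 A :: cmat
  shows "pdet (adj (K + U2 ** A) ** U2) (adj (K + U1 ** A) ** U1) =
    det (K + U1 ** A) * det U2 + det (K + U2 ** A) * det U1 - det K * det (U1 - U2)"
proof -
  have 1: "adj (K + U ** A) ** U = adj K ** U + csc (det U) (adj A)" for U
    by (simp add: cmat_eq_iff mult_entry det_2 algebra_simps)
  have 2: "det (K + U ** A) = det K + pdet K (U ** A) + det U * det A" for U
    by (simp add: mult_entry det_2 pdet_def algebra_simps)
  have 3: "pdet (V + csc u L) (V' + csc u' L) = pdet V V' + u' * pdet L V + u * pdet L V' + 2 * u * u' * det L"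
    for V V' L u u' by (simp add: pdet_def det_2 algebra_simps)
  have 4: "pdet (adj K ** U2) (adj K ** U1) = det K * pdet U2 U1"
    by (simp add: mult_entry det_2 pdet_def algebra_simps)
  have 5: "pdet (adj A) (adj K ** U) = pdet K (U ** A)" for U
    by (simp add: mult_entry pdet_def algebra_simps)
  have 6: "det (adj A) = det A" by (simp add: det_2)
  show ?thesis unfolding 1 2 3 4 5 6 det_minus by (simp add: algebra_simps)
qed

text \<open>The pencil has the shape E T - F, so the three-term form on the right is a multiple of
  N(T - P) with P = E^(-1) F. Unlike the description of P by null vectors, this one allows norm
  estimates.\<close>

lemma det_pencil:
  fixes A W1 W2 Y1 Y2 T :: cmat and s :: complex
  assumes Y: "Y1 ** (mat 1 - W1 ** A) = mat 1" "Y2 ** (mat 1 - W2 ** A) = mat 1"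
  defines "N1 \<equiv> det (mat 1 - W1 ** A)" and "N2 \<equiv> det (mat 1 - W2 ** A)"
  shows "N1 * N2 * det (csc (1-s) (Y2 ** (T - W2)) + csc s (Y1 ** (T - W1))) =
    (1-s) * N1 * det (T - W2) + s * N2 * det (T - W1) - s * (1-s) * det (W1 - W2) * det (mat 1 - T ** A)"
proof -
  have adj: "csc (det M) Y = adj M" if "Y ** M = mat 1" for Y M :: cmat
  proof -
    have "csc (det M) Y = Y ** (M ** adj M)"
      by (simp add: cmat_eq_iff mult_entry det_2 algebra_simps)
    then show ?thesis unfolding matrix_mul_assoc that by simp
  qed
  have detY: "det Y1 * N1 = 1" "det Y2 * N2 = 1"
    using Y unfolding N1_def N2_def by (metis det_mul det_I)+
  have M: "mat 1 - W1 ** A = (mat 1 - T ** A) + (T - W1) ** A"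
      "mat 1 - W2 ** A = (mat 1 - T ** A) + (T - W2) ** A"
    by (simp_all add: cmat_eq_iff mult_entry algebra_simps)
  have "N1 * N2 * pdet (Y2 ** (T - W2)) (Y1 ** (T - W1)) =
      pdet (csc N2 Y2 ** (T - W2)) (csc N1 Y1 ** (T - W1))"
    by (simp add: pdet_def mult_entry algebra_simps)
  also have "\<dots> = N1 * det (T - W2) + N2 * det (T - W1) - det (mat 1 - T ** A) * det ((T - W1) - (T - W2))"
    unfolding N1_def N2_def adj[OF Y(1)] adj[OF Y(2)] unfolding M by (rule pdet_adj_identity)
  finally have p: "N1 * N2 * pdet (Y2 ** (T - W2)) (Y1 ** (T - W1)) = \<dots>" .
  have W: "det ((T - W1) - (T - W2)) = det (W1 - W2)"
    by (simp add: det_2 algebra_simps)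
  have e: "det (csc p U + csc q V) = p\<^sup>2 * det U + q\<^sup>2 * det V + p * q * pdet U V" for p q U V
    by (simp add: det_2 pdet_def power2_eq_square algebra_simps)
  show ?thesis
    using p detY unfolding e det_mul W by algebra
qed

text \<open>Serves to identify the two descriptions of the point of a conformal line, by a pencil
  and by a null combination.\<close>

lemma det_diff_inject:
  fixes P P' :: cmat
  assumes "\<And>T. det (T - P) = det (T - P')"
  shows "P = P'"
proof -
  have 0: "det P = det P'"
    using assms[of 0] by (simp add: det_2)
  have p: "pdet P T = pdet P' T" for T
    using assms[of T] 0 unfolding det_minus by simp
  have "P $ i $ j = P' $ i $ j" for i j
    using p[of "vector [vector [1, 0], vector [0, 0]]"] p[of "vector [vector [0, 1], vector [0, 0]]"]
      p[of "vector [vector [0, 0], vector [1, 0]]"] p[of "vector [vector [0, 0], vector [0, 1]]"]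
      exhaust_2[of i] exhaust_2[of j]
    by (auto simp: pdet_def)
  then show ?thesis by (simp add: vec_eq_iff)
qed

text \<open>For fixed \<open>v\<close>, the form \<open>\<rho>\<^sup>2 |v + y A|\<^sup>2 - |y|\<^sup>2\<close> is concave in \<open>y\<close>.\<close>

lemma pencil_bound:
  fixes x1 x2 y1 y2 v :: "complex^2"
  assumes \<rho>: "\<rho> > 0" and A: "contr (1/\<rho>) A" and s: "0 \<le> s" "s \<le> 1"
    and x: "x1 = v + y1 v* A" "x2 = v + y2 v* A"
    and y: "norm y1 < \<rho> * norm x1" "norm y2 < \<rho> * norm x2"
  shows "norm ((1-s) *\<^sub>R y2 + s *\<^sub>R y1) < \<rho> * norm ((1-s) *\<^sub>R x2 + s *\<^sub>R x1)"
proof -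
  have sq: "(norm y1)\<^sup>2 < \<rho>\<^sup>2 * (norm x1)\<^sup>2" "(norm y2)\<^sup>2 < \<rho>\<^sup>2 * (norm x2)\<^sup>2"
    using power_strict_mono[OF y(1) norm_ge_zero, of 2] power_strict_mono[OF y(2) norm_ge_zero, of 2]
    by (simp_all add: power_mult_distrib)
  have "x1 - x2 = (y1 - y2) v* A"
    unfolding x by (simp add: vector_matrix_mult_diff_distrib)
  then have "\<rho> * norm (x1 - x2) \<le> norm (y1 - y2)"
    using contr_le[OF A, of "y1 - y2"] \<rho> by (simp add: field_simps)
  then have d: "\<rho>\<^sup>2 * (norm (x1 - x2))\<^sup>2 \<le> (norm (y1 - y2))\<^sup>2"
    using \<rho> power_mono[of "\<rho> * norm (x1 - x2)" _ 2] by (simp add: power_mult_distrib)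
  \<comment> \<open>The correction terms of \<open>convex_gap\<close> combine with a favourable sign
    because A is a contraction, so the strict inequalities at the end points carry over.\<close>
  have "(norm ((1-s) *\<^sub>R y2 + s *\<^sub>R y1))\<^sup>2 < \<rho>\<^sup>2 * (norm ((1-s) *\<^sub>R x2 + s *\<^sub>R x1))\<^sup>2"
  proof -
    have "0 < (1-s) * (\<rho>\<^sup>2 * (norm x2)\<^sup>2 - (norm y2)\<^sup>2) + s * (\<rho>\<^sup>2 * (norm x1)\<^sup>2 - (norm y1)\<^sup>2)"
    proof (cases "s = 0")
      case False
      then have "0 < s * (\<rho>\<^sup>2 * (norm x1)\<^sup>2 - (norm y1)\<^sup>2)"
        using sq s by simp
      moreover have "0 \<le> (1-s) * (\<rho>\<^sup>2 * (norm x2)\<^sup>2 - (norm y2)\<^sup>2)"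
        using sq s by simp
      ultimately show ?thesis by linarith
    qed (use sq in simp)
    moreover have "0 \<le> s * (1-s) * ((norm (y1 - y2))\<^sup>2 - \<rho>\<^sup>2 * (norm (x1 - x2))\<^sup>2)"
      using d s by simp
    ultimately show ?thesis
      unfolding convex_gap[OF s] by (simp add: algebra_simps)
  qed
  then show ?thesis
    using \<rho> power2_less_imp_less[of _ "\<rho> * norm ((1-s) *\<^sub>R x2 + s *\<^sub>R x1)"]
    by (simp add: power_mult_distrib)
qed

text \<open>The map W -> (1 - W A)^(-1) W sends A^(-1) to infinity and the conformal line to a
  segment. \<open>F\<close> is the point of this segment, E = 1 + F A is the denominator of the
  inverse map, and \<open>pencil_bound\<close> is the convexity of the image of the inner domain.
  The pair G, H stands for the point G^(-1) H, so that finite points and inverses of outer points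
  are treated alike.\<close>

lemma conformal_point:
  fixes A W1 W2 :: cmat and s :: real
  assumes \<rho>: "\<rho> > 0" and A: "contr (1/\<rho>) A" and W: "contr \<rho> W1" "contr \<rho> W2"
    and s: "0 \<le> s" "s \<le> 1"
  obtains P e where "contr \<rho> P" "e \<noteq> 0"
    "\<And>G H. e * det (G ** P - H) = (1-s) * det (mat 1 - A ** W1) * det (G ** W2 - H)
       + s * det (mat 1 - A ** W2) * det (G ** W1 - H)
       - s * (1-s) * det (W1 - W2) * det (G - H ** A)"
proof -
  define N1 N2 where N: "N1 = det (mat 1 - W1 ** A)" "N2 = det (mat 1 - W2 ** A)"
  have N0: "N1 \<noteq> 0" "N2 \<noteq> 0"
    using contr_1_minus[OF \<rho> A] W unfolding N by auto
  obtain Y1 where Y1: "Y1 ** (mat 1 - W1 ** A) = mat 1"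
    using inverse_cmat N0 unfolding N by metis
  obtain Y2 where Y2: "Y2 ** (mat 1 - W2 ** A) = mat 1"
    using inverse_cmat N0 unfolding N by metis
  define E F where "E = (1-s) *\<^sub>R Y2 + s *\<^sub>R Y1" "F = (1-s) *\<^sub>R (Y2 ** W2) + s *\<^sub>R (Y1 ** W1)"
  note EF = this
  have bound: "norm (v v* F) < \<rho> * norm (v v* E)" if "v \<noteq> 0" for v
  proof -
    have x: "v v* Y = v + (v v* (Y ** W)) v* A" if "Y ** (mat 1 - W ** A) = mat 1" for Y W
    proof -
      have "Y - (Y ** W) ** A = mat 1"
        using that by (simp add: matrix_mul_assoc cmat_eq_iff mult_entry algebra_simps)
      then have "v v* (Y - (Y ** W) ** A) = v" by (simp add: vmult_1)
      then show ?thesis unfolding vmult_diff vmult_assoc by (simp add: algebra_simps)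
    qed
    have y: "norm (v v* (Y ** W)) < \<rho> * norm (v v* Y)" if "Y ** (mat 1 - W ** A) = mat 1" "contr \<rho> W" for Y W
    proof -
      have "v v* Y \<noteq> 0"
      proof
        assume "v v* Y = 0"
        then have "(v v* Y) v* (mat 1 - W ** A) = 0" by (simp add: vmult_0)
        then show False using \<open>v \<noteq> 0\<close> unfolding vmult_assoc that vmult_1 by simp
      qed
      then show ?thesis using contrD[OF that(2)] by (simp add: vmult_assoc[symmetric])
    qed
    show ?thesis
      using pencil_bound[OF \<rho> A s x[OF Y1] x[OF Y2] y[OF Y1 W(1)] y[OF Y2 W(2)]]
      unfolding EF vmult_add vmult_scale .
  qed
  have "det E \<noteq> 0"
  proof (rule det_nonzeroI)
    fix v :: "complex^2" assume "v \<noteq> 0"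
    then show "v v* E \<noteq> 0" using bound[of v] by auto
  qed
  then obtain E' where E': "E ** E' = mat 1" "E' ** E = mat 1"
    using inverse_cmat by metis
  define P where "P = E' ** F"
  have P: "contr \<rho> P"
    unfolding contr_def
  proof (intro allI impI)
    fix v :: "complex^2" assume v: "v \<noteq> 0"
    have "v v* E' \<noteq> 0"
    proof
      assume "v v* E' = 0"
      then have "(v v* E') v* E = 0" by (simp add: vmult_0)
      then show False using v unfolding vmult_assoc E' vmult_1 by simp
    qed
    from bound[OF this] show "norm (v v* P) < \<rho> * norm v"
      unfolding P_def vmult_assoc E' vmult_1 .
  qed
  define R where "R = (\<lambda>T. (1-s) * N1 * det (T - W2) + s * N2 * det (T - W1)
     - s * (1-s) * det (W1 - W2) * det (mat 1 - T ** A))"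
  have EFs: "E ** T - F = csc (1-s) (Y2 ** (T - W2)) + csc s (Y1 ** (T - W1))" for T
    unfolding EF by (simp add: cmat_eq_iff mult_entry) (simp add: scaleR_conv_of_real algebra_simps)
  have R: "R T = N1 * N2 * det (E ** T - F)" for T
    unfolding EFs R_def N using det_pencil[OF Y1 Y2, of "of_real s" T] by simp
  have N': "det (mat 1 - A ** W1) = N1" "det (mat 1 - A ** W2) = N2"
    unfolding N by (simp_all add: det_1_minus_comm)
  define e where "e = (1-s) * N1 + s * N2 - s * (1-s) * det (W1 - W2) * det A"
  \<comment> \<open>This second difference extracts the coefficient of det T: it is \<open>e\<close>
    in the three-term form and N1 N2 det E in the pencil.\<close>
  have "2 * e = R (mat 1) + R (mat (-1)) - 2 * R 0"
    unfolding R_def e_def by (simp add: det_2 mult_entry algebra_simps)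
  also have "\<dots> = 2 * (N1 * N2 * det E)"
    unfolding R by (simp add: det_2 mult_entry algebra_simps)
  finally have e: "e = N1 * N2 * det E" by simp
  then have e0: "e \<noteq> 0" using N0 \<open>det E \<noteq> 0\<close> by simp
  define M where "M = csc ((1-s) * N1) W2 + csc (s * N2) W1 + csc (- s * (1-s) * det (W1 - W2)) (adj A)"
  have comb: "e * det (G ** csc (1/e) M - H) = (1-s) * N1 * det (G ** W2 - H)
       + s * N2 * det (G ** W1 - H) - s * (1-s) * det (W1 - W2) * det (G - H ** A)" for G H
    using conformal_combination[of "of_real s" A W1 W2 G H] e0
    unfolding N' e_def M_def by simp
  have "P = csc (1/e) M"
  proof (rule det_diff_inject)
    fix T
    have "det E * det (T - P) = det (E ** T - (E ** E') ** F)"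
      unfolding P_def det_mul[symmetric] by (simp add: matrix_mul_assoc matrix_diff)
    then have "e * det (T - P) = R T"
      unfolding E' R e by simp
    also have "\<dots> = e * det (mat 1 ** csc (1/e) M - T)"
      unfolding comb unfolding R_def by (simp add: det_2 algebra_simps)
    also have "\<dots> = e * det (T - csc (1/e) M)"
      by (simp add: det_2 algebra_simps)
    finally show "det (T - P) = det (T - csc (1/e) M)"
      using e0 by simp
  qed
  with comb that[OF P e0] show ?thesis unfolding N' by simp
qed

section \<open>Stokes' theorem on the scaled unitary group\<close>

abbreviation cont4 :: "(real \<Rightarrow> real \<Rightarrow> real \<Rightarrow> real \<Rightarrow> complex) \<Rightarrow> bool" where
  "cont4 f \<equiv> continuous_on UNIV (\<lambda>(a, b, c, d). f a b c d)"

lemma u2_box_cbox: "u2_box = cbox (0, 0, 0, 0) (pi, pi/2, 2*pi, 2*pi)"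
  by (simp add: u2_box_def cbox_Pair_eq)

lemma cont4_compose:
  assumes "cont4 f" "continuous_on S g1" "continuous_on S g2" "continuous_on S g3" "continuous_on S g4"
  shows "continuous_on S (\<lambda>x. f (g1 x) (g2 x) (g3 x) (g4 x))"
  using continuous_on_compose2[OF assms(1) continuous_on_Pair[OF assms(2)
      continuous_on_Pair[OF assms(3) continuous_on_Pair[OF assms(4,5)]]]] by simp

lemma integral_FTC_fst:
  fixes g g' :: "real \<Rightarrow> 'b::euclidean_space \<Rightarrow> complex"
  assumes cont: "continuous_on UNIV (\<lambda>(x, y). g' x y)" and "a \<le> b"
    and deriv: "\<And>x y. ((\<lambda>x. g x y) has_vector_derivative g' x y) (at x)"
  shows "integral (cbox (a, c) (b, d)) (\<lambda>(x, y). g' x y) = integral (cbox c d) (\<lambda>y. g b y - g a y)"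
proof -
  have cont': "continuous_on (cbox (a, c) (b, d)) (\<lambda>(x, y). g' x y)"
    using cont continuous_on_subset by blast
  have "integral (cbox (a, c) (b, d)) (\<lambda>(x, y). g' x y) =
      integral (cbox c d) (\<lambda>y. integral (cbox a b) (\<lambda>x. g' x y))"
    using integral_prod_continuous[OF cont'] integral_swap_continuous[OF cont'] by simp
  moreover have "integral (cbox a b) (\<lambda>x. g' x y) = g b y - g a y" for y
    using fundamental_theorem_of_calculus[OF \<open>a \<le> b\<close>, of "\<lambda>x. g x y" "\<lambda>x. g' x y"] deriv
    by (auto simp: has_vector_derivative_at_within intro!: integral_unique)
  ultimately show ?thesis by simp
qed

lemma integral_periodic_shift:
  fixes p :: "real \<Rightarrow> complex"
  assumes cont: "continuous_on UNIV p" and per: "\<And>x. p (x + 2*pi) = p x"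
  shows "integral {0..2*pi} (\<lambda>x. p (x + pi)) = integral {0..2*pi} p"
proof -
  have int: "p integrable_on {a..b}" for a b
    using cont continuous_on_subset integrable_continuous_interval by blast
  have "integral {0..2*pi} (\<lambda>x. p (x + pi)) = integral {pi..3*pi} p"
    using integral_shift_real_ivl[of pi pi "3*pi" p] by simp
  also have "\<dots> = integral {pi..2*pi} p + integral {2*pi..3*pi} p"
    using Henstock_Kurzweil_Integration.integral_combine[OF _ _ int, of pi "2*pi" "3*pi"] by simp
  also have "integral {2*pi..3*pi} p = integral {0..pi} p"
    using integral_shift_real_ivl[of "2*pi" "2*pi" "3*pi" p] per by simp
  also have "integral {pi..2*pi} p + integral {0..pi} p = integral {0..2*pi} p"
    using Henstock_Kurzweil_Integration.integral_combine[OF _ _ int, of 0 pi "2*pi"] by (simp add: add.commute)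
  finally show ?thesis .
qed

lemma integral_periodic_shift2:
  fixes p :: "real \<Rightarrow> real \<Rightarrow> complex"
  assumes cont: "continuous_on UNIV (\<lambda>(x, y). p x y)"
    and per: "\<And>x y. p (x + 2*pi) y = p x y" "\<And>x y. p x (y + 2*pi) = p x y"
  shows "integral (cbox (0,0) (2*pi,2*pi)) (\<lambda>(x, y). p (x + pi) (y + pi)) =
    integral (cbox (0,0) (2*pi,2*pi)) (\<lambda>(x, y). p x y)"
proof -
  have slice: "continuous_on S (\<lambda>t. p (g t) (h t))" if "continuous_on S g" "continuous_on S h"
    for S :: "'c::topological_space set" and g h
    using continuous_on_compose2[OF cont continuous_on_Pair[OF that]] by simp
  have "integral (cbox (0,0) (2*pi,2*pi)) (\<lambda>(x, y). p (x + pi) (y + pi)) =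
      integral {0..2*pi} (\<lambda>x. integral {0..2*pi} (\<lambda>y. p (x + pi) (y + pi)))"
    by (subst integral_prod_continuous)
       (auto simp: case_prod_beta' intro!: slice continuous_intros)
  also have "\<dots> = integral {0..2*pi} (\<lambda>x. integral {0..2*pi} (\<lambda>y. p (x + pi) y))"
    by (subst integral_periodic_shift) (auto simp: per intro!: slice continuous_intros)
  also have "\<dots> = integral {0..2*pi} (\<lambda>x. integral {0..2*pi} (\<lambda>y. p x y))"
  proof (rule integral_periodic_shift)
    show "continuous_on UNIV (\<lambda>x. integral {0..2*pi} (\<lambda>y. p x y))"
      using integral_continuous_on_param[of UNIV 0 "2*pi" p] continuous_on_subset[OF cont]
      by simp
  qed (simp add: per)
  also have "\<dots> = integral (cbox (0,0) (2*pi,2*pi)) (\<lambda>(x, y). p x y)"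
    by (subst integral_prod_continuous)
       (auto simp: case_prod_beta' intro!: slice continuous_intros)
  finally show ?thesis .
qed

text \<open>The faces \<open>a = 0\<close> and \<open>a = pi\<close> carry the same values only
  after a shift of both other angles by pi, the trace of the common sign in U(1) x SU(2).
  Integration over full periods absorbs the shift.\<close>

lemma box_integral_d1:
  assumes P: "cont4 P" and P': "cont4 P'"
    and deriv: "\<And>a b c d. ((\<lambda>a. P a b c d) has_vector_derivative P' a b c d) (at a)"
    and per: "\<And>a b c d. P a b (c + 2*pi) d = P a b c d" "\<And>a b c d. P a b c (d + 2*pi) = P a b c d"
      "\<And>a b c d. P (a + pi) b c d = P a b (c + pi) (d + pi)"
  shows "integral u2_box (\<lambda>(a, b, c, d). P' a b c d) = 0"
proof -
  note slice = cont4_compose[OF P]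
  have "integral u2_box (\<lambda>(a, b, c, d). P' a b c d) =
      integral (cbox (0,0,0) (pi/2,2*pi,2*pi)) (\<lambda>(b, c, d). P pi b c d - P 0 b c d)"
    using integral_FTC_fst[of "\<lambda>a (b, c, d). P' a b c d" 0 pi "\<lambda>a (b, c, d). P a b c d"] P' deriv
    unfolding u2_box_cbox by (simp add: case_prod_beta')
  also have "\<dots> = integral (cbox (0,0,0) (pi/2,2*pi,2*pi)) (\<lambda>(b, c, d). P 0 b (c + pi) (d + pi) - P 0 b c d)"
    using per(3)[of 0] by simp
  also have "\<dots> = integral (cbox 0 (pi/2)) (\<lambda>b. integral (cbox (0,0) (2*pi,2*pi))
      (\<lambda>(c, d). P 0 b (c + pi) (d + pi) - P 0 b c d))"
    by (subst integral_prod_continuous)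
       (auto simp: case_prod_beta' intro!: continuous_intros slice)
  finally have "integral u2_box (\<lambda>(a, b, c, d). P' a b c d) = \<dots>" .
  moreover have "integral (cbox (0,0) (2*pi,2*pi)) (\<lambda>(c, d). P 0 b (c + pi) (d + pi) - P 0 b c d) = 0" for b
  proof -
    have "integral (cbox (0,0) (2*pi,2*pi)) (\<lambda>(c, d). P 0 b (c + pi) (d + pi) - P 0 b c d) =
      integral (cbox (0,0) (2*pi,2*pi)) (\<lambda>(c, d). P 0 b (c + pi) (d + pi)) -
      integral (cbox (0,0) (2*pi,2*pi)) (\<lambda>(c, d). P 0 b c d)"
      unfolding case_prod_beta'
      by (intro Henstock_Kurzweil_Integration.integral_diff integrable_continuous continuous_intros slice)
    also have "\<dots> = 0"
      by (subst integral_periodic_shift2)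
         (auto simp: per case_prod_beta' intro!: continuous_intros slice)
    finally show ?thesis .
  qed
  ultimately show ?thesis by simp
qed

text \<open>The Hopf coordinates degenerate at \<open>b = 0\<close> and \<open>b = pi/2\<close>.
  There is no opposite face to cancel against, and the potential itself has to vanish on these
  two.\<close>

lemma box_integral_d2:
  assumes P': "cont4 P'"
    and deriv: "\<And>a b c d. ((\<lambda>b. P a b c d) has_vector_derivative P' a b c d) (at b)"
    and zero: "\<And>a c d. P a 0 c d = 0" "\<And>a c d. P a (pi/2) c d = 0"
  shows "integral u2_box (\<lambda>(a, b, c, d). P' a b c d) = 0"
proof -
  note slice = cont4_compose[OF P']
  have "integral u2_box (\<lambda>(a, b, c, d). P' a b c d) =
      integral (cbox 0 pi) (\<lambda>a. integral (cbox (0,0,0) (pi/2,2*pi,2*pi)) (\<lambda>(b, c, d). P' a b c d))"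
    unfolding u2_box_cbox
    by (subst integral_prod_continuous) (auto simp: case_prod_beta' intro!: continuous_intros slice)
  moreover have "integral (cbox (0,0,0) (pi/2,2*pi,2*pi)) (\<lambda>(b, c, d). P' a b c d) = 0" for a
  proof -
    have "continuous_on UNIV (\<lambda>(b, y). P' a b (fst y) (snd y))"
      unfolding case_prod_beta' by (intro slice continuous_intros)
    from integral_FTC_fst[OF this, of 0 "pi/2" "\<lambda>b y. P a b (fst y) (snd y)"] deriv zero
    show ?thesis by (simp add: case_prod_beta')
  qed
  ultimately show ?thesis by simp
qed

lemma box_integral_d3:
  assumes P': "cont4 P'"
    and deriv: "\<And>a b c d. ((\<lambda>c. P a b c d) has_vector_derivative P' a b c d) (at c)"
    and per: "\<And>a b d. P a b (2*pi) d = P a b 0 d"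
  shows "integral u2_box (\<lambda>(a, b, c, d). P' a b c d) = 0"
proof -
  note slice = cont4_compose[OF P']
  have "integral u2_box (\<lambda>(a, b, c, d). P' a b c d) =
      integral (cbox 0 pi) (\<lambda>a. integral (cbox (0,0,0) (pi/2,2*pi,2*pi)) (\<lambda>(b, c, d). P' a b c d))"
    unfolding u2_box_cbox
    by (subst integral_prod_continuous) (auto simp: case_prod_beta' intro!: continuous_intros slice)
  moreover have "integral (cbox (0,0,0) (pi/2,2*pi,2*pi)) (\<lambda>(b, c, d). P' a b c d) = 0" for a
  proof -
    have "integral (cbox (0,0,0) (pi/2,2*pi,2*pi)) (\<lambda>(b, c, d). P' a b c d) =
      integral (cbox 0 (pi/2)) (\<lambda>b. integral (cbox (0,0) (2*pi,2*pi)) (\<lambda>(c, d). P' a b c d))"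
      by (subst integral_prod_continuous) (auto simp: case_prod_beta' intro!: continuous_intros slice)
    moreover have "integral (cbox (0,0) (2*pi,2*pi)) (\<lambda>(c, d). P' a b c d) = 0" for b
    proof -
      have "continuous_on UNIV (\<lambda>(c, d). P' a b c d)"
        unfolding case_prod_beta' by (intro slice continuous_intros)
      from integral_FTC_fst[OF this, of 0 "2*pi" "P a b"] deriv per
      show ?thesis by simp
    qed
    ultimately show ?thesis by simp
  qed
  ultimately show ?thesis by simp
qed

lemma box_integral_d4:
  assumes P': "cont4 P'"
    and deriv: "\<And>a b c d. ((\<lambda>d. P a b c d) has_vector_derivative P' a b c d) (at d)"
    and per: "\<And>a b c. P a b c (2*pi) = P a b c 0"
  shows "integral u2_box (\<lambda>(a, b, c, d). P' a b c d) = 0"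
proof -
  note slice = cont4_compose[OF P']
  have "integral u2_box (\<lambda>(a, b, c, d). P' a b c d) =
      integral (cbox 0 pi) (\<lambda>a. integral (cbox (0,0,0) (pi/2,2*pi,2*pi)) (\<lambda>(b, c, d). P' a b c d))"
    unfolding u2_box_cbox
    by (subst integral_prod_continuous) (auto simp: case_prod_beta' intro!: continuous_intros slice)
  moreover have "integral (cbox (0,0,0) (pi/2,2*pi,2*pi)) (\<lambda>(b, c, d). P' a b c d) = 0" for a
  proof -
    have "integral (cbox (0,0,0) (pi/2,2*pi,2*pi)) (\<lambda>(b, c, d). P' a b c d) =
      integral (cbox 0 (pi/2)) (\<lambda>b. integral (cbox (0,0) (2*pi,2*pi)) (\<lambda>(c, d). P' a b c d))"
      by (subst integral_prod_continuous) (auto simp: case_prod_beta' intro!: continuous_intros slice)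
    moreover have "integral (cbox (0,0) (2*pi,2*pi)) (\<lambda>(c, d). P' a b c d) = 0" for b
    proof -
      have c: "continuous_on UNIV (\<lambda>(d, c). P' a b c d)"
        unfolding case_prod_beta' by (intro slice continuous_intros)
      have "integral (cbox (0,0) (2*pi,2*pi)) (\<lambda>(c, d). P' a b c d) =
          integral (cbox (0,0) (2*pi,2*pi)) (\<lambda>(d, c). P' a b c d)"
        by (subst (1 2) integral_prod_continuous, simp_all only: prod.case)
           (auto simp: case_prod_beta' intro!: continuous_intros slice
             integral_swap_continuous[of 0 0 "2*pi" "2*pi" "P' a b", unfolded cbox_interval])
      also have "\<dots> = 0"
        using integral_FTC_fst[OF c, of 0 "2*pi" "\<lambda>d c. P a b c d"] deriv per by simp
      finally show ?thesis .
    qed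
    ultimately show ?thesis by simp
  qed
  ultimately show ?thesis by simp
qed

lemma has_vector_derivative_cis:
  assumes "(q has_real_derivative q') (at x)"
  shows "((\<lambda>s. cis (q s)) has_vector_derivative \<i> * of_real q' * cis (q x)) (at x)"
  using has_vector_derivative_polar[of "\<lambda>_. 1" 0 x q q' _ 1] assms by simp

text \<open>Up to a constant, the integrand is a diagonal partial derivative of the function times
  the pulled-back volume form: the phase \<open>cis (4*a)\<close> of the latter divided by the phase
  of z11 (\<epsilon> = 1) or of z22 (\<epsilon> = -1) is \<open>cis (3*a - \<epsilon>*c)\<close>.
  The coefficients of G1, G2, G3 form a divergence-free field, so the integrand is a
  divergence.\<close>

lemma box_divergence_diag:
  fixes \<Gamma> G1 G2 G3 :: "real \<Rightarrow> real \<Rightarrow> real \<Rightarrow> real \<Rightarrow> complex"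
  assumes cont: "cont4 \<Gamma>" "cont4 G1" "cont4 G2" "cont4 G3"
    and deriv: "\<And>a b c d. ((\<lambda>a. \<Gamma> a b c d) has_vector_derivative G1 a b c d) (at a)"
      "\<And>a b c d. ((\<lambda>b. \<Gamma> a b c d) has_vector_derivative G2 a b c d) (at b)"
      "\<And>a b c d. ((\<lambda>c. \<Gamma> a b c d) has_vector_derivative G3 a b c d) (at c)"
    and per: "\<And>a b c d. \<Gamma> a b (c + 2*pi) d = \<Gamma> a b c d" "\<And>a b c d. \<Gamma> a b c (d + 2*pi) = \<Gamma> a b c d"
      "\<And>a b c d. \<Gamma> (a + pi) b c d = \<Gamma> a b (c + pi) (d + pi)"
    and \<epsilon>: "\<epsilon> = 1 \<or> \<epsilon> = (-1 :: real)"
  shows "integral u2_box (\<lambda>(a, b, c, d). cis (3*a - \<epsilon>*c) *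
    (- \<i> * of_real ((cos b)\<^sup>2 * sin b) * G1 a b c d - of_real (cos b * (sin b)\<^sup>2) * G2 a b c d
     - \<i> * of_real \<epsilon> * of_real (sin b) * G3 a b c d)) = 0"
proof -
  note \<Gamma>c = cont4_compose[OF cont(1)] cont4_compose[OF cont(2)] cont4_compose[OF cont(3)] cont4_compose[OF cont(4)]
  define P' where "P' = (\<lambda>a b c d. - \<i> * of_real ((cos b)\<^sup>2 * sin b) *
     (cis (3*a - \<epsilon>*c) * G1 a b c d + (3 * \<i> * cis (3*a - \<epsilon>*c)) * \<Gamma> a b c d))"
  define Q' where "Q' = (\<lambda>a b c d. of_real (- cos b * (sin b)\<^sup>2) * (cis (3*a - \<epsilon>*c) * G2 a b c d)
     + of_real ((sin b)^3 - 2 * (cos b)\<^sup>2 * sin b) * (cis (3*a - \<epsilon>*c) * \<Gamma> a b c d))"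
  define X' where "X' = (\<lambda>a b c d. - \<i> * of_real \<epsilon> * of_real (sin b) *
     (cis (3*a - \<epsilon>*c) * G3 a b c d + (- \<i> * of_real \<epsilon> * cis (3*a - \<epsilon>*c)) * \<Gamma> a b c d))"
  have cP: "cont4 P'" and cQ: "cont4 Q'" and cX: "cont4 X'"
    unfolding P'_def Q'_def X'_def case_prod_beta' by (intro continuous_intros \<Gamma>c)+
  \<comment> \<open>The number 3 + \<epsilon> is 4 or 2, hence even. This makes the phase compatible
    with the half-period identification of the faces in \<open>a\<close>.\<close>
  have cis_pi: "cis (3 * a + 3 * pi - \<epsilon> * c) = cis (3 * a - \<epsilon> * (c + pi))" for a c
  proof -
    have "cis (3 * a + 3 * pi - \<epsilon> * c) = cis (3 * a - \<epsilon> * (c + pi)) * cis ((3 + \<epsilon>) * pi)"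
      unfolding cis_mult by (simp add: algebra_simps)
    also have "cis ((3 + \<epsilon>) * pi) = 1"
      using \<epsilon> cis_multiple_2pi[of 1] cis_multiple_2pi[of 2] by auto
    finally show ?thesis by simp
  qed
  have cis_2pi: "cis (x - \<epsilon> * (c + 2 * pi)) = cis (x - \<epsilon> * c)" for x c
  proof -
    have "cis (x - \<epsilon> * (c + 2 * pi)) = cis (x - \<epsilon> * c) * cis (2 * pi * (- \<epsilon>))"
      unfolding cis_mult by (simp add: algebra_simps)
    also have "cis (2 * pi * (- \<epsilon>)) = 1"
      using \<epsilon> cis_multiple_2pi[of 1] cis_multiple_2pi[of "-1"] by auto
    finally show ?thesis by simp
  qed
  have 1: "integral u2_box (\<lambda>(a, b, c, d). P' a b c d) = 0"
  proof (rule box_integral_d1[where P = "\<lambda>a b c d. - \<i> * of_real ((cos b)\<^sup>2 * sin b) * (cis (3*a - \<epsilon>*c) * \<Gamma> a b c d)"])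
    show "((\<lambda>a. - \<i> * of_real ((cos b)\<^sup>2 * sin b) * (cis (3*a - \<epsilon>*c) * \<Gamma> a b c d))
        has_vector_derivative P' a b c d) (at a)" for a b c d
      unfolding P'_def
      by (intro has_vector_derivative_mult_right has_vector_derivative_mult deriv
          has_vector_derivative_eq_rhs[OF has_vector_derivative_cis[where q' = 3]])
         (auto intro!: derivative_eq_intros)
  qed (use cP in \<open>auto simp: case_prod_beta' per cis_pi cis_2pi intro!: continuous_intros \<Gamma>c\<close>)
  have 2: "integral u2_box (\<lambda>(a, b, c, d). Q' a b c d) = 0"
  proof (rule box_integral_d2[where P = "\<lambda>a b c d. of_real (- cos b * (sin b)\<^sup>2) * (cis (3*a - \<epsilon>*c) * \<Gamma> a b c d)", OF cQ])
    show "((\<lambda>b. of_real (- cos b * (sin b)\<^sup>2) * (cis (3*a - \<epsilon>*c) * \<Gamma> a b c d))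
        has_vector_derivative Q' a b c d) (at b)" for a b c d
      unfolding Q'_def
      apply (intro has_vector_derivative_mult has_vector_derivative_mult_right deriv has_vector_derivative_of_real)
      apply (auto intro!: derivative_eq_intros simp: power2_eq_square power3_eq_cube algebra_simps)
      done
  qed auto
  have 3: "integral u2_box (\<lambda>(a, b, c, d). X' a b c d) = 0"
  proof (rule box_integral_d3[where P = "\<lambda>a b c d. - \<i> * of_real \<epsilon> * of_real (sin b) * (cis (3*a - \<epsilon>*c) * \<Gamma> a b c d)", OF cX])
    show "((\<lambda>c. - \<i> * of_real \<epsilon> * of_real (sin b) * (cis (3*a - \<epsilon>*c) * \<Gamma> a b c d))
        has_vector_derivative X' a b c d) (at c)" for a b c d
      unfolding X'_def
      by (intro has_vector_derivative_mult_right has_vector_derivative_mult deriv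
          has_vector_derivative_eq_rhs[OF has_vector_derivative_cis[where q' = "- \<epsilon>"]])
         (auto intro!: derivative_eq_intros)
    show "- \<i> * of_real \<epsilon> * of_real (sin b) * (cis (3 * a - \<epsilon> * (2 * pi)) * \<Gamma> a b (2 * pi) d) =
       - \<i> * of_real \<epsilon> * of_real (sin b) * (cis (3 * a - \<epsilon> * 0) * \<Gamma> a b 0 d)" for a b d
      using per(1)[of a b 0 d] cis_2pi[of "3*a" 0] by simp
  qed
  \<comment> \<open>The terms with undifferentiated \<Gamma> cancel: 3 cos^2 sin + (sin^3 - 2 cos^2
    sin) - sin = 0.\<close>
  have eq: "cis (3*a - \<epsilon>*c) *
    (- \<i> * of_real ((cos b)\<^sup>2 * sin b) * G1 a b c d - of_real (cos b * (sin b)\<^sup>2) * G2 a b c d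
     - \<i> * of_real \<epsilon> * of_real (sin b) * G3 a b c d) = P' a b c d + Q' a b c d + X' a b c d" for a b c d
  proof -
    have 1: "(complex_of_real (cos b))\<^sup>2 + (of_real (sin b))\<^sup>2 = 1"
      by (metis add.commute of_real_1 of_real_add of_real_power sin_cos_squared_add)
    have 2: "(complex_of_real \<epsilon>)\<^sup>2 = 1" using \<epsilon> by auto
    have 3: "\<i>\<^sup>2 = -1" by simp
    show ?thesis unfolding P'_def Q'_def X'_def
      unfolding of_real_mult of_real_power of_real_minus of_real_diff of_real_numeral
      using 1 2 3 by algebra
  qed
  have int: "(\<lambda>(a, b, c, d). f a b c d) integrable_on u2_box" if "cont4 f" for f
    unfolding u2_box_cbox using that continuous_on_subset integrable_continuous by blast
  have "integral u2_box (\<lambda>t. ((\<lambda>(a, b, c, d). P' a b c d) t + (\<lambda>(a, b, c, d). Q' a b c d) t)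
      + (\<lambda>(a, b, c, d). X' a b c d) t) = 0"
    by (subst Henstock_Kurzweil_Integration.integral_add,
        rule integrable_add[OF int[OF cP] int[OF cQ]], rule int[OF cX],
        subst Henstock_Kurzweil_Integration.integral_add[OF int[OF cP] int[OF cQ]])
       (simp add: 1 2 3)
  then show ?thesis unfolding eq by (simp add: case_prod_beta')
qed

text \<open>The counterpart for the off-diagonal entries z12 (\<epsilon> = 1) and z21 (\<epsilon> =
  -1), whose phases involve \<open>d\<close> in place of \<open>c\<close>; cosine and sine exchange
  their roles.\<close>

lemma box_divergence_off:
  fixes \<Gamma> G1 G2 G3 :: "real \<Rightarrow> real \<Rightarrow> real \<Rightarrow> real \<Rightarrow> complex"
  assumes cont: "cont4 \<Gamma>" "cont4 G1" "cont4 G2" "cont4 G3"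
    and deriv: "\<And>a b c d. ((\<lambda>a. \<Gamma> a b c d) has_vector_derivative G1 a b c d) (at a)"
      "\<And>a b c d. ((\<lambda>b. \<Gamma> a b c d) has_vector_derivative G2 a b c d) (at b)"
      "\<And>a b c d. ((\<lambda>d. \<Gamma> a b c d) has_vector_derivative G3 a b c d) (at d)"
    and per: "\<And>a b c d. \<Gamma> a b (c + 2*pi) d = \<Gamma> a b c d" "\<And>a b c d. \<Gamma> a b c (d + 2*pi) = \<Gamma> a b c d"
      "\<And>a b c d. \<Gamma> (a + pi) b c d = \<Gamma> a b (c + pi) (d + pi)"
    and \<epsilon>: "\<epsilon> = 1 \<or> \<epsilon> = (-1 :: real)"
  shows "integral u2_box (\<lambda>(a, b, c, d). cis (3*a - \<epsilon>*d) *
    (- \<i> * of_real (cos b * (sin b)\<^sup>2) * G1 a b c d + of_real ((cos b)\<^sup>2 * sin b) * G2 a b c d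
     - \<i> * of_real \<epsilon> * of_real (cos b) * G3 a b c d)) = 0"
proof -
  note \<Gamma>c = cont4_compose[OF cont(1)] cont4_compose[OF cont(2)] cont4_compose[OF cont(3)] cont4_compose[OF cont(4)]
  define P' where "P' = (\<lambda>a b c d. - \<i> * of_real (cos b * (sin b)\<^sup>2) *
     (cis (3*a - \<epsilon>*d) * G1 a b c d + (3 * \<i> * cis (3*a - \<epsilon>*d)) * \<Gamma> a b c d))"
  define Q' where "Q' = (\<lambda>a b c d. of_real ((cos b)\<^sup>2 * sin b) * (cis (3*a - \<epsilon>*d) * G2 a b c d)
     + of_real ((cos b)^3 - 2 * cos b * (sin b)\<^sup>2) * (cis (3*a - \<epsilon>*d) * \<Gamma> a b c d))"
  define X' where "X' = (\<lambda>a b c d. - \<i> * of_real \<epsilon> * of_real (cos b) *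
     (cis (3*a - \<epsilon>*d) * G3 a b c d + (- \<i> * of_real \<epsilon> * cis (3*a - \<epsilon>*d)) * \<Gamma> a b c d))"
  have cP: "cont4 P'" and cQ: "cont4 Q'" and cX: "cont4 X'"
    unfolding P'_def Q'_def X'_def case_prod_beta' by (intro continuous_intros \<Gamma>c)+
  have cis_pi: "cis (3 * a + 3 * pi - \<epsilon> * d) = cis (3 * a - \<epsilon> * (d + pi))" for a d
  proof -
    have "cis (3 * a + 3 * pi - \<epsilon> * d) = cis (3 * a - \<epsilon> * (d + pi)) * cis ((3 + \<epsilon>) * pi)"
      unfolding cis_mult by (simp add: algebra_simps)
    also have "cis ((3 + \<epsilon>) * pi) = 1"
      using \<epsilon> cis_multiple_2pi[of 1] cis_multiple_2pi[of 2] by auto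
    finally show ?thesis by simp
  qed
  have cis_2pi: "cis (x - \<epsilon> * (d + 2 * pi)) = cis (x - \<epsilon> * d)" for x d
  proof -
    have "cis (x - \<epsilon> * (d + 2 * pi)) = cis (x - \<epsilon> * d) * cis (2 * pi * (- \<epsilon>))"
      unfolding cis_mult by (simp add: algebra_simps)
    also have "cis (2 * pi * (- \<epsilon>)) = 1"
      using \<epsilon> cis_multiple_2pi[of 1] cis_multiple_2pi[of "-1"] by auto
    finally show ?thesis by simp
  qed
  have 1: "integral u2_box (\<lambda>(a, b, c, d). P' a b c d) = 0"
  proof (rule box_integral_d1[where P = "\<lambda>a b c d. - \<i> * of_real (cos b * (sin b)\<^sup>2) * (cis (3*a - \<epsilon>*d) * \<Gamma> a b c d)"])
    show "((\<lambda>a. - \<i> * of_real (cos b * (sin b)\<^sup>2) * (cis (3*a - \<epsilon>*d) * \<Gamma> a b c d))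
        has_vector_derivative P' a b c d) (at a)" for a b c d
      unfolding P'_def
      by (intro has_vector_derivative_mult_right has_vector_derivative_mult deriv
          has_vector_derivative_eq_rhs[OF has_vector_derivative_cis[where q' = 3]])
         (auto intro!: derivative_eq_intros)
  qed (use cP in \<open>auto simp: case_prod_beta' per cis_pi cis_2pi intro!: continuous_intros \<Gamma>c\<close>)
  have 2: "integral u2_box (\<lambda>(a, b, c, d). Q' a b c d) = 0"
  proof (rule box_integral_d2[where P = "\<lambda>a b c d. of_real ((cos b)\<^sup>2 * sin b) * (cis (3*a - \<epsilon>*d) * \<Gamma> a b c d)", OF cQ])
    show "((\<lambda>b. of_real ((cos b)\<^sup>2 * sin b) * (cis (3*a - \<epsilon>*d) * \<Gamma> a b c d))
        has_vector_derivative Q' a b c d) (at b)" for a b c d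
      unfolding Q'_def
      apply (intro has_vector_derivative_mult has_vector_derivative_mult_right deriv has_vector_derivative_of_real)
      apply (auto intro!: derivative_eq_intros simp: power2_eq_square power3_eq_cube algebra_simps)
      done
  qed auto
  have 3: "integral u2_box (\<lambda>(a, b, c, d). X' a b c d) = 0"
  proof (rule box_integral_d4[where P = "\<lambda>a b c d. - \<i> * of_real \<epsilon> * of_real (cos b) * (cis (3*a - \<epsilon>*d) * \<Gamma> a b c d)", OF cX])
    show "((\<lambda>d. - \<i> * of_real \<epsilon> * of_real (cos b) * (cis (3*a - \<epsilon>*d) * \<Gamma> a b c d))
        has_vector_derivative X' a b c d) (at d)" for a b c d
      unfolding X'_def
      by (intro has_vector_derivative_mult_right has_vector_derivative_mult deriv
          has_vector_derivative_eq_rhs[OF has_vector_derivative_cis[where q' = "- \<epsilon>"]])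
         (auto intro!: derivative_eq_intros)
    show "- \<i> * of_real \<epsilon> * of_real (cos b) * (cis (3 * a - \<epsilon> * (2 * pi)) * \<Gamma> a b c (2 * pi)) =
       - \<i> * of_real \<epsilon> * of_real (cos b) * (cis (3 * a - \<epsilon> * 0) * \<Gamma> a b c 0)" for a b c
      using per(2)[of a b c 0] cis_2pi[of "3*a" 0] by simp
  qed
  have eq: "cis (3*a - \<epsilon>*d) *
    (- \<i> * of_real (cos b * (sin b)\<^sup>2) * G1 a b c d + of_real ((cos b)\<^sup>2 * sin b) * G2 a b c d
     - \<i> * of_real \<epsilon> * of_real (cos b) * G3 a b c d) = P' a b c d + Q' a b c d + X' a b c d" for a b c d
  proof -
    have 1: "(complex_of_real (cos b))\<^sup>2 + (of_real (sin b))\<^sup>2 = 1"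
      by (metis add.commute of_real_1 of_real_add of_real_power sin_cos_squared_add)
    have 2: "(complex_of_real \<epsilon>)\<^sup>2 = 1" using \<epsilon> by auto
    have 3: "\<i>\<^sup>2 = -1" by simp
    show ?thesis unfolding P'_def Q'_def X'_def
      unfolding of_real_mult of_real_power of_real_minus of_real_diff of_real_numeral
      using 1 2 3 by algebra
  qed
  have int: "(\<lambda>(a, b, c, d). f a b c d) integrable_on u2_box" if "cont4 f" for f
    unfolding u2_box_cbox using that continuous_on_subset integrable_continuous by blast
  have "integral u2_box (\<lambda>t. ((\<lambda>(a, b, c, d). P' a b c d) t + (\<lambda>(a, b, c, d). Q' a b c d) t)
      + (\<lambda>(a, b, c, d). X' a b c d) t) = 0"
    by (subst Henstock_Kurzweil_Integration.integral_add,
        rule integrable_add[OF int[OF cP] int[OF cQ]], rule int[OF cX],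
        subst Henstock_Kurzweil_Integration.integral_add[OF int[OF cP] int[OF cQ]])
       (simp add: 1 2 3)
  then show ?thesis unfolding eq by (simp add: case_prod_beta')
qed


section \<open>Holomorphic gradients along the parametrization\<close>

definition dp :: "cmat \<Rightarrow> cmat \<Rightarrow> complex" where
  "dp D H = D$1$1 * H$1$1 + D$1$2 * H$1$2 + D$2$1 * H$2$1 + D$2$2 * H$2$2"

text \<open>\<open>D\<close> is the matrix of holomorphic partial derivatives \<open>\<partial>f/\<partial>z\<^sub>i\<^sub>j\<close> at \<open>Z\<close>.\<close>

definition has_cgrad :: "(cmat \<Rightarrow> complex) \<Rightarrow> cmat \<Rightarrow> cmat \<Rightarrow> bool" where
  "has_cgrad f D Z \<longleftrightarrow> (f has_derivative dp D) (at Z)"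

lemma has_cgrad_curve:
  assumes "has_cgrad f D (\<gamma> x)" "(\<gamma> has_vector_derivative v) (at x)"
  shows "((\<lambda>s. f (\<gamma> s)) has_vector_derivative dp D v) (at x)"
proof -
  have "dp D (h *\<^sub>R v) = h *\<^sub>R dp D v" for h
    by (simp add: dp_def scaleR_right_distrib)
  then show ?thesis
    using has_derivative_compose[OF assms(2)[unfolded has_vector_derivative_def]
        assms(1)[unfolded has_cgrad_def]]
    by (simp add: has_vector_derivative_def)
qed

lemma has_vector_derivative_cmat_polarI:
  fixes f :: "real \<Rightarrow> cmat"
  assumes "\<And>i j. (p i j has_real_derivative p' i j) (at x)"
    "\<And>i j. (q i j has_real_derivative q' i j) (at x)"
    and "\<And>s i j. f s $ i $ j = c *\<^sub>R p i j s *\<^sub>R cis (q i j s)"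
    and "\<And>i j. f' $ i $ j = of_real c * (of_real (p' i j) + \<i> * of_real (p i j x * q' i j)) * cis (q i j x)"
  shows "(f has_vector_derivative f') (at x)"
proof (rule has_vector_derivative_cmatI)
  show "((\<lambda>s. f s $ i $ j) has_vector_derivative f' $ i $ j) (at x)" for i j
    unfolding assms(3) by (rule has_vector_derivative_polar[OF assms(1,2,4)])
qed

context
  fixes R :: real
begin

definition z11 where "z11 \<psi> \<theta> \<alpha> = of_real (R * cos \<theta>) * cis (\<psi> + \<alpha>)"
definition z12 where "z12 \<psi> \<theta> \<beta> = of_real (R * sin \<theta>) * cis (\<psi> + \<beta>)"
definition z21 where "z21 \<psi> \<theta> \<beta> = - of_real (R * sin \<theta>) * cis (\<psi> - \<beta>)"
definition z22 where "z22 \<psi> \<theta> \<alpha> = of_real (R * cos \<theta>) * cis (\<psi> - \<alpha>)"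

lemmas z_defs = z11_def z12_def z21_def z22_def

lemma u2_param_d1:
  "((\<lambda>s. u2_param R (s, \<theta>, \<alpha>, \<beta>)) has_vector_derivative
     vector [vector [\<i> * z11 \<psi> \<theta> \<alpha>, \<i> * z12 \<psi> \<theta> \<beta>], vector [\<i> * z21 \<psi> \<theta> \<beta>, \<i> * z22 \<psi> \<theta> \<alpha>]]) (at \<psi>)"
    apply (rule has_vector_derivative_cmat_polarI[OF _ _ u2_param_polar])
      apply (auto intro!: derivative_eq_intros)[2]
    subgoal for i j using exhaust_2[of i] exhaust_2[of j] by (auto simp: z_defs)
    done

lemma u2_param_d2:
  "((\<lambda>s. u2_param R (\<psi>, s, \<alpha>, \<beta>)) has_vector_derivative
     vector [vector [- of_real (R * sin \<theta>) * cis (\<psi> + \<alpha>), of_real (R * cos \<theta>) * cis (\<psi> + \<beta>)],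
             vector [- of_real (R * cos \<theta>) * cis (\<psi> - \<beta>), - of_real (R * sin \<theta>) * cis (\<psi> - \<alpha>)]]) (at \<theta>)"
    apply (rule has_vector_derivative_cmat_polarI[where q' = "\<lambda>_ _. 0" and
        p' = "\<lambda>i j. if i = j then - sin \<theta> else if i = 1 then cos \<theta> else - cos \<theta>",
          OF _ _ u2_param_polar])
      apply (auto intro!: derivative_eq_intros)[2]
    subgoal for i j using exhaust_2[of i] exhaust_2[of j] by auto
    done

lemma u2_param_d3:
  "((\<lambda>s. u2_param R (\<psi>, \<theta>, s, \<beta>)) has_vector_derivative
     vector [vector [\<i> * z11 \<psi> \<theta> \<alpha>, 0], vector [0, - \<i> * z22 \<psi> \<theta> \<alpha>]]) (at \<alpha>)"
    apply (rule has_vector_derivative_cmat_polarI[where p' = "\<lambda>_ _. 0" and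
        q' = "\<lambda>i j. if i = j then if i = 1 then 1 else -1 else 0",
          OF _ _ u2_param_polar])
      apply (auto intro!: derivative_eq_intros)[2]
    subgoal for i j using exhaust_2[of i] exhaust_2[of j] by (auto simp: z_defs)
    done

lemma u2_param_d4:
  "((\<lambda>s. u2_param R (\<psi>, \<theta>, \<alpha>, s)) has_vector_derivative
     vector [vector [0, \<i> * z12 \<psi> \<theta> \<beta>], vector [- \<i> * z21 \<psi> \<theta> \<beta>, 0]]) (at \<beta>)"
    apply (rule has_vector_derivative_cmat_polarI[where p' = "\<lambda>_ _. 0" and
        q' = "\<lambda>i j. if i = j then 0 else if i = 1 then 1 else -1",
          OF _ _ u2_param_polar])
      apply (auto intro!: derivative_eq_intros)[2]
    subgoal for i j using exhaust_2[of i] exhaust_2[of j] by (auto simp: z_defs)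
    done

end

lemma continuous_on_cmatI:
  fixes f :: "'a::topological_space \<Rightarrow> cmat"
  assumes "\<And>i j. continuous_on S (\<lambda>x. f x $ i $ j)"
  shows "continuous_on S f"
proof -
  have "continuous_on S (\<lambda>x. \<chi> i. \<chi> j. f x $ i $ j)"
    by (intro continuous_on_vec_lambda assms)
  then show ?thesis by simp
qed

lemma case_quadruple: "(\<lambda>(a, b, c, d). g (a, b, c, d)) = g"
  by (auto simp: fun_eq_iff)

lemma continuous_u2_param: "continuous_on S (u2_param R)"
proof (rule continuous_on_cmatI)
  fix i j :: 2
  have "continuous_on S (\<lambda>(a, b, c, d). u2_param R (a, b, c, d) $ i $ j)"
    unfolding u2_param_polar case_prod_beta'
    using exhaust_2[of i] exhaust_2[of j] by (auto intro!: continuous_intros)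
  then show "continuous_on S (\<lambda>x. u2_param R x $ i $ j)"
    unfolding case_quadruple[of "\<lambda>t. u2_param R t $ i $ j"] .
qed

lemma u2_param_in_U2: "u2_param R t \<in> U2 R"
proof -
  obtain \<psi> \<theta> \<alpha> \<beta> where t: "t = (\<psi>, \<theta>, \<alpha>, \<beta>)" by (cases t)
  have cs: "(complex_of_real (cos \<theta>))\<^sup>2 + (of_real (sin \<theta>))\<^sup>2 = 1"
    by (metis add.commute of_real_1 of_real_add of_real_power sin_cos_squared_add)
  have "u2_param 1 (\<psi>, \<theta>, \<alpha>, \<beta>) ** ctranspose (u2_param 1 (\<psi>, \<theta>, \<alpha>, \<beta>)) = mat 1"
    using cs unfolding vec_eq_iff forall_2 ctranspose_def matrix_matrix_mult_def mat_def sum_2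
    by (simp add: scaleR_conv_of_real cis_cnj cis_mult power2_eq_square algebra_simps)
  then show ?thesis
    unfolding t U2_def by (auto intro!: exI[of _ "u2_param 1 (\<psi>, \<theta>, \<alpha>, \<beta>)"])
qed

lemma u2_integral_eq:
  assumes "continuous_on (U2 R) f"
  shows "u2_integral R f = integral u2_box (\<lambda>t. f (u2_param R t) * u2_pullback R t)"
    and "(\<lambda>t. f (u2_param R t) * u2_pullback R t) integrable_on u2_box"
    and "continuous_on u2_box (\<lambda>t. f (u2_param R t) * u2_pullback R t)"
proof -
  have "continuous_on u2_box (\<lambda>(a, b, c, d). u2_pullback R (a, b, c, d))"
    unfolding u2_pullback_eq case_prod_beta' by (intro continuous_intros)
  then have c: "continuous_on u2_box (\<lambda>t. u2_pullback R t)"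
    unfolding case_quadruple .
  have "continuous_on u2_box (\<lambda>t. f (u2_param R t))"
    by (rule continuous_on_compose2[OF assms continuous_u2_param])
       (use u2_param_in_U2 in blast)
  with c show cont: "continuous_on u2_box (\<lambda>t. f (u2_param R t) * u2_pullback R t)"
    by (intro continuous_intros)
  then show "(\<lambda>t. f (u2_param R t) * u2_pullback R t) integrable_on u2_box"
    unfolding u2_box_cbox by (rule integrable_continuous)
  show "u2_integral R f = integral u2_box (\<lambda>t. f (u2_param R t) * u2_pullback R t)"
    unfolding u2_integral_def u2_box_cbox
    by (rule set_borel_integral_eq_integral, unfold set_integrable_def,
        rule borel_integrable_compact, rule compact_cbox)
       (use cont in \<open>simp add: u2_box_cbox\<close>)
qed


text \<open>Solves the chain rule for one holomorphic derivative: of the three tangential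
  derivatives on the left, x = 1 retains only \<open>e11\<close> and x = -1 only
  \<open>e22\<close>.\<close>

lemma bracket_diag:
  fixes C S r x A A' B B' e11 e12 e21 e22 :: complex
  assumes "C\<^sup>2 + S\<^sup>2 = 1"
  shows "- \<i> * (C\<^sup>2 * S) * (\<i> * (r * C * A * e11 + r * S * B * e12 + - (r * S) * B' * e21 + r * C * A' * e22))
    - C * S\<^sup>2 * (r * (- S * A * e11 + C * B * e12 - C * B' * e21 - S * A' * e22))
    - \<i> * x * S * (\<i> * (r * C * A * e11 - r * C * A' * e22))
    = r * C * S * (A * e11 * (1 + x) + A' * e22 * (1 - x))" (is "?l = _")
proof -
  have "?l = r * C * S * (A * e11 * ((C\<^sup>2 + S\<^sup>2) + x) + A' * e22 * ((C\<^sup>2 + S\<^sup>2) - x))"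
    by (simp add: algebra_simps power2_eq_square)
  then show ?thesis unfolding assms .
qed

lemma bracket_off:
  fixes C S r x A A' B B' e11 e12 e21 e22 :: complex
  assumes "C\<^sup>2 + S\<^sup>2 = 1"
  shows "- \<i> * (C * S\<^sup>2) * (\<i> * (r * C * A * e11 + r * S * B * e12 + - (r * S) * B' * e21 + r * C * A' * e22))
    + C\<^sup>2 * S * (r * (- S * A * e11 + C * B * e12 - C * B' * e21 - S * A' * e22))
    - \<i> * x * C * (\<i> * (r * S * B * e12 - - (r * S) * B' * e21))
    = r * C * S * (B * e12 * (1 + x) - B' * e21 * (1 - x))" (is "?l = _")
proof -
  have "?l = r * C * S * (B * e12 * ((C\<^sup>2 + S\<^sup>2) + x) - B' * e21 * ((C\<^sup>2 + S\<^sup>2) - x))"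
    by (simp add: algebra_simps power2_eq_square)
  then show ?thesis unfolding assms .
qed

text \<open>A holomorphic partial derivative times dV is the differential of g times a constant
  3-form, and \<open>U2 R\<close> has no boundary. In parameters, the pulled-back form is a constant
  multiple of one of the two explicit divergences above, and the contributions of the faces vanish
  or cancel.\<close>

theorem stokes_U2:
  assumes R: "R > 0" and D: "\<And>T. T \<in> U2 R \<Longrightarrow> has_cgrad g (D T) T" and cont: "continuous_on (U2 R) D"
  shows "u2_integral R (\<lambda>T. D T $ i $ j) = 0"
proof -
  define u where "u = (\<lambda>a b c d. u2_param R (a, b, c, d))"
  define \<Gamma> where "\<Gamma> = (\<lambda>a b c d. g (u a b c d))"
  define E where "E = (\<lambda>i j a b c d. D (u a b c d) $ i $ j)"
  have contg: "continuous_on (U2 R) g"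
    using D has_derivative_continuous
    by (fastforce simp: has_cgrad_def intro!: continuous_at_imp_continuous_on)
  have comp: "cont4 (\<lambda>a b c d. f (u a b c d))" if "continuous_on (U2 R) f" for f :: "cmat \<Rightarrow> complex"
  proof -
    have "continuous_on UNIV (\<lambda>t. f (u2_param R t))"
      using continuous_on_compose2[OF that continuous_u2_param] u2_param_in_U2 by blast
    then show ?thesis
      unfolding u_def case_quadruple[of "\<lambda>t. f (u2_param R t)"] .
  qed
  have c\<Gamma>: "cont4 \<Gamma>" unfolding \<Gamma>_def by (rule comp[OF contg])
  have cE: "cont4 (E i j)" for i j
    unfolding E_def by (rule comp[of "\<lambda>T. D T $ i $ j"]) (intro continuous_intros cont)
  note Ec = cont4_compose[OF cE]
  define G1 where "G1 = (\<lambda>a b c d. \<i> * (z11 R a b c * E 1 1 a b c d + z12 R a b d * E 1 2 a b c d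
      + z21 R a b d * E 2 1 a b c d + z22 R a b c * E 2 2 a b c d))"
  define G2 where "G2 = (\<lambda>a b c d. of_real R * (- of_real (sin b) * cis (a + c) * E 1 1 a b c d
      + of_real (cos b) * cis (a + d) * E 1 2 a b c d
      - of_real (cos b) * cis (a - d) * E 2 1 a b c d - of_real (sin b) * cis (a - c) * E 2 2 a b c d))"
  define G3 where "G3 = (\<lambda>a b c d. \<i> * (z11 R a b c * E 1 1 a b c d - z22 R a b c * E 2 2 a b c d))"
  define G4 where "G4 = (\<lambda>a b c d. \<i> * (z12 R a b d * E 1 2 a b c d - z21 R a b d * E 2 1 a b c d))"
  have cG: "cont4 G1" "cont4 G2" "cont4 G3" "cont4 G4"
    unfolding G1_def G2_def G3_def G4_def z_defs case_prod_beta'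
    by (intro continuous_intros Ec)+
  have cg: "has_cgrad g (D (u a b c d)) (u2_param R (a, b, c, d))" for a b c d
    unfolding u_def by (intro D u2_param_in_U2)
  have dG: "((\<lambda>a. \<Gamma> a b c d) has_vector_derivative G1 a b c d) (at a)"
    "((\<lambda>b. \<Gamma> a b c d) has_vector_derivative G2 a b c d) (at b)"
    "((\<lambda>c. \<Gamma> a b c d) has_vector_derivative G3 a b c d) (at c)"
    "((\<lambda>d. \<Gamma> a b c d) has_vector_derivative G4 a b c d) (at d)" for a b c d
    unfolding \<Gamma>_def u_def G1_def G2_def G3_def G4_def E_def
    by (rule has_vector_derivative_eq_rhs, rule has_cgrad_curve[OF cg u2_param_d1],
          simp add: dp_def u_def distrib_left mult.assoc del: u2_param.simps)
       (rule has_vector_derivative_eq_rhs, rule has_cgrad_curve[OF cg u2_param_d2],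
          simp add: dp_def u_def algebra_simps del: u2_param.simps,
        rule has_vector_derivative_eq_rhs, rule has_cgrad_curve[OF cg u2_param_d3],
          simp add: dp_def u_def algebra_simps del: u2_param.simps,
        rule has_vector_derivative_eq_rhs, rule has_cgrad_curve[OF cg u2_param_d4],
          simp add: dp_def u_def algebra_simps del: u2_param.simps)
  have up: "u a b (c + 2*pi) d = u a b c d" "u a b c (d + 2*pi) = u a b c d"
    "u (a + pi) b c d = u a b (c + pi) (d + pi)" for a b c d
  proof -
    have 0: "cis (x + 2 * pi) = cis x" for x
      by (simp add: complex_eq_iff)
    have 2: "cis (a + (c + 2*pi)) = cis (a + c)" for a c
      using 0[of "a + c"] by (simp only: add.assoc)
    have c2: "cis (a - (c + 2*pi)) = cis (a - c)" for a c
      using 0[of "a - (c + 2*pi)"] by simp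
    have c3: "cis (a + pi - c) = cis (a - (c + pi))" for a c
    proof -
      have "a + pi - c = a - (c + pi) + 2 * pi" by simp
      then show ?thesis by (simp only: 0)
    qed
    have 3: "cis (a + pi + c) = cis (a + (c + pi))" for a c by (simp only: add_ac)
    show "u a b (c + 2*pi) d = u a b c d" "u a b c (d + 2*pi) = u a b c d"
      "u (a + pi) b c d = u a b (c + pi) (d + pi)"
      unfolding u_def u2_param.simps 2 c2 c3 3 by (rule refl)+
  qed
  have per: "\<Gamma> a b (c + 2*pi) d = \<Gamma> a b c d" "\<Gamma> a b c (d + 2*pi) = \<Gamma> a b c d"
    "\<Gamma> (a + pi) b c d = \<Gamma> a b (c + pi) (d + pi)" for a b c d
    unfolding \<Gamma>_def up by (rule refl)+
  note diag = box_divergence_diag[of \<Gamma> G1 G2 G3, OF c\<Gamma> cG(1-3) dG(1-3) per]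
  note off = box_divergence_off[of \<Gamma> G1 G2 G4, OF c\<Gamma> cG(1,2,4) dG(1,2,4) per]
  have cs: "(complex_of_real (cos b))\<^sup>2 + (of_real (sin b))\<^sup>2 = 1" for b
    by (metis add.commute of_real_1 of_real_add of_real_power sin_cos_squared_add)
  have int: "(\<lambda>t. D (u2_param R t) $ i $ j * u2_pullback R t) =
      (\<lambda>(a, b, c, d). E i j a b c d * (- \<i> * of_real (R ^ 4 * (cos b * sin b)) * cis (4 * a)))" for i j
    using case_quadruple[symmetric, of "\<lambda>t. D (u2_param R t) $ i $ j * u2_pullback R t"]
    unfolding E_def u_def u2_pullback_eq .
  \<comment> \<open>Reduces each of the four entries to exhibiting the integrand as a constant
    multiple of a divergence; the constants come from \<open>bracket_diag\<close> and
    \<open>bracket_off\<close> with x = \<epsilon>.\<close>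
  have main: "integral u2_box (\<lambda>(a, b, c, d). E i j a b c d * (- \<i> * of_real (R ^ 4 * (cos b * sin b)) * cis (4 * a))) = 0"
    if "integral u2_box (\<lambda>(a, b, c, d). h a b c d) = 0"
      "\<And>a b c d. E i j a b c d * (- \<i> * of_real (R ^ 4 * (cos b * sin b)) * cis (4 * a)) = k * h a b c d"
    for i j k h
  proof -
    have "integral u2_box (\<lambda>(a, b, c, d). E i j a b c d * (- \<i> * of_real (R ^ 4 * (cos b * sin b)) * cis (4 * a)))
      = integral u2_box (\<lambda>t. k * (\<lambda>(a, b, c, d). h a b c d) t)"
      unfolding that(2) by (simp add: case_prod_beta')
    also have "\<dots> = k * integral u2_box (\<lambda>(a, b, c, d). h a b c d)"
      by (rule integral_mult_right)
    finally show ?thesis using that(1) by simp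
  qed
  have R3: "of_real (R ^ 4 * x) = of_real (R^3) * (of_real R * complex_of_real x)" for x
    by (simp add: power3_eq_cube power4_eq_xxxx)
  have 11: "E 1 1 a b c d * (- \<i> * of_real (R ^ 4 * (cos b * sin b)) * cis (4 * a)) =
     (- \<i> * of_real (R ^ 3) / 2) * (cis (3*a - 1*c) *
    (- \<i> * of_real ((cos b)\<^sup>2 * sin b) * G1 a b c d - of_real (cos b * (sin b)\<^sup>2) * G2 a b c d
     - \<i> * of_real 1 * of_real (sin b) * G3 a b c d))" for a b c d
  proof -
    have e: "cis (3*a - 1*c) * cis (a + c) = cis (4*a)" unfolding cis_mult by simp
    show ?thesis unfolding R3 unfolding G1_def G2_def G3_def z_defs of_real_mult of_real_power of_real_1
      bracket_diag[OF cs] e[symmetric] by (simp add: algebra_simps)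
  qed
  have 22: "E 2 2 a b c d * (- \<i> * of_real (R ^ 4 * (cos b * sin b)) * cis (4 * a)) =
     (- \<i> * of_real (R ^ 3) / 2) * (cis (3*a - (-1)*c) *
    (- \<i> * of_real ((cos b)\<^sup>2 * sin b) * G1 a b c d - of_real (cos b * (sin b)\<^sup>2) * G2 a b c d
     - \<i> * of_real (-1) * of_real (sin b) * G3 a b c d))" for a b c d
  proof -
    have e: "cis (3*a - (-1)*c) * cis (a - c) = cis (4*a)" unfolding cis_mult by simp
    show ?thesis unfolding R3 unfolding G1_def G2_def G3_def z_defs of_real_mult of_real_power of_real_minus of_real_1
      bracket_diag[OF cs] e[symmetric] by (simp add: algebra_simps)
  qed
  have 12: "E 1 2 a b c d * (- \<i> * of_real (R ^ 4 * (cos b * sin b)) * cis (4 * a)) =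
     (- \<i> * of_real (R ^ 3) / 2) * (cis (3*a - 1*d) *
    (- \<i> * of_real (cos b * (sin b)\<^sup>2) * G1 a b c d + of_real ((cos b)\<^sup>2 * sin b) * G2 a b c d
     - \<i> * of_real 1 * of_real (cos b) * G4 a b c d))" for a b c d
  proof -
    have e: "cis (3*a - 1*d) * cis (a + d) = cis (4*a)" unfolding cis_mult by simp
    show ?thesis unfolding R3 unfolding G1_def G2_def G4_def z_defs of_real_mult of_real_power of_real_1
      bracket_off[OF cs] e[symmetric] by (simp add: algebra_simps)
  qed
  have 21: "E 2 1 a b c d * (- \<i> * of_real (R ^ 4 * (cos b * sin b)) * cis (4 * a)) =
     (\<i> * of_real (R ^ 3) / 2) * (cis (3*a - (-1)*d) *
    (- \<i> * of_real (cos b * (sin b)\<^sup>2) * G1 a b c d + of_real ((cos b)\<^sup>2 * sin b) * G2 a b c d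
     - \<i> * of_real (-1) * of_real (cos b) * G4 a b c d))" for a b c d
  proof -
    have e: "cis (3*a - (-1)*d) * cis (a - d) = cis (4*a)" unfolding cis_mult by simp
    show ?thesis unfolding R3 unfolding G1_def G2_def G4_def z_defs of_real_mult of_real_power of_real_minus of_real_1
      bracket_off[OF cs] e[symmetric] by (simp add: algebra_simps)
  qed
  have "u2_integral R (\<lambda>T. D T $ i $ j) = integral u2_box (\<lambda>(a, b, c, d). E i j a b c d *
      (- \<i> * of_real (R ^ 4 * (cos b * sin b)) * cis (4 * a)))"
    by (subst u2_integral_eq(1)) (intro continuous_intros cont, simp only: int)
  also have "\<dots> = 0"
  proof -
    have p: "(1::real) = 1 \<or> (1::real) = -1" and m: "(-1::real) = 1 \<or> (-1::real) = -1"
      by simp_all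
    consider "i = 1" "j = 1" | "i = 1" "j = 2" | "i = 2" "j = 1" | "i = 2" "j = 2"
      using exhaust_2[of i] exhaust_2[of j] by blast
    then show ?thesis
    proof cases
      case 1
      show ?thesis unfolding 1 by (rule main[OF diag[OF p] 11])
    next
      case 2
      show ?thesis unfolding 2 by (rule main[OF off[OF p] 12])
    next
      case 3
      show ?thesis unfolding 3 by (rule main[OF off[OF m] 21])
    next
      case 4
      show ?thesis unfolding 4 by (rule main[OF diag[OF m] 22])
    qed
  qed
  finally show ?thesis .
qed

declare u2_param.simps [simp del] u2_pullback.simps [simp del]

section \<open>Linearity, vector fields and parameters in contour integrals\<close>

lemma u2_integral_cong:
  assumes "\<And>T. T \<in> U2 R \<Longrightarrow> f T = g T"
  shows "u2_integral R f = u2_integral R g"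
  unfolding u2_integral_def using assms[OF u2_param_in_U2] by simp

lemma u2_integral_cmult: "u2_integral R (\<lambda>T. c * f T) = c * u2_integral R f"
  unfolding u2_integral_def by (simp add: mult.assoc)

lemma u2_integral_add:
  assumes "continuous_on (U2 R) f" "continuous_on (U2 R) g"
  shows "u2_integral R (\<lambda>T. f T + g T) = u2_integral R f + u2_integral R g"
  unfolding u2_integral_eq(1)[OF assms(1)] u2_integral_eq(1)[OF assms(2)]
    u2_integral_eq(1)[OF continuous_on_add[OF assms]]
  by (simp add: distrib_right Henstock_Kurzweil_Integration.integral_add u2_integral_eq(2) assms)

lemma bounded_linear_entry: "bounded_linear (\<lambda>T :: cmat. T $ i $ j)"
  by (rule bounded_linear_compose[OF bounded_linear_vec_nth bounded_linear_vec_nth])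

lemma has_derivative_entry [derivative_intros]:
  "(f has_derivative f') F \<Longrightarrow> ((\<lambda>x. (f x :: cmat) $ i $ j) has_derivative (\<lambda>h. f' h $ i $ j)) F"
  by (rule bounded_linear.has_derivative[OF bounded_linear_entry])

lemma has_cgrad_mult:
  assumes "has_cgrad f D T" "has_cgrad g E T"
  shows "has_cgrad (\<lambda>T. f T * g T) (csc (f T) E + csc (g T) D) T"
proof -
  have "dp (csc (f T) E + csc (g T) D) = (\<lambda>h. f T * dp E h + dp D h * g T)"
    by (simp add: dp_def fun_eq_iff algebra_simps)
  then show ?thesis
    using has_derivative_mult[OF assms[unfolded has_cgrad_def]] by (simp add: has_cgrad_def)
qed

lemma has_cgrad_quadratic_entry:
  "has_cgrad (\<lambda>T. (C + csc a T - T ** A ** T) $ i $ j)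
    (\<chi> k l. (if k = i \<and> l = j then a else 0) - (if k = i then (A ** T) $ l $ j else 0)
       - (if l = j then (T ** A) $ i $ k else 0)) T"
  using exhaust_2[of i] exhaust_2[of j] unfolding has_cgrad_def
  by (auto simp: mult_entry intro!: derivative_eq_intros) (simp_all add: fun_eq_iff dp_def mult_entry algebra_simps)

lemma continuous_on_mult_entry:
  assumes "continuous_on S A" "continuous_on S B"
  shows "continuous_on S (\<lambda>x. (A x :: cmat) ** (B x :: cmat))"
  by (rule continuous_on_cmatI) (simp add: mult_entry, intro continuous_intros assms)

lemma continuous_on_csc:
  assumes "continuous_on S c" "continuous_on S A"
  shows "continuous_on S (\<lambda>x. csc (c x) (A x))"
  by (rule continuous_on_cmatI) (simp, intro continuous_intros assms)

lemma has_cgrad_continuous: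
  assumes "\<And>T. T \<in> S \<Longrightarrow> has_cgrad f (D T) T"
  shows "continuous_on S f"
  using assms has_derivative_continuous
  by (fastforce simp: has_cgrad_def intro!: continuous_at_imp_continuous_on)

text \<open>The fields C + a T - T A T are infinitesimal conformal transformations, with holomorphic
  divergence 4 a - 4 tr(A T). Applying \<open>stokes_U2\<close> to f times each entry of the field
  and adding up gives the divergence theorem for them.\<close>

lemma stokes_quadratic:
  assumes R: "R > 0" and D: "\<And>T. T \<in> U2 R \<Longrightarrow> has_cgrad f (D T) T" and cont: "continuous_on (U2 R) D"
  shows "u2_integral R (\<lambda>T. dp (D T) (C + csc a T - T ** A ** T) + f T * (4 * a - 4 * trace (A ** T))) = 0"
proof -
  define X where "X = (\<lambda>T. C + csc a T - T ** A ** T)"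
  define X' where "X' = (\<lambda>i j T. (\<chi> k l. (if k = i \<and> l = j then a else 0) - (if k = i then (A ** T) $ l $ j else 0)
       - (if l = j then (T ** A) $ i $ k else 0)) :: cmat)"
  define G where "G = (\<lambda>i j T. csc (f T) (X' i j T) + csc (X T $ i $ j) (D T))"
  note contf = has_cgrad_continuous[OF D]
  have cX: "continuous_on (U2 R) X"
    unfolding X_def by (intro continuous_intros continuous_on_mult_entry continuous_on_csc)
  have "continuous_on (U2 R) (X' i j)" for i j
    unfolding X'_def
    apply (rule continuous_on_cmatI)
    subgoal for k l
      by (cases "k = i"; cases "l = j"; simp add: mult_entry; intro continuous_intros)
    done
  then have cG: "continuous_on (U2 R) (G i j)" for i j
    unfolding G_def by (intro continuous_intros continuous_on_csc contf cX cont)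
  have "has_cgrad (\<lambda>T. f T * X T $ i $ j) (G i j T) T" if "T \<in> U2 R" for i j T
    unfolding G_def X_def X'_def
    by (rule has_cgrad_mult[OF D[OF that] has_cgrad_quadratic_entry])
  from stokes_U2[OF R this cG] have S: "u2_integral R (\<lambda>T. G i j T $ k $ l) = 0" for i j k l .
  have c: "continuous_on (U2 R) (\<lambda>T. G i j T $ k $ l)" for i j k l
    by (intro continuous_intros cG)
  have X: "C + csc a T - T ** A ** T = X T" for T
    by (simp add: X_def)
  have eq: "dp (D T) (X T) + f T * (4 * a - 4 * trace (A ** T)) =
      (G 1 1 T $ 1 $ 1 + G 1 2 T $ 1 $ 2) + (G 2 1 T $ 2 $ 1 + G 2 2 T $ 2 $ 2)" for T
    unfolding G_def X'_def dp_def by (simp add: trace_def sum_2 mult_entry algebra_simps)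
  show ?thesis
    unfolding X eq by (simp add: u2_integral_add S c continuous_on_add)
qed

lemma u2_leibniz:
  fixes f f' :: "real \<Rightarrow> cmat \<Rightarrow> complex"
  assumes deriv: "\<And>\<mu> T. \<mu> \<in> {0..1} \<Longrightarrow> T \<in> U2 R \<Longrightarrow>
      ((\<lambda>\<mu>. f \<mu> T) has_vector_derivative f' \<mu> T) (at \<mu> within {0..1})"
    and cont: "continuous_on ({0..1} \<times> U2 R) (\<lambda>(\<mu>, T). f \<mu> T)"
    and cont': "continuous_on ({0..1} \<times> U2 R) (\<lambda>(\<mu>, T). f' \<mu> T)"
    and \<mu>: "\<mu> \<in> {0..1}"
  shows "((\<lambda>\<mu>. u2_integral R (f \<mu>)) has_vector_derivative u2_integral R (f' \<mu>)) (at \<mu> within {0..1})"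
proof -
  have slice: "continuous_on (U2 R) (h \<mu>)" if "continuous_on ({0..1} \<times> U2 R) (\<lambda>(\<mu>, T). h \<mu> T)" "\<mu> \<in> {0..1}"
    for h :: "real \<Rightarrow> cmat \<Rightarrow> complex" and \<mu>
  proof -
    have "continuous_on (U2 R) (\<lambda>T. (\<mu>, T))" by (intro continuous_intros)
    from continuous_on_compose2[OF that(1) this] that(2) show ?thesis by (simp add: image_subset_iff)
  qed
  have pb: "continuous_on u2_box (\<lambda>t. u2_pullback R t)"
    using u2_integral_eq(3)[of R "\<lambda>_. 1"] by simp
  have cont2: "continuous_on ({0..1} \<times> u2_box) (\<lambda>(\<mu>, t). f' \<mu> (u2_param R t) * u2_pullback R t)"
  proof -
    have "continuous_on ({0..1} \<times> u2_box) (\<lambda>x. (fst x, u2_param R (snd x)))"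
      by (intro continuous_intros continuous_on_compose2[OF continuous_u2_param[of UNIV]]) auto
    from continuous_on_compose2[OF cont' this]
    have "continuous_on ({0..1} \<times> u2_box) (\<lambda>x. f' (fst x) (u2_param R (snd x)))"
      using u2_param_in_U2 by (simp add: image_subset_iff)
    moreover have "continuous_on ({0..1::real} \<times> u2_box) (\<lambda>x. u2_pullback R (snd x))"
      by (rule continuous_on_compose2[OF pb]) (auto intro!: continuous_intros)
    ultimately show ?thesis
      unfolding case_prod_beta' by (intro continuous_intros)
  qed
  have "((\<lambda>\<mu>. integral u2_box (\<lambda>t. f \<mu> (u2_param R t) * u2_pullback R t)) has_vector_derivative
     integral u2_box (\<lambda>t. f' \<mu> (u2_param R t) * u2_pullback R t)) (at \<mu> within {0..1})"
    unfolding u2_box_cbox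
  proof (rule leibniz_rule_vector_derivative[OF _ _ _ \<mu>])
    show "((\<lambda>\<mu>. f \<mu> (u2_param R t) * u2_pullback R t) has_vector_derivative
        f' \<mu> (u2_param R t) * u2_pullback R t) (at \<mu> within {0..1})" if "\<mu> \<in> {0..1}" for \<mu> t
      by (intro has_vector_derivative_mult_left deriv that u2_param_in_U2)
    show "(\<lambda>t. f \<mu> (u2_param R t) * u2_pullback R t) integrable_on cbox (0, 0, 0, 0) (pi, pi / 2, 2 * pi, 2 * pi)"
      if "\<mu> \<in> {0..1}" for \<mu>
      using u2_integral_eq(2)[OF slice[OF cont that]] unfolding u2_box_cbox .
  qed (use cont2 in \<open>simp_all add: u2_box_cbox\<close>)
  then show ?thesis
    by (rule has_vector_derivative_transform[OF \<mu>, rotated -1, THEN has_vector_derivative_eq_rhs])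
       (simp_all add: u2_integral_eq(1) slice[OF cont] slice[OF cont' \<mu>])
qed


section \<open>Products of inverse determinants depending on a parameter\<close>

definition dinv :: "nat \<Rightarrow> (nat \<Rightarrow> cmat) \<Rightarrow> complex" where
  "dinv m M = (\<Prod>i<m. inverse (det (M i)))"

text \<open>For M = K + L T, this is the gradient of det (K + L T) with respect to T.\<close>

definition gdet :: "cmat \<Rightarrow> cmat \<Rightarrow> cmat" where
  "gdet M L = vector [vector [M$2$2 * L$1$1 - M$1$2 * L$2$1, M$1$1 * L$2$1 - M$2$1 * L$1$1],
    vector [M$2$2 * L$1$2 - M$1$2 * L$2$2, M$1$1 * L$2$2 - M$2$1 * L$1$2]]"

lemma dp_gdet: "dp (gdet M L) H = pdet M (L ** H)"
  by (simp add: dp_def gdet_def pdet_def mult_entry algebra_simps)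

lemma dp_lin: "dp (D + E) H = dp D H + dp E H" "dp (csc c D) H = c * dp D H"
  by (simp_all add: dp_def algebra_simps)

lemma has_cgrad_det_inverse:
  assumes "det (K + L ** T) \<noteq> 0"
  shows "has_cgrad (\<lambda>T. inverse (det (K + L ** T))) (csc (- inverse (det (K + L ** T)) / det (K + L ** T)) (gdet (K + L ** T) L)) T"
proof -
  have "((\<lambda>T. det (K + L ** T)) has_derivative (\<lambda>H. pdet (K + L ** T) (L ** H))) (at T)"
    unfolding det_2 pdet_def
    by (auto simp: mult_entry fun_eq_iff algebra_simps intro!: derivative_eq_intros)
  from Deriv.has_derivative_inverse[OF assms this] show ?thesis
    unfolding has_cgrad_def
    by (rule has_derivative_eq_rhs) (simp add: fun_eq_iff dp_lin dp_gdet divide_inverse)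
qed

lemma has_cgrad_dinv:
  assumes "\<And>i. i < m \<Longrightarrow> det (K i + L i ** T) \<noteq> 0"
  shows "has_cgrad (\<lambda>T. dinv m (\<lambda>i. K i + L i ** T))
    (csc (- dinv m (\<lambda>i. K i + L i ** T))
      (\<Sum>i<m. csc (1 / det (K i + L i ** T)) (gdet (K i + L i ** T) (L i)))) T"
  using assms
proof (induction m)
  case 0
  have "dp (csc c 0) = (\<lambda>H. 0)" for c by (simp add: fun_eq_iff dp_def)
  then show ?case by (simp add: has_cgrad_def dinv_def)
next
  case (Suc m)
  note * = has_cgrad_mult[OF Suc.IH has_cgrad_det_inverse[of "K m" "L m" T]]
  have 1: "dinv (Suc m) (\<lambda>i. K i + L i ** T) =
      dinv m (\<lambda>i. K i + L i ** T) * inverse (det (K m + L m ** T))" for T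
    by (simp add: dinv_def)
  show ?case
    unfolding 1
    by (rule back_subst[of "\<lambda>D. has_cgrad _ D T", OF *])
       (use Suc.prems in \<open>simp_all add: cmat_eq_iff divide_inverse algebra_simps\<close>)
qed

lemma dinv_has_vector_derivative:
  fixes M :: "real \<Rightarrow> nat \<Rightarrow> cmat"
  assumes M: "\<And>i \<mu>. M \<mu> i = N0 i + \<mu> *\<^sub>R N1 i" and "\<And>i. i < m \<Longrightarrow> det (M \<mu> i) \<noteq> 0"
  shows "((\<lambda>\<mu>. dinv m (M \<mu>)) has_vector_derivative
    - dinv m (M \<mu>) * (\<Sum>i<m. pdet (M \<mu> i) (N1 i) / det (M \<mu> i))) (at \<mu> within S)"
  using assms(2)
proof (induction m)
  case 0
  then show ?case by (simp add: dinv_def)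
next
  case (Suc m)
  have e: "M \<mu> m $ a $ b = N0 m $ a $ b + of_real \<mu> * N1 m $ a $ b" for \<mu> a b
    unfolding M vector_add_component vector_scaleR_component by (simp add: scaleR_conv_of_real)
  have "((\<lambda>\<mu>. det (M \<mu> m)) has_vector_derivative pdet (M \<mu> m) (N1 m)) (at \<mu> within S)"
    unfolding det_2 pdet_def e
    by (auto intro!: derivative_eq_intros simp: algebra_simps)
  then have "((\<lambda>\<mu>. inverse (det (M \<mu> m))) has_vector_derivative
      - (inverse (det (M \<mu> m)) * pdet (M \<mu> m) (N1 m) * inverse (det (M \<mu> m)))) (at \<mu> within S)"
    using Deriv.has_derivative_inverse[of "\<lambda>\<mu>. det (M \<mu> m)" \<mu>] Suc.prems[of m]
    unfolding has_vector_derivative_def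
    by (rule_tac has_derivative_eq_rhs) (auto simp: fun_eq_iff)
  from has_vector_derivative_mult[OF Suc.IH this] Suc.prems
  show ?case
    by (auto simp: dinv_def divide_inverse algebra_simps elim!: has_vector_derivative_eq_rhs)
qed


lemma dp_sum: "dp (\<Sum>i\<in>I. E i) H = (\<Sum>i\<in>I. dp (E i) H)"
  by (simp add: dp_def sum_distrib_right sum.distrib)

lemma continuous_on_det:
  assumes "continuous_on S M"
  shows "continuous_on S (\<lambda>x. det (M x :: cmat))"
  unfolding det_2 by (intro continuous_intros assms)

lemma continuous_on_pdet:
  assumes "continuous_on S M" "continuous_on S N"
  shows "continuous_on S (\<lambda>x. pdet (M x) (N x))"
  unfolding pdet_def by (intro continuous_intros assms)

lemma continuous_on_dinv:
  assumes "\<And>i. i < m \<Longrightarrow> continuous_on S (\<lambda>x. M x i)" "\<And>i x. i < m \<Longrightarrow> x \<in> S \<Longrightarrow> det (M x i) \<noteq> 0"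
  shows "continuous_on S (\<lambda>x. dinv m (M x))"
  unfolding dinv_def using assms by (intro continuous_intros continuous_on_det) auto

text \<open>Up to the factor \<open>\<sigma> \<mu>\<close>, the \<open>\<mu>\<close>-derivative of \<open>\<mu>\<^sup>p\<close> times the integrand is the divergence of
  the integrand multiplied by the vector field \<open>C \<mu> + a T - T A T\<close>.\<close>

lemma homotopy_U2:
  fixes K0 K1 L0 L1 :: "nat \<Rightarrow> cmat" and a \<sigma> :: complex and A :: cmat
  defines "L \<equiv> \<lambda>\<mu> i. L0 i + \<mu> *\<^sub>R L1 i"
  defines "M \<equiv> \<lambda>\<mu> T i. (K0 i + \<mu> *\<^sub>R K1 i) + L \<mu> i ** T"
  defines "N \<equiv> \<lambda>T i. K1 i + L1 i ** T"
  assumes R: "R > 0"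
    and nz: "\<And>\<mu> T i. \<mu> \<in> {0..1} \<Longrightarrow> T \<in> U2 R \<Longrightarrow> i < m \<Longrightarrow> det (M \<mu> T i) \<noteq> 0"
    and eq: "\<And>\<mu> T i. \<mu> \<in> {0<..<1} \<Longrightarrow> T \<in> U2 R \<Longrightarrow> i < m \<Longrightarrow>
      pdet (M \<mu> T i) (L \<mu> i ** (C \<mu> + csc a T - T ** A ** T)) =
      \<tau> \<mu> T i * det (M \<mu> T i) + \<sigma> * of_real \<mu> * pdet (M \<mu> T i) (N T i)"
    and div: "\<And>\<mu> T. \<mu> \<in> {0<..<1} \<Longrightarrow> T \<in> U2 R \<Longrightarrow>
      4 * a - 4 * trace (A ** T) - (\<Sum>i<m. \<tau> \<mu> T i) = \<sigma> * of_nat p"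
    and \<sigma>: "\<sigma> \<noteq> 0"
  shows "u2_integral R (\<lambda>T. dinv m (M 1 T)) = 0 ^ p * u2_integral R (\<lambda>T. dinv m (M 0 T))"
proof -
  \<comment> \<open>The integral of \<open>f\<close> turns out to be constant in \<mu>. Since its
    value at 0 carries \<open>0 ^ p\<close>, the case p = 0 equates the two integrals and p > 0
    makes the integral at \<mu> = 1 vanish.\<close>
  define f where "f = (\<lambda>\<mu> T. of_real \<mu> ^ p * dinv m (M \<mu> T))"
  define S where "S = (\<lambda>\<mu> T. \<Sum>i<m. pdet (M \<mu> T i) (N T i) / det (M \<mu> T i))"
  define f' where "f' = (\<lambda>\<mu> T. of_real \<mu> ^ p * (- dinv m (M \<mu> T) * S \<mu> T)
    + of_nat p * of_real \<mu> ^ (p - 1) * dinv m (M \<mu> T))"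
  have M: "M \<mu> T i = (K0 i + L0 i ** T) + \<mu> *\<^sub>R N T i" for \<mu> T i
    unfolding M_def L_def N_def cmat_eq_iff
    by (simp add: mult_entry) (simp add: scaleR_conv_of_real algebra_simps)
  have cN: "continuous_on UNIV (\<lambda>(\<mu>::real, T). N T i)" for i
    unfolding N_def case_prod_beta' by (intro continuous_intros continuous_on_mult_entry)
  have cM: "continuous_on UNIV (\<lambda>(\<mu>, T). M \<mu> T i)" for i
    unfolding M_def L_def case_prod_beta' by (intro continuous_intros continuous_on_mult_entry)
  have cM': "continuous_on X (\<lambda>x. M (fst x) (snd x) i)" and cN': "continuous_on X (\<lambda>x. N (snd x) i)"
    for X :: "(real \<times> cmat) set" and i
    using cM[of i] cN[of i] continuous_on_subset by (auto simp: case_prod_beta')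
  have cd: "continuous_on ({0..1} \<times> U2 R) (\<lambda>x. dinv m (M (fst x) (snd x)))"
    by (intro continuous_on_dinv cM') (use nz in auto)
  have cf: "continuous_on ({0..1} \<times> U2 R) (\<lambda>(\<mu>, T). f \<mu> T)"
    unfolding f_def case_prod_beta' by (intro continuous_intros cd)
  have cf': "continuous_on ({0..1} \<times> U2 R) (\<lambda>(\<mu>, T). f' \<mu> T)"
    unfolding f'_def S_def case_prod_beta'
    by (intro continuous_intros cd continuous_on_pdet continuous_on_det cM' cN') (use nz in auto)
  have deriv: "((\<lambda>\<mu>. f \<mu> T) has_vector_derivative f' \<mu> T) (at \<mu> within {0..1})"
    if "\<mu> \<in> {0..1}" "T \<in> U2 R" for \<mu> T
  proof -
    have "((\<lambda>\<mu>. complex_of_real (\<mu> ^ p)) has_vector_derivative of_real (of_nat p * \<mu> ^ (p - 1))) (at \<mu> within {0..1})"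
      by (intro has_vector_derivative_of_real) (auto intro!: derivative_eq_intros)
    then have "((\<lambda>\<mu>. complex_of_real \<mu> ^ p) has_vector_derivative of_nat p * of_real \<mu> ^ (p - 1)) (at \<mu> within {0..1})"
      by simp
    from has_vector_derivative_mult[OF this dinv_has_vector_derivative[of "\<lambda>\<mu>. M \<mu> T", OF M nz[OF that]]]
    show ?thesis unfolding f_def f'_def S_def .
  qed
  note leib = u2_leibniz[OF deriv cf cf']
  have zero: "u2_integral R (f' \<mu>) = 0" if \<mu>: "\<mu> \<in> {0<..<1}" for \<mu>
  proof -
    define D where "D = (\<lambda>T. csc (- dinv m (M \<mu> T)) (\<Sum>i<m. csc (1 / det (M \<mu> T i)) (gdet (M \<mu> T i) (L \<mu> i))))"
    have \<mu>': "\<mu> \<in> {0..1}" using \<mu> by auto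
    have cM2: "continuous_on (U2 R) (\<lambda>T. M \<mu> T i)" for i
      unfolding M_def by (intro continuous_intros continuous_on_mult_entry)
    have D: "has_cgrad (\<lambda>T. dinv m (M \<mu> T)) (D T) T" if "T \<in> U2 R" for T
      using has_cgrad_dinv[of m "\<lambda>i. K0 i + \<mu> *\<^sub>R K1 i" "L \<mu>" T] nz[OF \<mu>' that]
      unfolding D_def M_def by simp
    have "continuous_on (U2 R) (\<lambda>T. gdet (M \<mu> T i) (L \<mu> i))" for i
    proof (rule continuous_on_cmatI)
      fix k l :: 2
      show "continuous_on (U2 R) (\<lambda>T. gdet (M \<mu> T i) (L \<mu> i) $ k $ l)"
        unfolding gdet_def using exhaust_2[of k] exhaust_2[of l]
        by (auto; intro continuous_intros cM2)
    qed
    then have "continuous_on (U2 R) D"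
      unfolding D_def using nz[OF \<mu>']
      by (intro continuous_on_csc continuous_intros continuous_on_dinv continuous_on_det cM2) auto
    note st = stokes_quadratic[OF R D this, of "C \<mu>" a A]
    \<comment> \<open>By \<open>eq\<close>, the field acts on each factor as a rescaling by \<tau>
      plus \<sigma> \<mu> times the \<mu>-derivative. By \<open>div\<close>, the divergence minus
      all rescalings leaves \<sigma> p, the contribution of the weight.\<close>
    have "\<sigma> * of_real \<mu> * f' \<mu> T = of_real \<mu> ^ p * (dp (D T) (C \<mu> + csc a T - T ** A ** T) +
       dinv m (M \<mu> T) * (4 * a - 4 * trace (A ** T)))" if T: "T \<in> U2 R" for T
    proof -
      have "(\<Sum>i<m. pdet (M \<mu> T i) (L \<mu> i ** (C \<mu> + csc a T - T ** A ** T)) / det (M \<mu> T i)) =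
          (\<Sum>i<m. \<tau> \<mu> T i + \<sigma> * of_real \<mu> * (pdet (M \<mu> T i) (N T i) / det (M \<mu> T i)))"
        using nz[OF \<mu>' T] eq[OF \<mu> T] by (intro sum.cong) (auto simp: add_divide_distrib)
      also have "\<dots> = (\<Sum>i<m. \<tau> \<mu> T i) + \<sigma> * of_real \<mu> * S \<mu> T"
        unfolding S_def by (simp add: sum.distrib sum_distrib_left)
      finally have "dp (D T) (C \<mu> + csc a T - T ** A ** T) =
          - dinv m (M \<mu> T) * ((\<Sum>i<m. \<tau> \<mu> T i) + \<sigma> * of_real \<mu> * S \<mu> T)"
        unfolding D_def dp_lin dp_sum dp_gdet by simp
      moreover have "of_real \<mu> * (of_nat p * of_real \<mu> ^ (p - 1)) = of_nat p * complex_of_real \<mu> ^ p"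
        by (cases p) auto
      moreover have "\<sigma> * \<nu> * (q * (- d * s) + n * q' * d) = q * (x + d * y)"
        if "x = - d * (t + \<sigma> * \<nu> * s)" "\<nu> * (n * q') = n * q" "y - t = \<sigma> * n"
        for \<nu> q q' d s n x y t :: complex
        using that by algebra
      ultimately show ?thesis
        using div[OF \<mu> T] unfolding f'_def by blast
    qed
    then have "u2_integral R (\<lambda>T. \<sigma> * of_real \<mu> * f' \<mu> T) =
        u2_integral R (\<lambda>T. of_real \<mu> ^ p * (dp (D T) (C \<mu> + csc a T - T ** A ** T) +
          dinv m (M \<mu> T) * (4 * a - 4 * trace (A ** T))))"
      by (rule u2_integral_cong)
    then have "\<sigma> * of_real \<mu> * u2_integral R (f' \<mu>) = 0"
      unfolding u2_integral_cmult using st by simp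
    then show ?thesis using \<sigma> \<mu> by simp
  qed
  \<comment> \<open>The factor \<mu> was divided out, so the derivative is known to vanish only in
    the open interval; continuity takes care of the end points.\<close>
  have "((\<lambda>\<mu>::real. 0 :: complex) has_integral (u2_integral R (f 1) - u2_integral R (f 0))) {0..1}"
  proof (rule fundamental_theorem_of_calculus_interior)
    show "continuous_on {0..1} (\<lambda>\<mu>. u2_integral R (f \<mu>))"
      unfolding continuous_on_eq_continuous_within
      by (intro ballI has_vector_derivative_continuous[OF leib])
    show "((\<lambda>\<mu>. u2_integral R (f \<mu>)) has_vector_derivative 0) (at \<mu>)" if "\<mu> \<in> {0<..<1}" for \<mu>
      using leib[of \<mu>] zero[OF that] that by (simp add: at_within_Icc_at)
  qed simp
  then have "u2_integral R (f 1) = u2_integral R (f 0)"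
    using has_integral_unique[OF _ has_integral_0] by fastforce
  then show ?thesis
    unfolding f_def by (simp add: u2_integral_cmult)
qed


section \<open>The one-loop integral\<close>

lemma pdet_mult_right: "pdet M (M ** Y) = det M * trace Y"
  by (simp add: pdet_def det_2 mult_entry trace_def sum_2 algebra_simps)

lemma norm_vmult_convex_U2:
  fixes v :: "complex^2"
  assumes "R > 0" "contr R P" "T \<in> U2 R" "\<mu> \<in> {0..1}"
  shows "norm (v v* (P + \<mu> *\<^sub>R (T - P))) \<le> R * norm v"
proof -
  have "v v* (P + \<mu> *\<^sub>R (T - P)) = (1 - \<mu>) *\<^sub>R (v v* P) + \<mu> *\<^sub>R (v v* T)"
    unfolding vmult_add vmult_scale vmult_diff by (simp add: algebra_simps)
  also have "norm \<dots> \<le> (1 - \<mu>) * norm (v v* P) + \<mu> * norm (v v* T)"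
    using assms(4) by (intro norm_triangle_le) simp
  also have "\<dots> \<le> (1 - \<mu>) * (R * norm v) + \<mu> * (R * norm v)"
    using assms contr_le[OF assms(2)] norm_vmult_U2[OF assms(1,3)]
    by (intro add_mono mult_left_mono) auto
  finally show ?thesis by (simp add: algebra_simps)
qed

lemma det_1_minus_le:
  assumes "R > 0" "contr (1/R) A" "\<And>v :: complex^2. norm (v v* S) \<le> R * norm v"
  shows "det (mat 1 - A ** S) \<noteq> 0"
proof (rule det_nonzeroI)
  fix v :: "complex^2" assume v: "v \<noteq> 0"
  have "norm ((v v* A) v* S) < norm v"
    using contrD[OF assms(2) v] assms(3)[of "v v* A"] assms(1) by (simp add: field_simps)
  then have "(v v* A) v* S \<noteq> v" by auto
  then show "v v* (mat 1 - A ** S) \<noteq> 0"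
    by (simp add: vmult_diff vmult_1 vmult_assoc)
qed

lemma contr_scale:
  assumes "contr R P" "0 \<le> \<mu>" "\<mu> \<le> 1" "R > 0"
  shows "contr R (\<mu> *\<^sub>R P)"
  unfolding contr_def vmult_scale
proof (intro allI impI)
  fix v :: "complex^2" assume "v \<noteq> 0"
  then have "norm (v v* P) < R * norm v" by (rule contrD[OF assms(1)])
  moreover have "\<mu> * norm (v v* P) \<le> 1 * norm (v v* P)"
    using assms by (intro mult_right_mono) auto
  ultimately show "norm (\<mu> *\<^sub>R (v v* P)) < R * norm v" using assms by simp
qed

lemma minus_mult: "(- A) ** B = - (A ** (B :: cmat))" for A :: cmat
  by (simp add: cmat_eq_iff mult_entry)

lemma less4_cases: "(i::nat) < 4 \<Longrightarrow> (i = 0 \<Longrightarrow> P) \<Longrightarrow> (i = 1 \<Longrightarrow> P) \<Longrightarrow> (i = 2 \<Longrightarrow> P) \<Longrightarrow> (i = 3 \<Longrightarrow> P) \<Longrightarrow> P"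
  by linarith

definition idx4 :: "'a \<Rightarrow> 'a \<Rightarrow> 'a \<Rightarrow> 'a \<Rightarrow> nat \<Rightarrow> 'a" where
  "idx4 a b c d i = (if i = 0 then a else if i = 1 then b else if i = 2 then c else d)"

lemma idx4 [simp]: "idx4 a b c d 0 = a" "idx4 a b c d (Suc 0) = b" "idx4 a b c d 2 = c" "idx4 a b c d 3 = d"
  by (simp_all add: idx4_def)

lemma dinv4: "dinv 4 M = inverse (det (M 0)) * inverse (det (M 1)) * inverse (det (M 2)) * inverse (det (M 3))"
  by (simp add: dinv_def eval_nat_numeral lessThan_Suc mult_ac)

lemma sum4: "(\<Sum>i<4::nat. f i) = f 0 + f 1 + f 2 + (f 3 :: complex)"
  by (simp add: eval_nat_numeral)

text \<open>Moving the double pole from P to 0 along \<mu> P, always inside the contour, is a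
  translation and does not change the integral. At 0 it is the integral that fixes the
  orientation.\<close>

lemma integral_inverse_square:
  assumes R: "R > 0" and P: "contr R P"
  shows "u2_integral R (\<lambda>T. inverse (det (T - P)) * inverse (det (T - P))) = - 2 * of_real (pi ^ 3) * \<i>"
proof -
  have "u2_integral R (\<lambda>T. dinv 2 (\<lambda>i. (0 + 1 *\<^sub>R (- P)) + (mat 1 + 1 *\<^sub>R 0) ** T)) =
     0 ^ 0 * u2_integral R (\<lambda>T. dinv 2 (\<lambda>i. (0 + 0 *\<^sub>R (- P)) + (mat 1 + 0 *\<^sub>R 0) ** T))"
  proof (rule homotopy_U2[OF R, where C = "\<lambda>\<mu>. - \<mu> *\<^sub>R P" and a = 0 and A = 0 and \<tau> = "\<lambda>_ _ _. 0" and \<sigma> = 1])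
    fix \<mu> :: real and T i assume "\<mu> \<in> {0..1}" "T \<in> U2 R"
    then show "det (0 + \<mu> *\<^sub>R - P + (mat 1 + \<mu> *\<^sub>R 0) ** T) \<noteq> 0"
      using det_diff_U2[OF R contr_scale[OF P _ _ R] \<open>T \<in> U2 R\<close>, of \<mu>] by simp
  next
    fix \<mu> :: real and T
    show "pdet M ((mat 1 + \<mu> *\<^sub>R 0) ** (- \<mu> *\<^sub>R P + csc 0 T - T ** 0 ** T)) =
        0 * det M + 1 * of_real \<mu> * pdet M (- P + 0 ** T)" for M
      by (simp add: pdet_def mult_entry) (simp add: scaleR_conv_of_real algebra_simps)
  qed (simp_all add: trace_def mult_entry sum_2)
  then have "u2_integral R (\<lambda>T. inverse (det (T - P)) * inverse (det (T - P))) =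
      u2_integral R (\<lambda>T. 1 / (det T)\<^sup>2)"
    by (simp add: dinv_def eval_nat_numeral power2_eq_square divide_inverse)
  then show ?thesis using u2_integral_orientation[OF R] by simp
qed


text \<open>Contracting the contour towards \<open>P\<close> reduces the claim to constant numerators.\<close>

lemma szego_formula:
  assumes R: "R > 0" and A: "contr (1/R) A1" "contr (1/R) A2" and P: "contr R P"
  shows "u2_integral R (\<lambda>T. inverse (det (mat 1 - A1 ** T)) * inverse (det (mat 1 - A2 ** T)) *
      inverse (det (T - P)) * inverse (det (T - P))) =
    - 2 * of_real (pi ^ 3) * \<i> * (inverse (det (mat 1 - A1 ** P)) * inverse (det (mat 1 - A2 ** P)))"
proof -
  \<comment> \<open>The first two factors are the outer ones with T replaced by P + \<mu> (T - P);
    the last two are the fixed double pole.\<close>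
  define K0 K1 L0 L1 where "K0 = idx4 (mat 1 - A1 ** P) (mat 1 - A2 ** P) (- P) (- P)"
    "K1 = idx4 (A1 ** P) (A2 ** P) 0 0" "L0 = idx4 0 0 (mat 1) (mat 1 :: cmat)" "L1 = idx4 (- A1) (- A2) 0 0"
  note KL = this
  have eqA: "pdet M ((0 + \<mu> *\<^sub>R - B) ** (- P + csc 1 T - T ** 0 ** T)) =
      0 * det M + 1 * of_real \<mu> * pdet M (B ** P + - B ** T)" for M B T :: cmat and \<mu>
    by (simp add: pdet_def mult_entry) (simp add: scaleR_conv_of_real algebra_simps)
  have eqP: "pdet ((- P + \<mu> *\<^sub>R 0) + (mat 1 + \<mu> *\<^sub>R 0) ** T) ((mat 1 + \<mu> *\<^sub>R 0) ** (- P + csc 1 T - T ** 0 ** T)) =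
      2 * det ((- P + \<mu> *\<^sub>R 0) + (mat 1 + \<mu> *\<^sub>R 0) ** T) + 1 * of_real \<mu> *
        pdet ((- P + \<mu> *\<^sub>R 0) + (mat 1 + \<mu> *\<^sub>R 0) ** T) (0 + 0 ** T)" for T :: cmat and \<mu>
    by (simp add: pdet_def det_2 mult_entry algebra_simps)
  have "u2_integral R (\<lambda>T. dinv 4 (\<lambda>i. (K0 i + 1 *\<^sub>R K1 i) + (L0 i + 1 *\<^sub>R L1 i) ** T)) =
     0 ^ 0 * u2_integral R (\<lambda>T. dinv 4 (\<lambda>i. (K0 i + 0 *\<^sub>R K1 i) + (L0 i + 0 *\<^sub>R L1 i) ** T))"
  \<comment> \<open>The field is T - P. Its divergence 4 is used up by the two factors N(T -
    P)^(-1), each of degree 2, so no power of \<mu> remains.\<close>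
  proof (rule homotopy_U2[OF R, where C = "\<lambda>_. - P" and a = 1 and A = 0 and \<tau> = "\<lambda>_ _. idx4 0 0 2 2" and \<sigma> = 1])
    fix \<mu> :: real and T and i :: nat assume \<mu>: "\<mu> \<in> {0..1}" and T: "T \<in> U2 R" and i: "i < 4"
    have 1: "(mat 1 - B ** P + \<mu> *\<^sub>R (B ** P)) + (0 + \<mu> *\<^sub>R - B) ** T =
        mat 1 - B ** (P + \<mu> *\<^sub>R (T - P))" for B
      by (simp add: cmat_eq_iff mult_entry) (simp add: scaleR_conv_of_real algebra_simps)
    have 2: "(- P + \<mu> *\<^sub>R 0) + (mat 1 + \<mu> *\<^sub>R 0) ** T = T - P"
      by (simp add: cmat_eq_iff mult_entry)
    note nzA = det_1_minus_le[OF R _ norm_vmult_convex_U2[OF R P T \<mu>]]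
    show "det (K0 i + \<mu> *\<^sub>R K1 i + (L0 i + \<mu> *\<^sub>R L1 i) ** T) \<noteq> 0"
      by (rule less4_cases[OF i]; simp only: KL idx4 One_nat_def 1 2; rule nzA A det_diff_U2[OF R P T])+
  next
    fix \<mu> :: real and T and i :: nat assume i: "i < 4"
    show "pdet (K0 i + \<mu> *\<^sub>R K1 i + (L0 i + \<mu> *\<^sub>R L1 i) ** T)
        ((L0 i + \<mu> *\<^sub>R L1 i) ** (- P + csc 1 T - T ** 0 ** T)) =
        idx4 0 0 2 2 i * det (K0 i + \<mu> *\<^sub>R K1 i + (L0 i + \<mu> *\<^sub>R L1 i) ** T) +
        1 * of_real \<mu> * pdet (K0 i + \<mu> *\<^sub>R K1 i + (L0 i + \<mu> *\<^sub>R L1 i) ** T) (K1 i + L1 i ** T)"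
      by (rule less4_cases[OF i]; simp only: KL idx4 One_nat_def; rule eqA eqP)
  qed (simp_all add: trace_def mult_entry sum_2 sum4)
  also have "(\<lambda>T. dinv 4 (\<lambda>i. (K0 i + 1 *\<^sub>R K1 i) + (L0 i + 1 *\<^sub>R L1 i) ** T)) =
     (\<lambda>T. inverse (det (mat 1 - A1 ** T)) * inverse (det (mat 1 - A2 ** T)) *
      inverse (det (T - P)) * inverse (det (T - P)))"
    by (simp add: dinv4 KL minus_mult mult_ac)
  also have "(\<lambda>T. dinv 4 (\<lambda>i. (K0 i + 0 *\<^sub>R K1 i) + (L0 i + 0 *\<^sub>R L1 i) ** T)) =
     (\<lambda>T. (inverse (det (mat 1 - A1 ** P)) * inverse (det (mat 1 - A2 ** P))) *
      (inverse (det (T - P)) * inverse (det (T - P))))"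
    by (simp add: dinv4 KL minus_mult mult_ac)
  finally show ?thesis
    unfolding u2_integral_cmult integral_inverse_square[OF R P] by simp
qed

text \<open>In the coordinate \<open>T\<^sup>-\<^sup>1\<close>, the homotopy contracts the contour towards \<open>A\<close>.\<close>

lemma one_outer_pole_integral:
  assumes R: "R > 0" and A: "contr (1/R) A" and W: "contr R W" and P: "contr R P"
  shows "u2_integral R (\<lambda>T. inverse (det (mat 1 - A ** T)) * inverse (det (T - W)) *
      inverse (det (T - P)) * inverse (det (T - P))) = 0"
proof -
  \<comment> \<open>With S = T^(-1), a factor T - V equals (1 - V S) T, and here S is replaced by A
    + \<mu> (S - A) inside the bracket. The factor 1 - A T = (S - A) T is kept fixed.\<close>
  define K0 K1 L0 L1 where "K0 = idx4 (mat 1 :: cmat) 0 0 0"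
    "K1 = idx4 0 (- W) (- P) (- P)"
    "L0 = idx4 (- A) (mat 1 - W ** A) (mat 1 - P ** A) (mat 1 - P ** A)" "L1 = idx4 0 (W ** A) (P ** A) (P ** A)"
  note KL = this
  define t where "t = (\<lambda>T. trace (A ** T))"
  have eqA: "pdet ((mat 1 + \<mu> *\<^sub>R 0) + (- A + \<mu> *\<^sub>R 0) ** T) ((- A + \<mu> *\<^sub>R 0) ** (0 + csc 1 T - T ** A ** T)) =
      - t T * det ((mat 1 + \<mu> *\<^sub>R 0) + (- A + \<mu> *\<^sub>R 0) ** T) + (-1) * of_real \<mu> *
        pdet ((mat 1 + \<mu> *\<^sub>R 0) + (- A + \<mu> *\<^sub>R 0) ** T) (0 + 0 ** T)" for T :: cmat and \<mu>
  proof -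
    have 1: "(mat 1 + \<mu> *\<^sub>R 0) + (- A + \<mu> *\<^sub>R 0) ** T = mat 1 - A ** T"
      by (simp add: cmat_eq_iff mult_entry)
    have 2: "(- A + \<mu> *\<^sub>R 0) ** (0 + csc 1 T - T ** A ** T) = (mat 1 - A ** T) ** (- (A ** T))"
      by (simp add: cmat_eq_iff mult_entry algebra_simps)
    show ?thesis unfolding 1 2 pdet_mult_right
      by (simp add: t_def trace_def sum_2) (simp add: pdet_def mult_entry)
  qed
  have eqW: "pdet ((0 + \<mu> *\<^sub>R - V) + (mat 1 - V ** A + \<mu> *\<^sub>R (V ** A)) ** T)
      ((mat 1 - V ** A + \<mu> *\<^sub>R (V ** A)) ** (0 + csc 1 T - T ** A ** T)) =
      (2 - t T) * det ((0 + \<mu> *\<^sub>R - V) + (mat 1 - V ** A + \<mu> *\<^sub>R (V ** A)) ** T) + (-1) * of_real \<mu> *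
        pdet ((0 + \<mu> *\<^sub>R - V) + (mat 1 - V ** A + \<mu> *\<^sub>R (V ** A)) ** T) (- V + V ** A ** T)"
    for T V :: cmat and \<mu>
  proof -
    define M where "M = (0 + \<mu> *\<^sub>R - V) + (mat 1 - V ** A + \<mu> *\<^sub>R (V ** A)) ** T"
    have 1: "(mat 1 - V ** A + \<mu> *\<^sub>R (V ** A)) ** (0 + csc 1 T - T ** A ** T) =
       M ** (mat 1 - A ** T) + \<mu> *\<^sub>R (V - V ** A ** T)"
    proof -
      have "csc 1 T - T ** A ** T = T ** (mat 1 - A ** T)"
        by (simp add: cmat_eq_iff mult_entry algebra_simps)
      then have "(mat 1 - V ** A + \<mu> *\<^sub>R (V ** A)) ** (0 + csc 1 T - T ** A ** T) =
          (M + \<mu> *\<^sub>R V) ** (mat 1 - A ** T)"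
        by (simp add: M_def matrix_mul_assoc)
      also have "\<dots> = M ** (mat 1 - A ** T) + \<mu> *\<^sub>R (V ** (mat 1 - A ** T))"
        unfolding cmat_eq_iff by (simp add: mult_entry) (simp add: scaleR_conv_of_real algebra_simps)
      finally show ?thesis by (simp add: matrix_diff matrix_mul_assoc)
    qed
    have 2: "pdet M (U + \<mu> *\<^sub>R H) = pdet M U + of_real \<mu> * pdet M H" for U H
      by (simp add: pdet_def) (simp add: scaleR_conv_of_real algebra_simps)
    have 3: "pdet M (V - H) = - pdet M (- V + H)" for H
      by (simp add: pdet_def algebra_simps)
    have 4: "trace (mat 1 - A ** T) = 2 - t T"
      by (simp add: t_def trace_def sum_2)
    show ?thesis
      unfolding M_def[symmetric] 1 2 3[of "V ** A ** T"] pdet_mult_right 4 by simp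
  qed
  \<comment> \<open>The exponent 2: in the coordinate S, contraction towards A scales dV by degree 4
    while N(S - A)^(-1) compensates only 2. In terms of T this is the count 4 - 4 t - (-t + 3 (2 -
    t)) = -2 with t = tr(A T).\<close>
  have "u2_integral R (\<lambda>T. dinv 4 (\<lambda>i. (K0 i + 1 *\<^sub>R K1 i) + (L0 i + 1 *\<^sub>R L1 i) ** T)) =
     0 ^ 2 * u2_integral R (\<lambda>T. dinv 4 (\<lambda>i. (K0 i + 0 *\<^sub>R K1 i) + (L0 i + 0 *\<^sub>R L1 i) ** T))"
  proof (rule homotopy_U2[OF R, where C = "\<lambda>_. 0" and a = 1 and A = A and
        \<tau> = "\<lambda>_ T. idx4 (- t T) (2 - t T) (2 - t T) (2 - t T)" and \<sigma> = "-1"])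
    fix \<mu> :: real and T and i :: nat assume \<mu>: "\<mu> \<in> {0..1}" and T: "T \<in> U2 R" and i: "i < 4"
    have 1: "(mat 1 + \<mu> *\<^sub>R 0) + (- A + \<mu> *\<^sub>R 0) ** T = mat 1 - A ** T"
      by (simp add: cmat_eq_iff mult_entry)
    have 2: "det ((0 + \<mu> *\<^sub>R - V) + (mat 1 - V ** A + \<mu> *\<^sub>R (V ** A)) ** T) \<noteq> 0" if V: "contr R V" for V
    proof (rule det_nonzeroI)
      fix v :: "complex^2" assume v: "v \<noteq> 0"
      define w where "w = v v* V"
      have w: "norm w < R * norm v" unfolding w_def by (rule contrD[OF V v])
      have "norm ((1 - \<mu>) *\<^sub>R (w v* A v* T) + \<mu> *\<^sub>R w) \<le> (1 - \<mu>) * norm (w v* A v* T) + \<mu> * norm w"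
        using \<mu> by (intro norm_triangle_le) simp
      also have "\<dots> \<le> (1 - \<mu>) * norm w + \<mu> * norm w"
        using \<mu> R contr_le[OF A, of w] norm_vmult_U2[OF R T, of "w v* A"]
        by (intro add_mono mult_left_mono) (auto simp: field_simps)
      also have "\<dots> < norm (v v* T)"
        using w norm_vmult_U2[OF R T, of v] by (simp add: algebra_simps)
      finally have "v v* T \<noteq> (1 - \<mu>) *\<^sub>R (w v* A v* T) + \<mu> *\<^sub>R w" by auto
      moreover have "(0 + \<mu> *\<^sub>R - V) + (mat 1 - V ** A + \<mu> *\<^sub>R (V ** A)) ** T =
          T - ((1 - \<mu>) *\<^sub>R (V ** A ** T) + \<mu> *\<^sub>R V)"
        unfolding cmat_eq_iff by (simp add: mult_entry) (simp add: scaleR_conv_of_real algebra_simps)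
      ultimately show "v v* ((0 + \<mu> *\<^sub>R - V) + (mat 1 - V ** A + \<mu> *\<^sub>R (V ** A)) ** T) \<noteq> 0"
        by (simp only: w_def vmult_diff vmult_add vmult_scale vmult_assoc right_minus_eq) simp
    qed
    show "det (K0 i + \<mu> *\<^sub>R K1 i + (L0 i + \<mu> *\<^sub>R L1 i) ** T) \<noteq> 0"
      by (rule less4_cases[OF i]; simp only: KL idx4 One_nat_def 1; rule 2[OF W] 2[OF P] det_1_minus_U2[OF R A T])
  next
    fix \<mu> :: real and T and i :: nat assume i: "i < 4"
    show "pdet (K0 i + \<mu> *\<^sub>R K1 i + (L0 i + \<mu> *\<^sub>R L1 i) ** T)
        ((L0 i + \<mu> *\<^sub>R L1 i) ** (0 + csc 1 T - T ** A ** T)) =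
        idx4 (- t T) (2 - t T) (2 - t T) (2 - t T) i * det (K0 i + \<mu> *\<^sub>R K1 i + (L0 i + \<mu> *\<^sub>R L1 i) ** T) +
        (-1) * of_real \<mu> * pdet (K0 i + \<mu> *\<^sub>R K1 i + (L0 i + \<mu> *\<^sub>R L1 i) ** T) (K1 i + L1 i ** T)"
      by (rule less4_cases[OF i]; simp only: KL idx4 One_nat_def; rule eqA eqW)
  qed (simp_all add: t_def sum4)
  also have "(\<lambda>T. dinv 4 (\<lambda>i. (K0 i + 1 *\<^sub>R K1 i) + (L0 i + 1 *\<^sub>R L1 i) ** T)) =
     (\<lambda>T. inverse (det (mat 1 - A ** T)) * inverse (det (T - W)) *
      inverse (det (T - P)) * inverse (det (T - P)))"
    by (simp add: dinv4 KL minus_mult mult_ac)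
  finally show ?thesis by simp
qed

section \<open>The forms \<open>Q_s\<close> and the one-loop formula\<close>

definition cross_form :: "complex \<Rightarrow> complex \<Rightarrow> complex \<Rightarrow> real \<Rightarrow> complex" where
  "cross_form a b c s = (1 - of_real s) * a + of_real s * b - of_real s * (1 - of_real s) * c"

text \<open>The pair (G, H) of \<open>conformal_point\<close> is taken to be (1, T) and (A1, 1). The
  second identity holds for all A1, so that inner and outer points may later exchange their
  roles.\<close>

lemma cross_form_conformal_point:
  assumes R: "R > 0" and A2: "contr (1/R) A2" and W: "contr R W1" "contr R W2"
    and s: "s \<in> {0..1}"
  obtains P e where "contr R P" "e \<noteq> 0"
    "\<And>T. e * det (T - P) = cross_form (det (mat 1 - A2 ** W1) * det (T - W2))
        (det (mat 1 - A2 ** W2) * det (T - W1)) (det (W1 - W2) * det (mat 1 - A2 ** T)) s"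
    "\<And>A1. e * det (mat 1 - A1 ** P) = cross_form (det (mat 1 - A2 ** W1) * det (mat 1 - A1 ** W2))
        (det (mat 1 - A1 ** W1) * det (mat 1 - A2 ** W2)) (det (A1 - A2) * det (W1 - W2)) s"
proof -
  obtain P e where P: "contr R P" "e \<noteq> 0" and eq:
    "\<And>G H. e * det (G ** P - H) = (1-s) * det (mat 1 - A2 ** W1) * det (G ** W2 - H)
       + s * det (mat 1 - A2 ** W2) * det (G ** W1 - H)
       - s * (1-s) * det (W1 - W2) * det (G - H ** A2)"
    using conformal_point[OF R A2 W, of s] s by auto
  have sw: "det (X - Y) = det (Y - X)" for X Y :: cmat
    by (simp add: det_2 algebra_simps)
  show ?thesis
  proof (rule that[OF P])
    fix T
    show "e * det (T - P) = cross_form (det (mat 1 - A2 ** W1) * det (T - W2))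
        (det (mat 1 - A2 ** W2) * det (T - W1)) (det (W1 - W2) * det (mat 1 - A2 ** T)) s"
      using eq[of "mat 1" T]
      by (simp add: cross_form_def sw[of _ T] det_1_minus_comm[of T A2] algebra_simps)
  next
    fix A1
    show "e * det (mat 1 - A1 ** P) = cross_form (det (mat 1 - A2 ** W1) * det (mat 1 - A1 ** W2))
        (det (mat 1 - A1 ** W1) * det (mat 1 - A2 ** W2)) (det (A1 - A2) * det (W1 - W2)) s"
      using eq[of A1 "mat 1"]
      by (simp add: cross_form_def sw[of _ "mat 1"] algebra_simps)
  qed
qed

lemma cross_form_U2_nonzero:
  assumes "R > 0" "contr (1/R) A2" "contr R W1" "contr R W2" "s \<in> {0..1}" "T \<in> U2 R"
  shows "cross_form (det (mat 1 - A2 ** W1) * det (T - W2))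
      (det (mat 1 - A2 ** W2) * det (T - W1)) (det (W1 - W2) * det (mat 1 - A2 ** T)) s \<noteq> 0"
  by (rule cross_form_conformal_point[OF assms(1-5)])
     (metis mult_eq_0_iff det_diff_U2[OF assms(1) _ assms(6)])

lemma continuous_on_cross_form:
  assumes "continuous_on S a" "continuous_on S b" "continuous_on S c" "continuous_on S s"
  shows "continuous_on S (\<lambda>x. cross_form (a x) (b x) (c x) (s x))"
  unfolding cross_form_def by (intro continuous_intros assms)

text \<open>With Q denoting the form, Q - s Q' = a - s^2 c no longer contains b. The quotient s/Q
  runs from 0 at s = 0 to 1/b at s = 1, so integrating its derivative represents 1/b by terms with
  numerators a and c only.\<close>

lemma cross_form_quotient_derivative:
  assumes "cross_form a b c s \<noteq> 0"
  shows "((\<lambda>s. of_real s * inverse (cross_form a b c s)) has_vector_derivative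
    (a - of_real s ^ 2 * c) * (inverse (cross_form a b c s) * inverse (cross_form a b c s))) (at s within S)"
proof -
  have 1: "((\<lambda>s. cross_form a b c s) has_vector_derivative (b - a - c + 2 * of_real s * c)) (at s within S)"
    unfolding cross_form_def
    by (auto intro!: derivative_eq_intros simp: algebra_simps)
  have 2: "((\<lambda>s. inverse (cross_form a b c s)) has_vector_derivative
      - (inverse (cross_form a b c s) * (b - a - c + 2 * of_real s * c) * inverse (cross_form a b c s))) (at s within S)"
    using Deriv.has_derivative_inverse[OF assms 1[unfolded has_vector_derivative_def]]
    unfolding has_vector_derivative_def
    by (rule has_derivative_eq_rhs) (auto simp: fun_eq_iff)
  have 3: "((\<lambda>s. complex_of_real s) has_vector_derivative 1) (at s within S)"
    by (auto intro!: derivative_eq_intros)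
  have alg: "x * - (y * (b - a - c + 2 * x * c) * y) + 1 * y = (a - x ^ 2 * c) * (y * y)"
    if "((1 - x) * a + x * b - x * (1 - x) * c) * y = 1" for x y :: complex
    using that by algebra
  show ?thesis
    by (intro has_vector_derivative_eq_rhs[OF has_vector_derivative_mult[OF 3 2]] alg)
       (use assms in \<open>simp add: cross_form_def\<close>)
qed

text \<open>Both sides are compared along the conformal line through \<open>W2\<close> and \<open>W1\<close> that
  ends at the pole \<open>A2\<^sup>-\<^sup>1\<close>.\<close>

theorem one_loop_integral:
  assumes R: "R > 0" and A: "contr (1/R) A1" "contr (1/R) A2" and W: "contr R W1" "contr R W2"
  shows "u2_integral R (\<lambda>T. inverse (det (mat 1 - A1 ** T)) * inverse (det (mat 1 - A2 ** T)) *
      inverse (det (T - W1)) * inverse (det (T - W2))) =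
    - 2 * of_real (pi ^ 3) * \<i> * integral {0..1} (\<lambda>s.
      inverse (cross_form (det (mat 1 - A2 ** W1) * det (mat 1 - A1 ** W2))
        (det (mat 1 - A1 ** W1) * det (mat 1 - A2 ** W2)) (det (A1 - A2) * det (W1 - W2)) s))"
proof -
  define k where "k = - 2 * complex_of_real (pi ^ 3) * \<i>"
  define Q where "Q = (\<lambda>s. cross_form (det (mat 1 - A2 ** W1) * det (mat 1 - A1 ** W2))
        (det (mat 1 - A1 ** W1) * det (mat 1 - A2 ** W2)) (det (A1 - A2) * det (W1 - W2)) s)"
  define a where "a = (\<lambda>T. det (mat 1 - A2 ** W1) * det (T - W2))"
  define b where "b = (\<lambda>T. det (mat 1 - A2 ** W2) * det (T - W1))"
  define c where "c = (\<lambda>T. det (W1 - W2) * det (mat 1 - A2 ** T))"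
  define q where "q = (\<lambda>s T. cross_form (a T) (b T) (c T) s)"
  \<comment> \<open>\<open>d\<close> lacks the pole at W1. That pole comes from \<open>b\<close>,
    the value of \<open>q\<close> at s = 1.\<close>
  define d where "d = (\<lambda>T. inverse (det (mat 1 - A1 ** T)) * inverse (det (mat 1 - A2 ** T)) * inverse (det (T - W2)))"
  define F where "F = (\<lambda>s T. d T * (of_real s * inverse (q s T)))"
  define F' where "F' = (\<lambda>s T. d T * ((a T - of_real s ^ 2 * c T) * (inverse (q s T) * inverse (q s T))))"
  have q0: "q s T \<noteq> 0" if "s \<in> {0..1}" "T \<in> U2 R" for s T
    unfolding q_def a_def b_def c_def by (rule cross_form_U2_nonzero[OF R A(2) W that])
  have T0: "det (mat 1 - A1 ** T) \<noteq> 0" "det (mat 1 - A2 ** T) \<noteq> 0" "det (T - W2) \<noteq> 0" if "T \<in> U2 R" for T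
    using det_1_minus_U2[OF R _ that] det_diff_U2[OF R _ that] A W by blast+
  note ci = continuous_intros continuous_on_det continuous_on_mult_entry
  have cabc: "continuous_on S (\<lambda>x. a (f x))" "continuous_on S (\<lambda>x. b (f x))" "continuous_on S (\<lambda>x. c (f x))"
    if "continuous_on S f" for S :: "'t::topological_space set" and f
    unfolding a_def b_def c_def by (intro ci that)+
  have cd: "continuous_on (U2 R) d"
    unfolding d_def by (intro ci) (use T0 in auto)
  have cd2: "continuous_on ({0..1} \<times> U2 R) (\<lambda>x. d (snd x))"
    by (rule continuous_on_compose2[OF cd]) (auto intro!: continuous_intros)
  have cq: "continuous_on ({0..1} \<times> U2 R) (\<lambda>x. inverse (q (fst x) (snd x)))"
    using q0 unfolding q_def by (intro continuous_intros continuous_on_cross_form cabc) auto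
  have cF: "continuous_on ({0..1} \<times> U2 R) (\<lambda>(s, T). F s T)"
    and cF': "continuous_on ({0..1} \<times> U2 R) (\<lambda>(s, T). F' s T)"
    unfolding F_def F'_def case_prod_beta' by (intro continuous_intros cd2 cq cabc)+
  have deriv: "((\<lambda>s. F s T) has_vector_derivative F' s T) (at s within {0..1})"
    if "s \<in> {0..1}" "T \<in> U2 R" for s T
    unfolding F_def F'_def q_def
    by (intro has_vector_derivative_mult_right cross_form_quotient_derivative)
       (use q0[OF that] in \<open>simp add: q_def\<close>)
  have val: "u2_integral R (F' s) = k * inverse (det (mat 1 - A2 ** W2)) * inverse (Q s)"
    if s: "s \<in> {0..1}" for s
  proof -
    obtain P e where P: "contr R P" "e \<noteq> 0" and eP: "\<And>T. e * det (T - P) = q s T"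
      and eA: "\<And>A1. e * det (mat 1 - A1 ** P) = cross_form (det (mat 1 - A2 ** W1) * det (mat 1 - A1 ** W2))
        (det (mat 1 - A1 ** W1) * det (mat 1 - A2 ** W2)) (det (A1 - A2) * det (W1 - W2)) s"
      by (rule cross_form_conformal_point[OF R A(2) W s], rule that)
         (simp_all only: q_def a_def b_def c_def)
    define f1 where "f1 = (\<lambda>T. inverse (det (mat 1 - A1 ** T)) * inverse (det (mat 1 - A2 ** T)) *
        inverse (det (T - P)) * inverse (det (T - P)))"
    define f2 where "f2 = (\<lambda>T. inverse (det (mat 1 - A1 ** T)) * inverse (det (T - W2)) *
        inverse (det (T - P)) * inverse (det (T - P)))"
    have cf: "continuous_on (U2 R) f1" "continuous_on (U2 R) f2"
      unfolding f1_def f2_def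
      by (intro ci; use T0 det_diff_U2[OF R P(1)] in blast)+
    \<comment> \<open>The numerator \<open>a\<close> cancels the pole at W2 and \<open>c\<close>
      cancels the outer factor of A2. What remains has a double pole at P: \<open>f1\<close> with
      two outer factors and \<open>f2\<close> with one outer factor and one further inner
      pole.\<close>
    have "F' s T = (det (mat 1 - A2 ** W1) * inverse e * inverse e) * f1 T +
        (- (of_real s ^ 2 * det (W1 - W2) * inverse e * inverse e)) * f2 T" if T: "T \<in> U2 R" for T
    proof -
      have alg: "x * y * w * ((n1 * n3 - r * (n4 * n2)) * ((i * p) * (i * p))) =
          (n1 * i * i) * (x * y * p * p) + (- (r * n4 * i * i)) * (x * w * p * p)"
        if "n3 * w = 1" "n2 * y = 1" for x y w n1 n2 n3 n4 r i p :: complex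
        using that by algebra
      show ?thesis
        unfolding F'_def f1_def f2_def d_def a_def c_def eP[symmetric] inverse_mult_distrib
        by (rule alg) (use T0[OF T] in auto)
    qed
    then have "u2_integral R (F' s) = u2_integral R (\<lambda>T. (det (mat 1 - A2 ** W1) * inverse e * inverse e) * f1 T +
        (- (of_real s ^ 2 * det (W1 - W2) * inverse e * inverse e)) * f2 T)"
      by (rule u2_integral_cong)
    also have "\<dots> = (det (mat 1 - A2 ** W1) * inverse e * inverse e) * u2_integral R f1 +
        (- (of_real s ^ 2 * det (W1 - W2) * inverse e * inverse e)) * u2_integral R f2"
      by (subst u2_integral_add) (intro continuous_intros cf, intro continuous_intros cf,
        simp only: u2_integral_cmult)
    also have "u2_integral R f1 = k * (inverse (det (mat 1 - A1 ** P)) * inverse (det (mat 1 - A2 ** P)))"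
      unfolding f1_def k_def by (rule szego_formula[OF R A P(1)])
    also have "u2_integral R f2 = 0"
      unfolding f2_def by (rule one_outer_pole_integral[OF R A(1) W(2) P(1)])
    finally have "u2_integral R (F' s) = det (mat 1 - A2 ** W1) * k *
        (inverse (e * det (mat 1 - A1 ** P)) * inverse (e * det (mat 1 - A2 ** P)))"
      by (simp add: mult_ac)
    also have "e * det (mat 1 - A1 ** P) = Q s" unfolding eA Q_def ..
    \<comment> \<open>For A1 = A2 the form has equal first two coefficients and c = 0, hence does
      not depend on s.\<close>
    also have "e * det (mat 1 - A2 ** P) = det (mat 1 - A2 ** W1) * det (mat 1 - A2 ** W2)"
      unfolding eA cross_form_def by (simp add: det_2[of 0] algebra_simps)
    finally show ?thesis
      using contr_1_minus'[OF R A(2) W(1)] by (simp add: mult_ac)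
  qed
  have "((\<lambda>s. u2_integral R (F' s)) has_integral (u2_integral R (F 1) - u2_integral R (F 0))) {0..1}"
    by (rule fundamental_theorem_of_calculus) (auto intro!: u2_leibniz[OF deriv cF cF'])
  then have "integral {0..1} (\<lambda>s. u2_integral R (F' s)) = u2_integral R (F 1) - u2_integral R (F 0)"
    by (rule integral_unique)
  moreover have "u2_integral R (F 0) = 0"
    using u2_integral_cmult[of R 0 "\<lambda>_. 0"] by (simp add: F_def)
  moreover have "integral {0..1} (\<lambda>s. u2_integral R (F' s)) =
      integral {0..1} (\<lambda>s. (k * inverse (det (mat 1 - A2 ** W2))) * inverse (Q s))"
    using val by (intro Henstock_Kurzweil_Integration.integral_cong) auto
  moreover have "F 1 = (\<lambda>T. inverse (det (mat 1 - A2 ** W2)) * (inverse (det (mat 1 - A1 ** T)) *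
      inverse (det (mat 1 - A2 ** T)) * inverse (det (T - W1)) * inverse (det (T - W2))))"
    by (simp add: F_def d_def q_def cross_form_def b_def fun_eq_iff)
  ultimately show ?thesis
    using contr_1_minus'[OF R A(2) W(2)] unfolding k_def[symmetric] Q_def[symmetric]
    by (simp add: u2_integral_cmult)
qed

section \<open>Slingshots\<close>

text \<open>The semigroup law that makes parameters multiply: replacing b by \<open>Q_s\<close> and
  c by s^2 c turns the form at t into \<open>Q_(s t)\<close>. In a slingshot the common factor p is
  the dashed edge.\<close>

lemma cross_form_compose:
  "cross_form (p * a) (p * cross_form a b c s) (p * of_real s ^ 2 * c) t = p * cross_form a b c (s * t)"
  by (simp add: cross_form_def algebra_simps power2_eq_square)

lemma cross_form_scale: "k * cross_form a b c s = cross_form (k * a) (k * b) (k * c) s"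
  by (simp add: cross_form_def algebra_simps)

definition quad :: "cmat \<Rightarrow> cmat \<Rightarrow> cmat \<Rightarrow> cmat \<Rightarrow> real \<Rightarrow> complex" where
  "quad Z1 Z2 W1 W2 = cross_form (det (Z1 - W2) * det (Z2 - W1)) (det (Z1 - W1) * det (Z2 - W2))
     (det (Z1 - Z2) * det (W1 - W2))"

lemma det_diff_comm: "det (X - Y) = det (Y - (X :: cmat))"
  by (simp add: det_2 algebra_simps)

lemma quad_sym: "quad Z1 Z2 W1 W2 = quad Z2 Z1 W2 W1"
  unfolding quad_def using det_diff_comm[of Z1 Z2] det_diff_comm[of W1 W2]
  by (simp add: mult.commute)

lemma det_diff_inverse:
  assumes "Z ** A = mat 1"
  shows "det (T - Z) = det Z * det (mat 1 - A ** (T :: cmat))"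
proof -
  have "det Z * det (mat 1 - A ** T) = det (Z - (Z ** A) ** T)"
    unfolding det_mul[symmetric] by (simp add: matrix_diff matrix_mul_assoc)
  then show ?thesis by (simp add: assms det_diff_comm)
qed

lemma det_diff_inverses:
  assumes "Z1 ** A1 = mat 1" "A2 ** Z2 = mat 1"
  shows "det (Z1 - Z2) = det Z1 * det Z2 * det (A1 - (A2 :: cmat))"
proof -
  have "det (Z1 ** (A2 - A1) ** Z2) = det (Z1 ** (A2 ** Z2) - (Z1 ** A1) ** Z2)"
    by (simp add: matrix_diff matrix_mul_assoc cmat_eq_iff mult_entry algebra_simps
        arg_cong[of _ _ det])
  then show ?thesis using assms by (simp add: det_mul det_diff_comm[of A1] mult_ac)
qed

lemma D_minus_inverse:
  assumes R: "R > 0" and Z: "Z \<in> D_minus R"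
  obtains A where "Z ** A = mat 1" "A ** Z = mat 1" "contr (1/R) A" "det Z \<noteq> 0"
proof -
  have Z': "norm (v v* Z) > R * norm v" if "v \<noteq> 0" for v
    using Z that unfolding D_minus_iff[OF R] by blast
  have d: "det Z \<noteq> 0"
  proof (rule det_nonzeroI)
    fix v :: "complex^2" assume "v \<noteq> 0"
    then show "v v* Z \<noteq> 0" using Z'[of v] R by (auto simp: mult_less_0_iff)
  qed
  then obtain A where A: "Z ** A = mat 1" "A ** Z = mat 1" using inverse_cmat by metis
  have "contr (1/R) A"
    unfolding contr_def
  proof (intro allI impI)
    fix v :: "complex^2" assume v: "v \<noteq> 0"
    have vA: "(v v* A) v* Z = v" unfolding vmult_assoc A vmult_1 ..
    then have "v v* A \<noteq> 0" using v by (auto simp: vmult_0)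
    from Z'[OF this] show "norm (v v* A) < 1/R * norm v"
      unfolding vA using R by (simp add: field_simps)
  qed
  with A d that show ?thesis by blast
qed

definition loop_const :: complex where "loop_const = \<i> / of_real (2 * pi ^ 3)"

lemma loop_const_mult: "loop_const * (- 2 * of_real (pi ^ 3) * \<i>) = 1"
  by (simp add: loop_const_def field_simps)

lemma one_loop:
  assumes R: "R > 0" and Z: "Z1 \<in> D_minus R" "Z2 \<in> D_minus R" and W: "W1 \<in> D_plus R" "W2 \<in> D_plus R"
  shows "loop_const * u2_integral R (\<lambda>T. inverse (det (T - Z1)) * inverse (det (T - Z2)) *
      inverse (det (T - W1)) * inverse (det (T - W2))) =
    integral {0..1} (\<lambda>s. inverse (quad Z1 Z2 W1 W2 s))"
proof -
  obtain A1 where A1: "Z1 ** A1 = mat 1" "A1 ** Z1 = mat 1" "contr (1/R) A1" "det Z1 \<noteq> 0"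
    using D_minus_inverse[OF R Z(1)] by blast
  obtain A2 where A2: "Z2 ** A2 = mat 1" "A2 ** Z2 = mat 1" "contr (1/R) A2" "det Z2 \<noteq> 0"
    using D_minus_inverse[OF R Z(2)] by blast
  note d = det_diff_inverse[OF A1(1)] det_diff_inverse[OF A2(1)]
  define k where "k = inverse (det Z1) * inverse (det Z2)"
  define G where "G = (\<lambda>T. inverse (det (mat 1 - A1 ** T)) * inverse (det (mat 1 - A2 ** T)) *
      inverse (det (T - W1)) * inverse (det (T - W2)))"
  define q where "q = (\<lambda>s. inverse (cross_form (det (mat 1 - A2 ** W1) * det (mat 1 - A1 ** W2))
        (det (mat 1 - A1 ** W1) * det (mat 1 - A2 ** W2)) (det (A1 - A2) * det (W1 - W2)) s))"
  have 1: "(\<lambda>T. inverse (det (T - Z1)) * inverse (det (T - Z2)) *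
      inverse (det (T - W1)) * inverse (det (T - W2))) = (\<lambda>T. k * G T)"
    unfolding d G_def k_def by (simp add: fun_eq_iff)
  have "quad Z1 Z2 W1 W2 s = det Z1 * det Z2 * cross_form (det (mat 1 - A2 ** W1) * det (mat 1 - A1 ** W2))
        (det (mat 1 - A1 ** W1) * det (mat 1 - A2 ** W2)) (det (A1 - A2) * det (W1 - W2)) s" for s
    unfolding quad_def cross_form_scale det_diff_inverses[OF A1(1) A2(2)]
    unfolding det_diff_comm[of Z1 W1] det_diff_comm[of Z1 W2]
      det_diff_comm[of Z2 W1] det_diff_comm[of Z2 W2] d
    by (simp add: mult_ac)
  then have 2: "inverse (quad Z1 Z2 W1 W2 s) = k * q s" for s
    unfolding q_def k_def by simp
  have "u2_integral R G = - 2 * of_real (pi ^ 3) * \<i> * integral {0..1} q"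
    unfolding G_def q_def using one_loop_integral[OF R A1(3) A2(3)] W D_plus_iff[OF R] by blast
  then have "loop_const * u2_integral R (\<lambda>T. k * G T) =
      (loop_const * (- 2 * of_real (pi ^ 3) * \<i>)) * (k * integral {0..1} q)"
    unfolding u2_integral_cmult by (simp only: mult_ac)
  then show ?thesis unfolding 1 2 loop_const_mult by simp
qed

text \<open>In its first argument, \<open>quad\<close> is a multiple of N(T - P) for an inner point
  P, so T sees a one-loop integrand with W1 moved to P. The coefficients of the resulting form are
  those of \<open>cross_form_compose\<close>.\<close>

lemma slingshot_quad_Z1:
  assumes R: "R > 0" and Z: "Z1 \<in> D_minus R" "Z2 \<in> D_minus R" and W: "W1 \<in> D_plus R" "W2 \<in> D_plus R"
    and s: "s \<in> {0..1}"
  shows "T \<in> U2 R \<Longrightarrow> quad T Z2 W1 W2 s \<noteq> 0"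
    and "loop_const * u2_integral R (\<lambda>T. det (Z2 - W2) * inverse (det (T - Z1)) * inverse (det (T - Z2)) *
      inverse (det (T - W2)) * inverse (quad T Z2 W1 W2 s)) =
    integral {0..1} (\<lambda>t. inverse (quad Z1 Z2 W1 W2 (s * t)))"
proof -
  note W' = W[unfolded D_plus_iff[OF R]]
  obtain A2 where A2: "Z2 ** A2 = mat 1" "A2 ** Z2 = mat 1" "contr (1/R) A2" "det Z2 \<noteq> 0"
    using D_minus_inverse[OF R Z(2)] by blast
  note d = det_diff_inverse[OF A2(1)]
  obtain P e where P: "contr R P" "e \<noteq> 0" and e: "\<And>T. e * det (T - P) =
      cross_form (det (mat 1 - A2 ** W1) * det (T - W2))
        (det (mat 1 - A2 ** W2) * det (T - W1)) (det (W1 - W2) * det (mat 1 - A2 ** T)) s"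
    by (rule cross_form_conformal_point[OF R A2(3) W' s], rule that)
  define c where "c = det Z2 * e"
  have c0: "c \<noteq> 0" using A2 P by (simp add: c_def)
  have c: "c * det (X - P) = quad X Z2 W1 W2 s" for X
  proof -
    have "c * det (X - P) = det Z2 * (e * det (X - P))" by (simp add: c_def)
    also have "\<dots> = quad X Z2 W1 W2 s"
      unfolding e quad_def det_diff_comm[of Z2 W1] det_diff_comm[of Z2 W2] d cross_form_scale
      by (simp add: mult_ac)
    finally show ?thesis .
  qed
  show "quad T Z2 W1 W2 s \<noteq> 0" if "T \<in> U2 R"
    unfolding c[symmetric] using det_diff_U2[OF R P(1) that] c0 by simp
  have PD: "P \<in> D_plus R" using P(1) D_plus_iff[OF R] by simp
  define p where "p = det (Z2 - W2)"
  have p0: "p \<noteq> 0"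
    using contr_1_minus'[OF R A2(3) W'(2)] A2(4) unfolding p_def det_diff_comm[of Z2 W2] d by simp
  have comp: "c * quad Z1 Z2 P W2 t = p * quad Z1 Z2 W1 W2 (s * t)" for t
  proof -
    \<comment> \<open>Both values come from evaluating \<open>quad\<close> at a coincidence of
      points: with its first argument at Z2 it does not depend on s, and with its first argument at
      W2 one has a = 0 and c = b, which leaves s^2 b.\<close>
    have z2: "c * det (Z2 - P) = p * det (Z2 - W1)"
      unfolding c quad_def cross_form_def p_def by (simp add: det_2[of 0] algebra_simps)
    have w2: "c * det (P - W2) = p * of_real s ^ 2 * det (W1 - W2)"
      unfolding det_diff_comm[of P] c quad_def cross_form_def p_def
      using det_diff_comm[of W2 W1] det_diff_comm[of W2 Z2]
      by (simp add: det_2[of 0] power2_eq_square algebra_simps)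
    have "c * quad Z1 Z2 P W2 t = cross_form (det (Z1 - W2) * (c * det (Z2 - P)))
        (det (Z2 - W2) * (c * det (Z1 - P))) (det (Z1 - Z2) * (c * det (P - W2))) t"
      unfolding quad_def cross_form_scale by (simp add: mult_ac)
    also have "\<dots> = cross_form (p * (det (Z1 - W2) * det (Z2 - W1)))
        (p * quad Z1 Z2 W1 W2 s) (p * of_real s ^ 2 * (det (Z1 - Z2) * det (W1 - W2))) t"
      unfolding z2 w2 c[of Z1] p_def[symmetric] by (simp add: mult_ac)
    also have "\<dots> = p * quad Z1 Z2 W1 W2 (s * t)"
      unfolding quad_def cross_form_compose ..
    finally show ?thesis .
  qed
  have comp': "p / c * inverse (quad Z1 Z2 P W2 t) = inverse (quad Z1 Z2 W1 W2 (s * t))" for t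
  proof -
    have "inverse (c * quad Z1 Z2 P W2 t) = inverse (p * quad Z1 Z2 W1 W2 (s * t))"
      unfolding comp ..
    then show ?thesis using p0 c0 by (simp add: field_simps)
  qed
  define G where "G = (\<lambda>T. inverse (det (T - Z1)) * inverse (det (T - Z2)) * inverse (det (T - P)) * inverse (det (T - W2)))"
  have "(\<lambda>T. det (Z2 - W2) * inverse (det (T - Z1)) * inverse (det (T - Z2)) *
      inverse (det (T - W2)) * inverse (quad T Z2 W1 W2 s)) = (\<lambda>T. (p / c) * G T)"
    unfolding c[symmetric] p_def G_def by (simp add: fun_eq_iff divide_inverse mult_ac)
  then have "loop_const * u2_integral R (\<lambda>T. det (Z2 - W2) * inverse (det (T - Z1)) * inverse (det (T - Z2)) *
      inverse (det (T - W2)) * inverse (quad T Z2 W1 W2 s)) = p / c * (loop_const * u2_integral R G)"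
    by (simp only: u2_integral_cmult mult.left_commute)
  also have "loop_const * u2_integral R G = integral {0..1} (\<lambda>t. inverse (quad Z1 Z2 P W2 t))"
    unfolding G_def by (rule one_loop[OF R Z PD W(2)])
  also have "p / c * integral {0..1} (\<lambda>t. inverse (quad Z1 Z2 P W2 t)) = integral {0..1} (\<lambda>t. p / c * inverse (quad Z1 Z2 P W2 t))"
    by (rule integral_mult_right[symmetric])
  finally show "loop_const * u2_integral R (\<lambda>T. det (Z2 - W2) * inverse (det (T - Z1)) * inverse (det (T - Z2)) *
      inverse (det (T - W2)) * inverse (quad T Z2 W1 W2 s)) =
    integral {0..1} (\<lambda>t. inverse (quad Z1 Z2 W1 W2 (s * t)))"
    unfolding comp' .
qed


text \<open>The mirror image in inverted coordinates: the inverses of Z1 and Z2 are inner points for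
  the radius 1/R, and W2 is the inverse of the third point. The resulting B may be singular, the
  moved outer point then being at infinity; hence \<open>one_loop_integral\<close>, formulated with
  inverses, is applied instead of \<open>one_loop\<close>.\<close>

lemma slingshot_quad_W1:
  assumes R: "R > 0" and Z: "Z1 \<in> D_minus R" "Z2 \<in> D_minus R" and W: "W1 \<in> D_plus R" "W2 \<in> D_plus R"
    and s: "s \<in> {0..1}"
  shows "T \<in> U2 R \<Longrightarrow> quad Z1 Z2 T W2 s \<noteq> 0"
    and "loop_const * u2_integral R (\<lambda>T. det (Z2 - W2) * inverse (det (T - W1)) * inverse (det (T - Z2)) *
      inverse (det (T - W2)) * inverse (quad Z1 Z2 T W2 s)) =
    integral {0..1} (\<lambda>t. inverse (quad Z1 Z2 W1 W2 (s * t)))"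
proof -
  note W' = W[unfolded D_plus_iff[OF R]]
  obtain A1 where A1: "Z1 ** A1 = mat 1" "A1 ** Z1 = mat 1" "contr (1/R) A1" "det Z1 \<noteq> 0"
    using D_minus_inverse[OF R Z(1)] by blast
  obtain A2 where A2: "Z2 ** A2 = mat 1" "A2 ** Z2 = mat 1" "contr (1/R) A2" "det Z2 \<noteq> 0"
    using D_minus_inverse[OF R Z(2)] by blast
  note d = det_diff_inverse[OF A1(1)] det_diff_inverse[OF A2(1)]
  have R': "1/R > 0" using R by simp
  have W2': "contr (1/(1/R)) W2" using W'(2) by simp
  obtain B e where B: "contr (1/R) B" "e \<noteq> 0" and eT: "\<And>T. e * det (T - B) =
      cross_form (det (mat 1 - W2 ** A1) * det (T - A2))
        (det (mat 1 - W2 ** A2) * det (T - A1)) (det (A1 - A2) * det (mat 1 - W2 ** T)) s"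
    and eX: "\<And>X. e * det (mat 1 - X ** B) = cross_form (det (mat 1 - W2 ** A1) * det (mat 1 - X ** A2))
        (det (mat 1 - X ** A1) * det (mat 1 - W2 ** A2)) (det (X - W2) * det (A1 - A2)) s"
    by (rule cross_form_conformal_point[OF R' W2' A1(3) A2(3) s], rule that)
  define c where "c = det Z1 * det Z2 * e"
  have c0: "c \<noteq> 0" using A1 A2 B by (simp add: c_def)
  have c: "c * det (mat 1 - B ** X) = quad Z1 Z2 X W2 s" for X
  proof -
    have "c * det (mat 1 - B ** X) = det Z1 * det Z2 * (e * det (mat 1 - X ** B))"
      by (simp add: c_def det_1_minus_comm[of B])
    also have "\<dots> = quad Z1 Z2 X W2 s"
      unfolding eX quad_def cross_form_scale det_diff_inverses[OF A1(1) A2(2)]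
      unfolding det_diff_comm[of Z1 X] det_diff_comm[of Z2 X] det_diff_comm[of Z1 W2] det_diff_comm[of Z2 W2] d
        det_1_minus_comm[of W2] det_1_minus_comm[of X]
      by (simp add: mult_ac)
    finally show ?thesis .
  qed
  show "quad Z1 Z2 T W2 s \<noteq> 0" if "T \<in> U2 R"
    unfolding c[symmetric] using det_1_minus_U2[OF R B(1) that] c0 by simp
  define p where "p = det (Z2 - W2)"
  define q where "q = (\<lambda>t. cross_form (det (mat 1 - A2 ** W1) * det (mat 1 - B ** W2))
        (det (mat 1 - B ** W1) * det (mat 1 - A2 ** W2)) (det (B - A2) * det (W1 - W2)) t)"
  have p: "p = det Z2 * det (mat 1 - A2 ** W2)"
    unfolding p_def det_diff_comm[of Z2 W2] d ..
  have p0: "p \<noteq> 0"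
    using contr_1_minus'[OF R A2(3) W'(2)] A2(4) unfolding p by simp
  have comp: "det Z2 * c * q t = p * quad Z1 Z2 W1 W2 (s * t)" for t
  proof -
    have w2: "c * det (mat 1 - B ** W2) = p * det (Z1 - W2)"
      unfolding c quad_def cross_form_def p_def by (simp add: det_2[of 0] algebra_simps)
    have z2: "det Z2 * (c * det (B - A2)) = p * of_real s ^ 2 * det (Z1 - Z2)"
    proof -
      have "det Z2 * (c * det (B - A2)) = det Z1 * det Z2 * det Z2 * (e * det (A2 - B))"
        by (simp add: c_def det_diff_comm[of B])
      also have "e * det (A2 - B) = of_real s ^ 2 * (det (mat 1 - A2 ** W2) * det (A1 - A2))"
        unfolding eT cross_form_def
        by (simp add: det_2[of 0] det_diff_comm[of A2 A1] det_1_minus_comm[of W2] power2_eq_square algebra_simps)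
      finally show ?thesis unfolding p det_diff_inverses[OF A1(1) A2(2)] by (simp add: mult_ac)
    qed
    have "det Z2 * c * q t = cross_form (det Z2 * det (mat 1 - A2 ** W1) * (c * det (mat 1 - B ** W2)))
        (det Z2 * det (mat 1 - A2 ** W2) * (c * det (mat 1 - B ** W1)))
        (det Z2 * (c * det (B - A2)) * det (W1 - W2)) t"
      unfolding q_def cross_form_scale by (simp add: mult_ac)
    also have "\<dots> = cross_form (p * (det (Z1 - W2) * det (Z2 - W1)))
        (p * quad Z1 Z2 W1 W2 s) (p * of_real s ^ 2 * (det (Z1 - Z2) * det (W1 - W2))) t"
      unfolding z2 w2 c[of W1] p[symmetric] det_diff_comm[of Z2 W1] d by (simp add: mult_ac)
    also have "\<dots> = p * quad Z1 Z2 W1 W2 (s * t)"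
      unfolding quad_def cross_form_compose ..
    finally show ?thesis .
  qed
  define r where "r = p / (det Z2 * c)"
  have comp': "r * inverse (q t) = inverse (quad Z1 Z2 W1 W2 (s * t))" for t
  proof -
    have "inverse (det Z2 * c * q t) = inverse (p * quad Z1 Z2 W1 W2 (s * t))"
      unfolding comp ..
    then show ?thesis using p0 c0 A2(4) by (simp add: r_def field_simps)
  qed
  define G where "G = (\<lambda>T. inverse (det (mat 1 - B ** T)) * inverse (det (mat 1 - A2 ** T)) *
      inverse (det (T - W1)) * inverse (det (T - W2)))"
  have "(\<lambda>T. det (Z2 - W2) * inverse (det (T - W1)) * inverse (det (T - Z2)) *
      inverse (det (T - W2)) * inverse (quad Z1 Z2 T W2 s)) = (\<lambda>T. r * G T)"
    unfolding c[symmetric] p_def[symmetric] G_def r_def d by (simp add: fun_eq_iff divide_inverse mult_ac)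
  then have "loop_const * u2_integral R (\<lambda>T. det (Z2 - W2) * inverse (det (T - W1)) * inverse (det (T - Z2)) *
      inverse (det (T - W2)) * inverse (quad Z1 Z2 T W2 s)) = r * (loop_const * u2_integral R G)"
    by (simp only: u2_integral_cmult mult.left_commute)
  also have "u2_integral R G = - 2 * of_real (pi ^ 3) * \<i> * integral {0..1} (\<lambda>t. inverse (q t))"
    unfolding G_def q_def by (rule one_loop_integral[OF R B(1) A2(3) W'])
  also have "loop_const * \<dots> = integral {0..1} (\<lambda>t. inverse (q t))"
  proof -
    have "loop_const * (k * x) = x" if "loop_const * k = 1" for k x
      using that by (simp add: mult.assoc[symmetric])
    then show ?thesis using loop_const_mult by blast
  qed
  also have "r * integral {0..1} (\<lambda>t. inverse (q t)) = integral {0..1} (\<lambda>t. r * inverse (q t))"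
    by (rule integral_mult_right[symmetric])
  finally show "loop_const * u2_integral R (\<lambda>T. det (Z2 - W2) * inverse (det (T - W1)) * inverse (det (T - Z2)) *
      inverse (det (T - W2)) * inverse (quad Z1 Z2 T W2 s)) =
    integral {0..1} (\<lambda>t. inverse (quad Z1 Z2 W1 W2 (s * t)))"
    unfolding comp' .
qed


section \<open>The explicit formula for box integrals\<close>

text \<open>The integral of h(s_1 ... s_n) over the unit cube. The recursion replaces the value of h
  at x by its average over x s, which is exactly what one slingshot does to the integrand.\<close>

primrec iter_int :: "nat \<Rightarrow> (real \<Rightarrow> complex) \<Rightarrow> complex" where
  "iter_int 0 h = h 1"
| "iter_int (Suc n) h = iter_int n (\<lambda>x. integral {0..1} (\<lambda>s. h (x * s)))"

lemma iter_int_cong: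
  assumes "\<And>x. x \<in> {0..1} \<Longrightarrow> h x = h' x"
  shows "iter_int n h = iter_int n h'"
  using assms
proof (induction n arbitrary: h h')
  case (Suc n)
  have "integral {0..1} (\<lambda>s. h (x * s)) = integral {0..1} (\<lambda>s. h' (x * s))" if "x \<in> {0..1}" for x
    using that by (intro Henstock_Kurzweil_Integration.integral_cong Suc.prems) (auto simp: mult_le_one)
  then show ?case unfolding iter_int.simps by (rule Suc.IH)
qed simp

lemma iter_int_cmult: "iter_int n (\<lambda>s. c * h s) = c * iter_int n h"
proof (induction n arbitrary: h)
  case (Suc n)
  have "integral {0..1} (\<lambda>s. c * h (x * s)) = c * integral {0..1} (\<lambda>s. h (x * s))" for x
    by (rule integral_mult_right)
  then show ?case unfolding iter_int.simps by (simp only: Suc.IH)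
qed simp

lemma u2_integral_swap:
  assumes cont: "continuous_on ({0..1::real} \<times> U2 R) (\<lambda>(s, T). G s T)"
  shows "u2_integral R (\<lambda>T. integral {0..1} (\<lambda>s. G s T)) = integral {0..1} (\<lambda>s. u2_integral R (G s))"
    and "continuous_on (U2 R) (\<lambda>T. integral {0..1} (\<lambda>s. G s T))"
proof -
  have "continuous_on (U2 R \<times> cbox 0 1) (\<lambda>x. G (snd x) (fst x))"
  proof -
    have "continuous_on (U2 R \<times> cbox 0 (1::real)) (\<lambda>x. (snd x, fst x))"
      by (intro continuous_intros)
    from continuous_on_compose2[OF cont this] show ?thesis by (auto simp: image_subset_iff)
  qed
  then show c: "continuous_on (U2 R) (\<lambda>T. integral {0..1} (\<lambda>s. G s T))"
    using integral_continuous_on_param[of "U2 R" 0 1 "\<lambda>T s. G s T"] by (simp add: case_prod_beta')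
  have cG: "continuous_on (U2 R) (G s)" if "s \<in> {0..1}" for s
  proof -
    have "continuous_on (U2 R) (\<lambda>T. (s, T))" by (intro continuous_intros)
    from continuous_on_compose2[OF cont this] that show ?thesis by (simp add: image_subset_iff)
  qed
  have pb: "continuous_on u2_box (\<lambda>t. u2_pullback R t)"
    using u2_integral_eq(3)[of R "\<lambda>_. 1"] by simp
  have cb: "continuous_on (cbox (0, 0, 0, 0, 0) (1 :: real, pi, pi/2, 2*pi, 2*pi))
      (\<lambda>(s, t). G s (u2_param R t) * u2_pullback R t)"
  proof -
    have eq: "cbox (0, 0, 0, 0, 0) (1 :: real, pi, pi/2, 2*pi, 2*pi) = {0..1} \<times> u2_box"
      by (simp add: u2_box_cbox cbox_Pair_eq)
    have "continuous_on ({0..1} \<times> u2_box) (\<lambda>x. (fst x :: real, u2_param R (snd x)))"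
      by (intro continuous_intros continuous_on_compose2[OF continuous_u2_param[of UNIV]]) auto
    from continuous_on_compose2[OF cont this]
    have "continuous_on ({0..1} \<times> u2_box) (\<lambda>x. G (fst x) (u2_param R (snd x)))"
      using u2_param_in_U2 by (simp add: image_subset_iff)
    moreover have "continuous_on ({0..1::real} \<times> u2_box) (\<lambda>x. u2_pullback R (snd x))"
      by (rule continuous_on_compose2[OF pb]) (auto intro!: continuous_intros)
    ultimately show ?thesis
      unfolding case_prod_beta' eq by (intro continuous_intros)
  qed
  have "u2_integral R (\<lambda>T. integral {0..1} (\<lambda>s. G s T)) =
      integral u2_box (\<lambda>t. integral {0..1} (\<lambda>s. G s (u2_param R t) * u2_pullback R t))"
    unfolding u2_integral_eq(1)[OF c] by simp
  also have "\<dots> = integral {0..1} (\<lambda>s. integral u2_box (\<lambda>t. G s (u2_param R t) * u2_pullback R t))"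
    using integral_swap_continuous[OF cb] by (simp add: u2_box_cbox)
  also have "\<dots> = integral {0..1} (\<lambda>s. u2_integral R (G s))"
    by (intro Henstock_Kurzweil_Integration.integral_cong) (simp add: u2_integral_eq(1) cG)
  finally show "u2_integral R (\<lambda>T. integral {0..1} (\<lambda>s. G s T)) = integral {0..1} (\<lambda>s. u2_integral R (G s))" .
qed

lemma iter_int_swap:
  assumes "continuous_on ({0..1} \<times> U2 R) (\<lambda>(s, T). F s T)"
  shows "u2_integral R (\<lambda>T. iter_int n (\<lambda>s. F s T)) = iter_int n (\<lambda>s. u2_integral R (F s))"
  using assms
proof (induction n arbitrary: F)
  case (Suc n)
  define F' where "F' = (\<lambda>x T. integral {0..1} (\<lambda>s. F (x * s) T))"
  have "continuous_on (({0..1} \<times> U2 R) \<times> cbox 0 1) (\<lambda>y. F (fst (fst y) * snd y) (snd (fst y)))"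
  proof -
    have "continuous_on (({0..1} \<times> U2 R) \<times> cbox 0 (1::real)) (\<lambda>y. (fst (fst y) * snd y, snd (fst y)))"
      by (intro continuous_intros)
    from continuous_on_compose2[OF Suc.prems this] show ?thesis
      by (auto simp: image_subset_iff mult_le_one)
  qed
  then have "continuous_on ({0..1} \<times> U2 R) (\<lambda>(x, T). F' x T)"
    using integral_continuous_on_param[of "{0..1} \<times> U2 R" 0 1 "\<lambda>x s. F (fst x * s) (snd x)"]
    by (simp add: F'_def case_prod_beta')
  note * = Suc.IH[OF this]
  have "u2_integral R (F' x) = integral {0..1} (\<lambda>s. u2_integral R (F (x * s)))" if x: "x \<in> {0..1}" for x
  proof -
    have "continuous_on ({0..1::real} \<times> U2 R) (\<lambda>y. (x * fst y, snd y))"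
      by (intro continuous_intros)
    from continuous_on_compose2[OF Suc.prems this] x
    have "continuous_on ({0..1} \<times> U2 R) (\<lambda>(s, T). F (x * s) T)"
      by (auto simp: image_subset_iff mult_le_one case_prod_beta')
    from u2_integral_swap(1)[OF this] show ?thesis by (simp add: F'_def)
  qed
  from iter_int_cong[OF this] * show ?case
    by (simp add: F'_def)
qed simp

definition ladder :: "nat \<Rightarrow> cmat \<Rightarrow> cmat \<Rightarrow> cmat \<Rightarrow> cmat \<Rightarrow> complex" where
  "ladder n Z1 Z2 W1 W2 = iter_int n (\<lambda>s. inverse (quad Z1 Z2 W1 W2 s))"

lemma ladder_sym: "ladder n Z1 Z2 W1 W2 = ladder n Z2 Z1 W2 W1"
  unfolding ladder_def quad_sym[of Z1] ..

lemma D_diff_U2: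
  assumes "R > 0" "T \<in> U2 R"
  shows "Z \<in> D_minus R \<Longrightarrow> det (T - Z) \<noteq> 0" and "W \<in> D_plus R \<Longrightarrow> det (T - W) \<noteq> 0"
proof -
  assume "Z \<in> D_minus R"
  from D_minus_inverse[OF assms(1) this] show "det (T - Z) \<noteq> 0"
    using det_1_minus_U2[OF assms(1) _ assms(2)] det_diff_inverse by (metis mult_eq_0_iff)
next
  assume "W \<in> D_plus R"
  then show "det (T - W) \<noteq> 0"
    using det_diff_U2[OF assms(1) _ assms(2)] D_plus_iff[OF assms(1)] by blast
qed

lemma continuous_on_quad:
  assumes "continuous_on S a" "continuous_on S b" "continuous_on S c" "continuous_on S d" "continuous_on S s"
  shows "continuous_on S (\<lambda>x. quad (a x) (b x) (c x) (d x) (s x))"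
  unfolding quad_def by (intro continuous_on_cross_form continuous_intros continuous_on_det assms)

text \<open>Common to both kinds of slingshot: the contour integral is moved inside the parameter
  integrals and evaluated there for each s.\<close>

lemma slingshot_step:
  fixes g :: "cmat \<Rightarrow> complex" and q :: "real \<Rightarrow> cmat \<Rightarrow> complex"
  assumes g: "continuous_on (U2 R) g" and q: "continuous_on ({0..1} \<times> U2 R) (\<lambda>x. q (fst x) (snd x))"
    and nz: "\<And>s T. s \<in> {0..1} \<Longrightarrow> T \<in> U2 R \<Longrightarrow> q s T \<noteq> 0"
    and eq: "\<And>s. s \<in> {0..1} \<Longrightarrow> loop_const * u2_integral R (\<lambda>T. g T * inverse (q s T)) =
      integral {0..1} (\<lambda>t. h (s * t))"
  shows "loop_const * u2_integral R (\<lambda>T. g T * iter_int n (\<lambda>s. inverse (q s T))) = iter_int (Suc n) h"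
proof -
  have "continuous_on ({0..1::real} \<times> U2 R) (\<lambda>x. g (snd x))"
    by (rule continuous_on_compose2[OF g]) (auto intro!: continuous_intros)
  then have "continuous_on ({0..1} \<times> U2 R) (\<lambda>(s, T). g T * inverse (q s T))"
    unfolding case_prod_beta' using nz by (intro continuous_intros q) auto
  from iter_int_swap[OF this, of n]
  have "loop_const * u2_integral R (\<lambda>T. g T * iter_int n (\<lambda>s. inverse (q s T))) =
      iter_int n (\<lambda>s. loop_const * u2_integral R (\<lambda>T. g T * inverse (q s T)))"
    by (simp add: iter_int_cmult)
  also have "\<dots> = iter_int n (\<lambda>s. integral {0..1} (\<lambda>t. h (s * t)))"
    by (rule iter_int_cong) (rule eq)
  finally show ?thesis by simp
qed

lemma ladder_slingshot:
  assumes R: "R > 0" and Z: "Z1 \<in> D_minus R" "Z2 \<in> D_minus R" and W: "W1 \<in> D_plus R" "W2 \<in> D_plus R"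
  shows ladder_slingshot_Z1: "loop_const * u2_integral R (\<lambda>T. det (Z2 - W2) * inverse (det (T - Z1)) *
      inverse (det (T - Z2)) * inverse (det (T - W2)) * ladder n T Z2 W1 W2) = ladder (Suc n) Z1 Z2 W1 W2"
    and ladder_slingshot_W1: "loop_const * u2_integral R (\<lambda>T. det (Z2 - W2) * inverse (det (T - W1)) *
      inverse (det (T - Z2)) * inverse (det (T - W2)) * ladder n Z1 Z2 T W2) = ladder (Suc n) Z1 Z2 W1 W2"
proof -
  note nz = D_diff_U2[OF R]
  show "loop_const * u2_integral R (\<lambda>T. det (Z2 - W2) * inverse (det (T - Z1)) *
      inverse (det (T - Z2)) * inverse (det (T - W2)) * ladder n T Z2 W1 W2) = ladder (Suc n) Z1 Z2 W1 W2"
    unfolding ladder_def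
  proof (rule slingshot_step[where q = "\<lambda>s T. quad T Z2 W1 W2 s"])
    show "continuous_on (U2 R) (\<lambda>T. det (Z2 - W2) * inverse (det (T - Z1)) *
        inverse (det (T - Z2)) * inverse (det (T - W2)))"
      by (intro continuous_intros continuous_on_det) (use nz Z W in blast)+
  qed (intro continuous_intros continuous_on_quad | rule slingshot_quad_Z1[OF R Z W] | assumption)+
  show "loop_const * u2_integral R (\<lambda>T. det (Z2 - W2) * inverse (det (T - W1)) *
      inverse (det (T - Z2)) * inverse (det (T - W2)) * ladder n Z1 Z2 T W2) = ladder (Suc n) Z1 Z2 W1 W2"
    unfolding ladder_def
  proof (rule slingshot_step[where q = "\<lambda>s T. quad Z1 Z2 T W2 s"])
    show "continuous_on (U2 R) (\<lambda>T. det (Z2 - W2) * inverse (det (T - W1)) *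
        inverse (det (T - Z2)) * inverse (det (T - W2)))"
      by (intro continuous_intros continuous_on_det) (use nz Z W in blast)+
  qed (intro continuous_intros continuous_on_quad | rule slingshot_quad_W1[OF R Z W] | assumption)+
qed

section \<open>Box diagrams\<close>

definition vertices :: "nat \<Rightarrow> vertex set" where
  "vertices n = range Outer \<union> Inner ` {1..n}"

lemma relabel_simps [simp]:
  "relabel n X (Inner k) = Inner k" "relabel n X (Outer X) = Inner n"
  "Y \<noteq> X \<Longrightarrow> relabel n X (Outer Y) = Outer Y"
  by (simp_all add: relabel_def)

lemma relabel_vertices: "u \<in> vertices n \<Longrightarrow> relabel (Suc n) X u \<in> vertices (Suc n)"
  by (auto simp: vertices_def relabel_def)

text \<open>Guarantees that the internal vertex created next is a fresh name, so that relabelling a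
  corner cannot collide with an edge already present.\<close>

lemma box_diagram_edges:
  assumes "box_diagram n D"
    and "(u, v) \<in># solid D \<or> (u, v) \<in># dashed D"
  shows "u \<in> vertices n \<and> v \<in> vertices n"
  using assms
proof (induction arbitrary: u v)
  case one
  then show ?case by (auto simp: one_loop_def vertices_def)
next
  case (step n D X)
  have "relabel (Suc n) X u \<in> vertices (Suc n) \<and> relabel (Suc n) X v \<in> vertices (Suc n)"
    if "(u, v) \<in># solid D \<or> (u, v) \<in># dashed D" for u v
    using step.IH[OF that] relabel_vertices by blast
  moreover have "Outer Y \<in> vertices (Suc n)" "Inner (Suc n) \<in> vertices (Suc n)" for Y
    by (auto simp: vertices_def)
  ultimately show ?case
    using step.prems by (auto simp: slingshot_def split: prod.splits)
qed

lemma slingshot_prec: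
  "prec (slingshot m X D) = (map_prod (relabel m X) (relabel m X) ` prec D \<union> new_prec m X)\<^sup>+"
  by (simp add: slingshot_def split: prod.splits)

lemma slingshot_prec_old:
  "(u, v) \<in> prec D \<Longrightarrow> (relabel m X u, relabel m X v) \<in> prec (slingshot m X D)"
  unfolding slingshot_prec by (rule r_into_trancl) force

lemma slingshot_prec_new: "e \<in> new_prec m X \<Longrightarrow> e \<in> prec (slingshot m X D)"
  unfolding slingshot_prec by (cases e) (auto intro: r_into_trancl)

lemma slingshot_prec_trans:
  "(u, v) \<in> prec (slingshot m X D) \<Longrightarrow> (v, w) \<in> prec (slingshot m X D) \<Longrightarrow> (u, w) \<in> prec (slingshot m X D)"
  unfolding slingshot_prec by (rule trancl_trans)

text \<open>A slingshot adds three of the four relations between the new vertex and the corners. The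
  fourth is inherited from X, whose place the new vertex takes; this is why the relation between W
  and Z is carried along in the induction.\<close>

lemma last_vertex_between:
  assumes "box_diagram n D" "Z \<in> {CZ1, CZ2}" "W \<in> {CW1, CW2}"
  shows "n \<ge> 1 \<and> (Outer W, Inner n) \<in> prec D \<and> (Inner n, Outer Z) \<in> prec D \<and> (Outer W, Outer Z) \<in> prec D"
  using assms
proof (induction arbitrary: Z W)
  case one
  then show ?case unfolding one_loop_def
    by (auto intro: r_into_trancl trancl_into_trancl)
next
  case (step n D X)
  have old: "(Outer W, Outer Z) \<in> prec D" if "Z \<in> {CZ1, CZ2}" "W \<in> {CW1, CW2}" for Z W
    using step.IH[OF that] by blast
  have "(Outer W, Inner (Suc n)) \<in> prec (slingshot (Suc n) X D)
      \<and> (Inner (Suc n), Outer Z) \<in> prec (slingshot (Suc n) X D)"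
    using slingshot_prec_old[OF old[of CZ1 CW1], of "Suc n" X] slingshot_prec_old[OF old[of CZ1 CW2], of "Suc n" X]
      slingshot_prec_old[OF old[of CZ2 CW1], of "Suc n" X] slingshot_prec_old[OF old[of CZ2 CW2], of "Suc n" X]
      slingshot_prec_new[of _ "Suc n" X D] step.prems
    by (cases X) auto
  then show ?case
    using slingshot_prec_trans[of "Outer W" "Inner (Suc n)" "Suc n" X D "Outer Z"] by simp
qed

lemma trancl_subsetI: "r \<subseteq> S \<Longrightarrow> trans S \<Longrightarrow> r\<^sup>+ \<subseteq> S"
  using trancl_mono trancl_id by blast

text \<open>A height function witnesses that the order has no cycles, which is what makes admissible
  radii exist. Its bounds allow these radii to be squeezed into a prescribed interval.\<close>

lemma box_diagram_rank:
  assumes "box_diagram n D"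
  obtains h :: "vertex \<Rightarrow> real" and m M where "m < M" "\<And>v. m \<le> h v \<and> h v \<le> M"
    "\<And>X. X \<in> {CZ1, CZ2} \<Longrightarrow> h (Outer X) = M" "\<And>X. X \<in> {CW1, CW2} \<Longrightarrow> h (Outer X) = m"
    "prec D \<subseteq> {(u, v). u \<in> vertices n \<and> v \<in> vertices n \<and> h u < h v}"
  using assms
proof (induction arbitrary: thesis)
  case one
  define h :: "vertex \<Rightarrow> real" where "h = (\<lambda>v. if v \<in> {Outer CZ1, Outer CZ2} then 2 else
    if v \<in> {Outer CW1, Outer CW2} then 0 else 1)"
  have "prec one_loop \<subseteq> {(u, v). u \<in> vertices 1 \<and> v \<in> vertices 1 \<and> h u < h v}"
    unfolding one_loop_def diagram.simps
    by (rule trancl_subsetI) (auto simp: h_def vertices_def trans_def)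
  then show ?case by (intro one[of 0 2 h]) (auto simp: h_def)
next
  case (step n D X)
  obtain h :: "vertex \<Rightarrow> real" and m M where mM: "m < M" and b: "\<And>v. m \<le> h v \<and> h v \<le> M"
    and Z: "\<And>X. X \<in> {CZ1, CZ2} \<Longrightarrow> h (Outer X) = M" and W: "\<And>X. X \<in> {CW1, CW2} \<Longrightarrow> h (Outer X) = m"
    and p: "prec D \<subseteq> {(u, v). u \<in> vertices n \<and> v \<in> vertices n \<and> h u < h v}"
    using step.IH by blast
  \<comment> \<open>The new vertex takes over the extreme height of X. Both corners on that side,
    also the one that is not relabelled, are pushed out by one, so that they stay extremal and of
    equal height.\<close>
  define h' where "h' = (if X \<in> {CZ1, CZ2}
    then h(Inner (Suc n) := M, Outer CZ1 := M + 1, Outer CZ2 := M + 1)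
    else h(Inner (Suc n) := m, Outer CW1 := m - 1, Outer CW2 := m - 1))"
  let ?m = "if X \<in> {CZ1, CZ2} then m else m - 1" and ?M = "if X \<in> {CZ1, CZ2} then M + 1 else M"
  have new: "Inner (Suc n) \<notin> vertices n" by (auto simp: vertices_def)
  have "h' (relabel (Suc n) X u) < h' (relabel (Suc n) X v)" if "(u, v) \<in> prec D" for u v
  proof -
    have uv: "u \<in> vertices n" "v \<in> vertices n" "h u < h v" using p that by auto
    have ne: "u \<noteq> Inner (Suc n)" "v \<noteq> Inner (Suc n)" using uv new by auto
    show ?thesis
    proof (cases "X \<in> {CZ1, CZ2}")
      case True
      have "h u < M" using uv(3) b[of v] by linarith
      then have u: "u \<noteq> Outer CZ1" "u \<noteq> Outer CZ2" using Z by force+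
      then have "relabel (Suc n) X u = u" using True by (auto simp: relabel_def)
      then have "h' (relabel (Suc n) X u) = h u" using True u ne by (simp add: h'_def)
      moreover have "h v \<le> h' (relabel (Suc n) X v)"
        using True ne b[of v] by (auto simp: h'_def relabel_def)
      ultimately show ?thesis using uv(3) by linarith
    next
      case False
      then have X: "X = CW1 \<or> X = CW2" by (cases X) auto
      have "m < h v" using uv(3) b[of u] by linarith
      then have v: "v \<noteq> Outer CW1" "v \<noteq> Outer CW2" using W by force+
      then have "relabel (Suc n) X v = v" using X by (auto simp: relabel_def)
      then have "h' (relabel (Suc n) X v) = h v" using False v ne by (simp add: h'_def)
      moreover have "h' (relabel (Suc n) X u) \<le> h u"
        using X ne b[of u] by (auto simp: h'_def relabel_def)
      ultimately show ?thesis using uv(3) by linarith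
    qed
  qed
  moreover have "h' u < h' v" if "(u, v) \<in> new_prec (Suc n) X" for u v
    using that mM Z W by (cases X) (auto simp: h'_def)
  moreover have "u \<in> vertices (Suc n) \<and> v \<in> vertices (Suc n)" if "(u, v) \<in> new_prec (Suc n) X" for u v
    using that by (cases X) (auto simp: vertices_def)
  ultimately have "prec (slingshot (Suc n) X D) \<subseteq> {(u, v). u \<in> vertices (Suc n) \<and> v \<in> vertices (Suc n) \<and> h' u < h' v}"
    unfolding slingshot_prec
    using p relabel_vertices by (intro trancl_subsetI) (auto simp: trans_def)
  moreover have "?m \<le> h' v \<and> h' v \<le> ?M" for v
    using b[of v] mM by (auto simp: h'_def)
  moreover have "Y \<in> {CZ1, CZ2} \<Longrightarrow> h' (Outer Y) = ?M" "Y \<in> {CW1, CW2} \<Longrightarrow> h' (Outer Y) = ?m" for Y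
    using Z W by (auto simp: h'_def)
  ultimately show ?case using mM by (intro step.prems[of ?m ?M h']) auto
qed

section \<open>Box integrals\<close>

lemma u2_multi_integral_cmult:
  "u2_multi_integral n r (\<lambda>\<tau>. c * f \<tau>) = c * u2_multi_integral n r f"
  by (induction n arbitrary: f) (simp_all add: u2_integral_cmult)

lemma box_integrand_slingshot:
  assumes edges: "\<And>u v. (u, v) \<in># solid D \<or> (u, v) \<in># dashed D \<Longrightarrow>
      p' (relabel m X u) = p u \<and> p' (relabel m X v) = p v"
    and Y: "neighbours X = (Y, Y')"
  shows "box_integrand (slingshot m X D) p' = det (p' (Outer Y) - p' (Outer Y')) *
      inverse (det (p' (Inner m) - p' (Outer X))) * inverse (det (p' (Inner m) - p' (Outer Y))) *
      inverse (det (p' (Inner m) - p' (Outer Y'))) * box_integrand D p"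
proof -
  define f where "f = (\<lambda>q (u :: vertex, v :: vertex). inverse (det (q u - q v :: cmat)))"
  define g where "g = (\<lambda>q (u :: vertex, v :: vertex). det (q u - q v :: cmat))"
  have bi: "box_integrand E q = prod_mset (image_mset (f q) (solid E)) * prod_mset (image_mset (g q) (dashed E))" for E q
    by (simp add: box_integrand_def f_def g_def)
  have 1: "image_mset (f p') (image_mset (map_prod (relabel m X) (relabel m X)) (solid D)) = image_mset (f p) (solid D)"
    unfolding multiset.map_comp
  proof (rule image_mset_cong)
    fix e assume "e \<in># solid D"
    then show "(f p' \<circ> map_prod (relabel m X) (relabel m X)) e = f p e"
      using edges[of "fst e" "snd e"] by (cases e) (simp add: f_def)
  qed
  have 2: "image_mset (g p') (image_mset (map_prod (relabel m X) (relabel m X)) (dashed D)) = image_mset (g p) (dashed D)"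
    unfolding multiset.map_comp
  proof (rule image_mset_cong)
    fix e assume "e \<in># dashed D"
    then show "(g p' \<circ> map_prod (relabel m X) (relabel m X)) e = g p e"
      using edges[of "fst e" "snd e"] by (cases e) (simp add: g_def)
  qed
  show ?thesis
    unfolding bi by (simp add: slingshot_def Y 1 2) (simp add: f_def g_def mult_ac)
qed

text \<open>The vertex created last is the outermost integration variable. With it fixed at T, what
  remains is the old diagram with corner X placed at T, times the factors of the slingshot.
  \<open>P\<close> is read only at corners, so its constant internal positions do not
  matter.\<close>

lemma box_integral_slingshot:
  fixes Z1 Z2 W1 W2 :: cmat
  assumes D: "box_diagram n D" and Y: "neighbours X = (Y, Y')"
  defines "P \<equiv> place Z1 Z2 W1 W2 (\<lambda>_. 0)"
  assumes P': "\<And>T \<tau>. place (Z1' T) (Z2' T) (W1' T) (W2' T) \<tau> = (place Z1 Z2 W1 W2 \<tau>)(Outer X := T)"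
  shows "box_integral (Suc n) (slingshot (Suc n) X D) r Z1 Z2 W1 W2 =
    loop_const * u2_integral (r (Suc n)) (\<lambda>T. det (P (Outer Y) - P (Outer Y')) *
      inverse (det (T - P (Outer X))) * inverse (det (T - P (Outer Y))) * inverse (det (T - P (Outer Y'))) *
      box_integral n D r (Z1' T) (Z2' T) (W1' T) (W2' T))"
proof -
  define g where "g = (\<lambda>T. det (P (Outer Y) - P (Outer Y')) *
      inverse (det (T - P (Outer X))) * inverse (det (T - P (Outer Y))) * inverse (det (T - P (Outer Y'))))"
  have P: "place Z1 Z2 W1 W2 \<tau> (Outer C) = P (Outer C)" for \<tau> C
    unfolding P_def by (cases C) auto
  have "box_integrand (slingshot (Suc n) X D) (place Z1 Z2 W1 W2 (\<tau>(Suc n := T))) =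
      g T * box_integrand D (place (Z1' T) (Z2' T) (W1' T) (W2' T) \<tau>)" for \<tau> T
  proof -
    have e: "place Z1 Z2 W1 W2 (\<tau>(Suc n := T)) (relabel (Suc n) X u) =
        place (Z1' T) (Z2' T) (W1' T) (W2' T) \<tau> u" if "u \<in> vertices n" for u
    proof (cases u)
      case (Outer C)
      then show ?thesis unfolding P' by (cases "C = X") (auto simp: P)
    next
      case (Inner k)
      then have "k \<noteq> Suc n" using that by (auto simp: vertices_def)
      then show ?thesis using Inner unfolding P' by simp
    qed
    show ?thesis
      using e box_diagram_edges[OF D]
      by (subst box_integrand_slingshot[OF _ Y, where p = "place (Z1' T) (Z2' T) (W1' T) (W2' T) \<tau>"])
         (auto simp: g_def P)
  qed
  moreover have "det (P (Outer Y) - P (Outer Y')) * inverse (det (T - P (Outer X))) *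
      inverse (det (T - P (Outer Y))) * inverse (det (T - P (Outer Y'))) = g T" for T
    by (simp add: g_def)
  ultimately show ?thesis
    unfolding box_integral_def u2_multi_integral.simps power_Suc loop_const_def[symmetric]
    by (simp add: u2_multi_integral_cmult u2_integral_cmult[symmetric] mult_ac)
qed


lemma U2_D_minus:
  assumes "0 < r" "r < R" "T \<in> U2 R"
  shows "T \<in> D_minus r"
  unfolding D_minus_iff[OF assms(1)] using norm_vmult_U2[of R T] assms by simp

lemma U2_D_plus:
  assumes "0 < R" "R < r" "T \<in> U2 R"
  shows "T \<in> D_plus r"
  using norm_vmult_U2[of R T] assms D_plus_iff[of r T] by (simp add: contr_def)

text \<open>Stated vertex by vertex rather than through extremal radii, so that the induction only
  has to follow single order relations through a relabelling.\<close>

definition in_domain :: "nat \<Rightarrow> diagram \<Rightarrow> (nat \<Rightarrow> real) \<Rightarrow> (corner \<Rightarrow> cmat) \<Rightarrow> bool" where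
  "in_domain n D r p \<longleftrightarrow> (\<forall>k\<in>{1..n}.
     (\<forall>Z\<in>{CZ1, CZ2}. (Inner k, Outer Z) \<in> prec D \<longrightarrow> p Z \<in> D_minus (r k)) \<and>
     (\<forall>W\<in>{CW1, CW2}. (Outer W, Inner k) \<in> prec D \<longrightarrow> p W \<in> D_plus (r k)))"

lemma in_domain_last:
  assumes "box_diagram n D" "in_domain n D r p"
  shows "n \<ge> 1" "p CZ1 \<in> D_minus (r n)" "p CZ2 \<in> D_minus (r n)" "p CW1 \<in> D_plus (r n)" "p CW2 \<in> D_plus (r n)"
proof -
  note l = last_vertex_between[OF assms(1)]
  show n: "n \<ge> 1" using l[of CZ1 CW1] by simp
  then have "n \<in> {1..n}" by simp
  note d = assms(2)[unfolded in_domain_def, THEN bspec, OF this]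
  show "p CZ1 \<in> D_minus (r n)" "p CZ2 \<in> D_minus (r n)" "p CW1 \<in> D_plus (r n)" "p CW2 \<in> D_plus (r n)"
    using d l[of CZ1 CW1] l[of CZ2 CW2] by blast+
qed

text \<open>The relations of the old corner X pass to the new vertex. Its contour therefore lies
  outside all contours below X, or inside all contours above X, so T is a legitimate position of X
  in the old diagram.\<close>

lemma in_domain_slingshot:
  assumes D: "box_diagram n D" and r: "admissible_radii (Suc n) (slingshot (Suc n) X D) r"
    and p: "in_domain (Suc n) (slingshot (Suc n) X D) r p" and T: "T \<in> U2 (r (Suc n))"
  shows "admissible_radii n D r" "in_domain n D r (p(X := T))"
proof -
  have pos: "r k > 0" if "k \<in> {1..Suc n}" for k
    using r that unfolding admissible_radii_def by blast
  have less: "r j < r k" if "j \<in> {1..Suc n}" "k \<in> {1..Suc n}" "(Inner j, Inner k) \<in> prec (slingshot (Suc n) X D)" for j k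
    using r that unfolding admissible_radii_def by blast
  show "admissible_radii n D r"
    unfolding admissible_radii_def
  proof (intro conjI ballI impI)
    fix j k assume "j \<in> {1..n}" "k \<in> {1..n}" "(Inner j, Inner k) \<in> prec D"
    then show "r j < r k"
      using slingshot_prec_old[of "Inner j" "Inner k" D "Suc n" X] by (intro less) auto
  qed (use pos in auto)
  have Z: "(p(X := T)) Z \<in> D_minus (r k)"
    if k: "k \<in> {1..n}" and Z: "Z \<in> {CZ1, CZ2}" and rel: "(Inner k, Outer Z) \<in> prec D" for k Z
  proof (cases "Z = X")
    case True
    then have "r k < r (Suc n)"
      using slingshot_prec_old[OF rel, of "Suc n" X] k by (intro less) auto
    then show ?thesis using U2_D_minus[OF pos _ T] k True by simp
  next
    case False
    have "(Inner k, Outer Z) \<in> prec (slingshot (Suc n) X D) \<longrightarrow> p Z \<in> D_minus (r k)"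
      using p k Z unfolding in_domain_def by (meson atLeastAtMost_iff le_SucI)
    then show ?thesis
      using slingshot_prec_old[OF rel, of "Suc n" X] False by simp
  qed
  have W: "(p(X := T)) W \<in> D_plus (r k)"
    if k: "k \<in> {1..n}" and W: "W \<in> {CW1, CW2}" and rel: "(Outer W, Inner k) \<in> prec D" for k W
  proof (cases "W = X")
    case True
    then have "r (Suc n) < r k"
      using slingshot_prec_old[OF rel, of "Suc n" X] k by (intro less) auto
    then show ?thesis using U2_D_plus[OF pos _ T] k True by simp
  next
    case False
    have "(Outer W, Inner k) \<in> prec (slingshot (Suc n) X D) \<longrightarrow> p W \<in> D_plus (r k)"
      using p k W unfolding in_domain_def by (meson atLeastAtMost_iff le_SucI)
    then show ?thesis
      using slingshot_prec_old[OF rel, of "Suc n" X] False by simp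
  qed
  show "in_domain n D r (p(X := T))"
    unfolding in_domain_def using Z W by blast
qed

theorem box_integral_eq_ladder:
  assumes "box_diagram n D" "admissible_radii n D r" "in_domain n D r p"
  shows "box_integral n D r (p CZ1) (p CZ2) (p CW1) (p CW2) = ladder n (p CZ1) (p CZ2) (p CW1) (p CW2)"
  using assms
proof (induction arbitrary: p)
  case one
  note dom = in_domain_last[OF box_diagram.one one(2)]
  have r: "r 1 > 0" using one(1) by (simp add: admissible_radii_def)
  have "box_integral 1 one_loop r (p CZ1) (p CZ2) (p CW1) (p CW2) = loop_const * u2_integral (r 1)
      (\<lambda>T. inverse (det (T - p CZ1)) * inverse (det (T - p CZ2)) * inverse (det (T - p CW1)) * inverse (det (T - p CW2)))"
    by (simp add: box_integral_def box_integrand_def one_loop_def loop_const_def mult.assoc)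
  also have "\<dots> = ladder 1 (p CZ1) (p CZ2) (p CW1) (p CW2)"
    using one_loop[OF r dom(2-5)] by (simp add: ladder_def)
  finally show ?case .
next
  case (step n D X)
  note dom = in_domain_last[OF box_diagram.step[OF step.hyps] step.prems(2)]
  have r: "r (Suc n) > 0" using step.prems(1) by (simp add: admissible_radii_def)
  have IH: "box_integral n D r ((p(X := T)) CZ1) ((p(X := T)) CZ2) ((p(X := T)) CW1) ((p(X := T)) CW2) =
      ladder n ((p(X := T)) CZ1) ((p(X := T)) CZ2) ((p(X := T)) CW1) ((p(X := T)) CW2)"
    if "T \<in> U2 (r (Suc n))" for T
    by (rule step.IH[OF in_domain_slingshot[OF step.hyps step.prems that]])
  obtain Y Y' where Y: "neighbours X = (Y, Y')" by fastforce
  have pl: "place ((p(X := T)) CZ1) ((p(X := T)) CZ2) ((p(X := T)) CW1) ((p(X := T)) CW2) \<tau> =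
      (place (p CZ1) (p CZ2) (p CW1) (p CW2) \<tau>)(Outer X := T)" for T \<tau>
  proof
    fix v
    show "place ((p(X := T)) CZ1) ((p(X := T)) CZ2) ((p(X := T)) CW1) ((p(X := T)) CW2) \<tau> v =
      ((place (p CZ1) (p CZ2) (p CW1) (p CW2) \<tau>)(Outer X := T)) v"
    proof (cases v)
      case (Outer C)
      then show ?thesis by (cases C) auto
    qed simp
  qed
  have P: "place (p CZ1) (p CZ2) (p CW1) (p CW2) \<tau> (Outer C) = p C" for \<tau> C
    by (cases C) auto
  have "box_integral (Suc n) (slingshot (Suc n) X D) r (p CZ1) (p CZ2) (p CW1) (p CW2) =
    loop_const * u2_integral (r (Suc n)) (\<lambda>T. det (p Y - p Y') *
      inverse (det (T - p X)) * inverse (det (T - p Y)) * inverse (det (T - p Y')) *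
      box_integral n D r ((p(X := T)) CZ1) ((p(X := T)) CZ2) ((p(X := T)) CW1) ((p(X := T)) CW2))"
    using box_integral_slingshot[OF step.hyps Y pl] unfolding P .
  also have "\<dots> = loop_const * u2_integral (r (Suc n)) (\<lambda>T. det (p Y - p Y') *
      inverse (det (T - p X)) * inverse (det (T - p Y)) * inverse (det (T - p Y')) *
      ladder n ((p(X := T)) CZ1) ((p(X := T)) CZ2) ((p(X := T)) CW1) ((p(X := T)) CW2))"
    by (rule arg_cong[of _ _ "\<lambda>x. loop_const * x"], rule u2_integral_cong) (simp only: IH)
  also have "\<dots> = ladder (Suc n) (p CZ1) (p CZ2) (p CW1) (p CW2)"
  proof (cases X)
    case CZ1
    then show ?thesis using ladder_slingshot_Z1[OF r dom(2-5)] Y by simp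
  next
    \<comment> \<open>Exchanging the indices 1 and 2 on both sides preserves \<open>ladder\<close>
      and reduces the corners with index 2 to those with index 1.\<close>
    case CZ2
    then show ?thesis using ladder_slingshot_Z1[OF r dom(3,2,5,4)] Y
      by (simp add: ladder_sym[of _ "p CZ1"] ladder_sym[of _ _ _ "p CW1"])
  next
    case CW1
    then show ?thesis using ladder_slingshot_W1[OF r dom(2-5)] Y by simp
  next
    case CW2
    then show ?thesis using ladder_slingshot_W1[OF r dom(3,2,5,4)] Y
      by (simp add: ladder_sym[of _ "p CZ1"])
  qed
  finally show ?case .
qed

section \<open>Box operators\<close>

definition in_operator_domain :: "nat \<Rightarrow> diagram \<Rightarrow> (nat \<Rightarrow> real) \<Rightarrow> real \<Rightarrow> real \<Rightarrow> cmat \<Rightarrow> cmat \<Rightarrow> bool" where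
  "in_operator_domain n D r R1 R2 W1 W2 \<longleftrightarrow> admissible_radii n D r \<and> R1 > r_max n D r CZ1 \<and> R2 > r_max n D r CZ2 \<and>
     W1 \<in> D_plus (r_min n D r CW1) \<and> W2 \<in> D_plus (r_min n D r CW2)"

lemma D_plus_mono:
  assumes "0 < r" "r \<le> R" "W \<in> D_plus r"
  shows "W \<in> D_plus R"
proof -
  have "norm (v v* W) < R * norm v" if "v \<noteq> 0" for v
  proof -
    have "norm (v v* W) < r * norm v" using assms that D_plus_iff contrD by blast
    also have "\<dots> \<le> R * norm v" using assms(2) by (simp add: mult_right_mono)
    finally show ?thesis .
  qed
  then show ?thesis using assms D_plus_iff[of R W] by (simp add: contr_def)
qed

lemma operator_domain_bounds:
  assumes D: "box_diagram n D" and dom: "in_operator_domain n D r R1 R2 W1 W2" and k: "k \<in> {1..n}"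
  shows "(Inner k, Outer CZ1) \<in> prec D \<Longrightarrow> r k < R1" "(Inner k, Outer CZ2) \<in> prec D \<Longrightarrow> r k < R2"
    "(Outer CW1, Inner k) \<in> prec D \<Longrightarrow> W1 \<in> D_plus (r k)" "(Outer CW2, Inner k) \<in> prec D \<Longrightarrow> W2 \<in> D_plus (r k)"
proof -
  have pos: "r k > 0" if "k \<in> {1..n}" for k
    using dom that unfolding in_operator_domain_def admissible_radii_def by blast
  have max: "r k \<le> r_max n D r X" if "(Inner k, Outer X) \<in> prec D" for X
    unfolding r_max_def using that k by (intro Max_ge) auto
  have min: "r_min n D r X \<le> r k \<and> 0 < r_min n D r X" if "(Outer X, Inner k) \<in> prec D" for X
  proof -
    let ?S = "r ` {k \<in> {1..n}. (Outer X, Inner k) \<in> prec D}"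
    have "Min ?S \<in> ?S" using that k by (intro Min_in) auto
    then have "0 < Min ?S" using pos by auto
    moreover have "Min ?S \<le> r k" using that k by (intro Min_le) auto
    ultimately show ?thesis by (simp add: r_min_def)
  qed
  show "(Inner k, Outer CZ1) \<in> prec D \<Longrightarrow> r k < R1" "(Inner k, Outer CZ2) \<in> prec D \<Longrightarrow> r k < R2"
    using max dom unfolding in_operator_domain_def by force+
  show "(Outer CW1, Inner k) \<in> prec D \<Longrightarrow> W1 \<in> D_plus (r k)" "(Outer CW2, Inner k) \<in> prec D \<Longrightarrow> W2 \<in> D_plus (r k)"
    using min D_plus_mono dom unfolding in_operator_domain_def by blast+
qed

lemma box_operator_integral_eq:
  assumes D: "box_diagram n D" and dom: "in_operator_domain n D r R1 R2 W1 W2"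
  shows "box_operator_integral n D r R1 R2 \<phi>1 \<phi>2 W1 W2 = (\<i> / of_real (2 * pi ^ 3))\<^sup>2 *
     u2_integral R1 (\<lambda>Z1. u2_integral R2 (\<lambda>Z2.
       ladder n Z1 Z2 W1 W2 * deg_tilde \<phi>1 Z1 * deg_tilde \<phi>2 Z2 / det Z1 / det Z2))"
proof -
  have adm: "admissible_radii n D r" using dom unfolding in_operator_domain_def by blast
  have "box_integral n D r Z1 Z2 W1 W2 = ladder n Z1 Z2 W1 W2" if Z: "Z1 \<in> U2 R1" "Z2 \<in> U2 R2" for Z1 Z2
  proof -
    define p where "p = (\<lambda>X. case X of CZ1 \<Rightarrow> Z1 | CZ2 \<Rightarrow> Z2 | CW1 \<Rightarrow> W1 | CW2 \<Rightarrow> W2)"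
    have "in_domain n D r p"
      unfolding in_domain_def
    proof
      fix k assume k: "k \<in> {1..n}"
      have "r k > 0" using adm k unfolding admissible_radii_def by blast
      then show "(\<forall>Z\<in>{CZ1, CZ2}. (Inner k, Outer Z) \<in> prec D \<longrightarrow> p Z \<in> D_minus (r k)) \<and>
          (\<forall>W\<in>{CW1, CW2}. (Outer W, Inner k) \<in> prec D \<longrightarrow> p W \<in> D_plus (r k))"
        using operator_domain_bounds[OF D dom k] U2_D_minus Z by (auto simp: p_def)
    qed
    from box_integral_eq_ladder[OF D adm this] show ?thesis by (simp add: p_def)
  qed
  then show ?thesis
    unfolding box_operator_integral_def
    by (simp cong: u2_integral_cong)
qed

text \<open>The last vertex of D' lies between all corners, so its radius \<rho> lies below R1 and
  R2 and bounds W1 and W2. The rank function of D then spreads radii over the interval from \<rho>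
  to min R1 R2, whatever the order of D is.\<close>

lemma exists_operator_domain:
  assumes D: "box_diagram n D" and D': "box_diagram n D'" and dom: "in_operator_domain n D' r' R1 R2 W1 W2"
  obtains r where "in_operator_domain n D r R1 R2 W1 W2"
proof -
  note last = last_vertex_between
  have n: "n \<in> {1..n}" using last[OF D, of CZ1 CW1] by simp
  define \<rho> where "\<rho> = r' n"
  have \<rho>: "\<rho> > 0" using dom n unfolding in_operator_domain_def admissible_radii_def \<rho>_def by blast
  have bnd: "\<rho> < R1" "\<rho> < R2" "W1 \<in> D_plus \<rho>" "W2 \<in> D_plus \<rho>"
    using operator_domain_bounds[OF D' dom n] last[OF D', of CZ1 CW1] last[OF D', of CZ2 CW2]
    unfolding \<rho>_def by simp_all
  obtain h :: "vertex \<Rightarrow> real" and m M where mM: "m < M" and b: "\<And>v. m \<le> h v \<and> h v \<le> M"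
    and p: "prec D \<subseteq> {(u, v). u \<in> vertices n \<and> v \<in> vertices n \<and> h u < h v}"
    by (rule box_diagram_rank[OF D]) (rule that)
  \<comment> \<open>The summand 1 keeps the largest possible radius \<rho> + \<epsilon> (M - m)
    strictly below min R1 R2.\<close>
  define \<epsilon> where "\<epsilon> = (min R1 R2 - \<rho>) / (M - m + 1)"
  have \<epsilon>: "\<epsilon> > 0" using bnd mM by (simp add: \<epsilon>_def)
  have \<epsilon>R: "\<rho> + \<epsilon> * (M - m) < min R1 R2"
  proof -
    have "\<epsilon> * (M - m) < \<epsilon> * (M - m + 1)" using \<epsilon> by simp
    also have "\<dots> = min R1 R2 - \<rho>" using mM by (simp add: \<epsilon>_def)
    finally show ?thesis by linarith
  qed
  define r where "r = (\<lambda>k. \<rho> + \<epsilon> * (h (Inner k) - m))"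
  have ge: "\<rho> \<le> r k" for k using \<epsilon> b by (simp add: r_def)
  have lt: "r k < min R1 R2" for k
  proof -
    have "\<epsilon> * (h (Inner k) - m) \<le> \<epsilon> * (M - m)" using \<epsilon> b by simp
    then show ?thesis using \<epsilon>R by (simp add: r_def)
  qed
  have adm: "admissible_radii n D r"
    unfolding admissible_radii_def
  proof (intro conjI ballI impI)
    show "0 < r k" for k using ge[of k] \<rho> by linarith
    fix j k assume "(Inner j, Inner k) \<in> prec D"
    then have "h (Inner j) < h (Inner k)" using p by auto
    then show "r j < r k" using \<epsilon> by (simp add: r_def)
  qed
  have max: "r_max n D r Z < min R1 R2" if "Z \<in> {CZ1, CZ2}" for Z
  proof -
    have "n \<in> {k \<in> {1..n}. (Inner k, Outer Z) \<in> prec D}" using n last[OF D that, of CW1] by simp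
    then have ne: "r ` {k \<in> {1..n}. (Inner k, Outer Z) \<in> prec D} \<noteq> {}" by blast
    have "Max (r ` {k \<in> {1..n}. (Inner k, Outer Z) \<in> prec D}) \<in> range r"
      using Max_in[OF _ ne] by auto
    then obtain k where "r_max n D r Z = r k" unfolding r_max_def by blast
    then show ?thesis using lt by simp
  qed
  have min: "\<rho> \<le> r_min n D r W" if "W \<in> {CW1, CW2}" for W
  proof -
    have "n \<in> {k \<in> {1..n}. (Outer W, Inner k) \<in> prec D}" using n last[OF D _ that, of CZ1] by simp
    then have ne: "r ` {k \<in> {1..n}. (Outer W, Inner k) \<in> prec D} \<noteq> {}" by blast
    have "Min (r ` {k \<in> {1..n}. (Outer W, Inner k) \<in> prec D}) \<in> range r"
      using Min_in[OF _ ne] by auto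
    then obtain k where "r_min n D r W = r k" unfolding r_min_def by blast
    then show ?thesis using ge by simp
  qed
  have "r_max n D r CZ1 < R1" "r_max n D r CZ2 < R2"
    using max[of CZ1] max[of CZ2] by simp_all
  moreover have "W1 \<in> D_plus (r_min n D r CW1)" "W2 \<in> D_plus (r_min n D r CW2)"
    using D_plus_mono[OF \<rho> min bnd(3)] D_plus_mono[OF \<rho> min bnd(4)] by simp_all
  ultimately show ?thesis
    using adm that unfolding in_operator_domain_def by blast
qed

text \<open>For data allowed by D', suitable radii for D exist with the same R1, R2, W1, W2, and
  both operator integrals are then the same integral of \<open>ladder\<close>.\<close>

lemma is_box_operator_transfer:
  assumes D: "box_diagram n D" and D': "box_diagram n D'" and L: "is_box_operator n D L"
  shows "is_box_operator n D' L"
proof -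
  have "L (tensor \<phi>1 \<phi>2) W1 W2 = box_operator_integral n D' r R1 R2 \<phi>1 \<phi>2 W1 W2"
    if \<phi>: "\<phi>1 \<in> harmonic_polys" "\<phi>2 \<in> harmonic_polys" and dom: "in_operator_domain n D' r R1 R2 W1 W2"
    for \<phi>1 \<phi>2 r R1 R2 W1 W2
  proof -
    obtain r0 where r0: "in_operator_domain n D r0 R1 R2 W1 W2"
      using exists_operator_domain[OF D D' dom] .
    then have "L (tensor \<phi>1 \<phi>2) W1 W2 = box_operator_integral n D r0 R1 R2 \<phi>1 \<phi>2 W1 W2"
      using L \<phi> unfolding is_box_operator_def in_operator_domain_def by blast
    then show ?thesis
      unfolding box_operator_integral_eq[OF D r0] box_operator_integral_eq[OF D' dom] .
  qed
  then show ?thesis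
    using L unfolding is_box_operator_def in_operator_domain_def by blast
qed

theorem corollary15:
  fixes n :: nat and D D' :: diagram
  assumes "n \<ge> 1"
    and "box_diagram n D"
    and "box_diagram n D'"
  shows "box_operator n D = box_operator n D'"
proof -
  \<comment> \<open>The defining predicates coincide as functions of the operator, so the two
    definite descriptions denote the same thing.\<close>
  have "is_box_operator n D = is_box_operator n D'"
    using is_box_operator_transfer assms(2,3) by blast
  then show ?thesis
    unfolding box_operator_def by simp
qed

end
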